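(* Let $U\subset\mathbb{R}^n$ be open and let $g:U\to\mathbb{R}^n\setminus\{0\}$ be locally Lipschitz and satisfy Jacobi's integrability condition. Then the following three conditions are equivalent. (i) For any $x^*\in U$, there exists an open neighborhood $V$ of $x^*$ such that for any $x,y\in V$, $g(x)\cdot y\ge g(x)\cdot x$ implies $g(y)\cdot x\le g(y)\cdot y$. (ii) For any $x\in U$ and $v\in\mathbb{R}^n$, if $g(x)\cdot v=0$, then $\limsup_{t\downarrow 0}\frac{1}{t}\,v\cdot g(x+tv)\ge 0$. (iii) Every regular solution $u$ to $\nabla u(x)=\lambda(x)g(x)$ defined on a convex domain is quasi-convex.
   Context: A function on an open set is locally Lipschitz if it is Lipschitz on every compact subset; such a function is differentiable almost everywhere (Rademacher). Manifolds are embedded submanifolds of Euclidean space: $X\subset\mathbb{R}^N$ is an $m$-dimensional $C^1$ manifold if each point of $X$ has a relatively open neighborhood in $X$ that is $C^1$ diffeomorphic to an open subset of $\mathbb{R}^m$. $T_x(X)$ denotes the tangent space as a linear subspace of $\mathbb{R}^N$. A vector field $g$ is a normal vector field of $X$ if $g(x)\cdot v=0$ for all $x\in X$, $v\in T_x(X)$. The level sets of $u:V\to\mathbb{R}$ are the sets $u^{-1}(u(x))$, $x\in V$. Jacobi's integrability condition for $g$: for any $i,j,k\in\{1,\dots,n\}$, the equality $$g_i\left(\frac{\partial g_j}{\partial x_k}-\frac{\partial g_k}{\partial x_j}\right)+g_j\left(\frac{\partial g_k}{\partial x_i}-\frac{\partial g_i}{\partial x_k}\right)+g_k\left(\frac{\partial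 g_i}{\partial x_j}-\frac{\partial g_j}{\partial x_i}\right)=0$$ holds at almost every point of $U$. Normal solution: for $g:U\to\mathbb{R}^n\setminus\{0\}$ locally Lipschitz, a function $u:V\to\mathbb{R}$ is a normal solution to $\nabla u(x)=\lambda(x)g(x)$ if 1) $V$ is open and $V\subset U$; 2) $u$ is locally Lipschitz; 3) every level set of $u$ is an $(n-1)$-dimensional $C^1$ manifold; 4) $g$ is a normal vector field of every level set of $u$; 5) $u$ has no local maximum point and no local minimum point; 6) if $u$ is differentiable at $x$, then $\nabla u(x)\neq 0$. Regular solution: a normal solution $u:V\to\mathbb{R}$ such that $V$ is connected and, for every $x\in V$, the function $t\mapsto u(x+tg(x))$ is strictly increasing on some open interval containing $0$. $u$ is quasi-convex on a convex set $C$ if $u((1-t)x+ty)\le\max\{u(x),u(y)\}$ for all $x,y\in C$, $t\in[0,1]$. *)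

theory Defs
  imports "HOL-Analysis.Analysis"
begin

definition locally_lipschitz_on ::
    "'a::metric_space set \<Rightarrow> ('a \<Rightarrow> 'b::metric_space) \<Rightarrow> bool" where
  "locally_lipschitz_on U f \<longleftrightarrow>
     (\<forall>K. compact K \<and> K \<subseteq> U \<longrightarrow> (\<exists>L. L-lipschitz_on K f))"

definition partial_deriv :: "'n \<Rightarrow> (real ^ 'n::finite \<Rightarrow> real) \<Rightarrow> real ^ 'n \<Rightarrow> real" where
  "partial_deriv k f x = deriv (\<lambda>t. f (x + t *\<^sub>R axis k 1)) 0"

(* deriv is unspecified where the derivative does not exist; for locally Lipschitz g
   this concerns only a null subset of U. *)
definition jacobi_integrable :: "(real ^ 'n::finite) set \<Rightarrow> (real ^ 'n \<Rightarrow> real ^ 'n) \<Rightarrow> bool" where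
  "jacobi_integrable U g \<longleftrightarrow>
     (\<forall>i j k. AE x\<in>U in lebesgue.
        g x $ i * (partial_deriv k (\<lambda>y. g y $ j) x - partial_deriv j (\<lambda>y. g y $ k) x)
      + g x $ j * (partial_deriv i (\<lambda>y. g y $ k) x - partial_deriv k (\<lambda>y. g y $ i) x)
      + g x $ k * (partial_deriv j (\<lambda>y. g y $ i) x - partial_deriv i (\<lambda>y. g y $ j) x) = 0)"

(* A map on an arbitrary subset of a Euclidean space is C^1 if it extends to a C^1 map
   on an open neighbourhood of each point. *)
definition C1_map_on ::
    "'a::euclidean_space set \<Rightarrow> ('a \<Rightarrow> 'b::euclidean_space) \<Rightarrow> bool" where
  "C1_map_on A f \<longleftrightarrow>
     (\<forall>x\<in>A. \<exists>N F (F' :: 'a \<Rightarrow> 'a \<Rightarrow>\<^sub>L 'b). open N \<and> x \<in> N \<and>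
        (\<forall>y\<in>N. (F has_derivative blinfun_apply (F' y)) (at y)) \<and> continuous_on N F' \<and>
        (\<forall>y\<in>A \<inter> N. F y = f y))"

definition C1_diffeomorphic ::
    "'a::euclidean_space set \<Rightarrow> 'b::euclidean_space set \<Rightarrow> bool" where
  "C1_diffeomorphic A B \<longleftrightarrow>
     (\<exists>f h. homeomorphism A B f h \<and> C1_map_on A f \<and> C1_map_on B h)"

(* The model space R^m is represented by an m-dimensional linear subspace L of the ambient
   space, since m is not a type. All such L are linearly isomorphic, and one exists whenever
   m is at most the ambient dimension, as is the case for every nonempty m-manifold. *)
definition C1_manifold :: "nat \<Rightarrow> 'a::euclidean_space set \<Rightarrow> bool" where
  "C1_manifold m X \<longleftrightarrow>
     (\<forall>x\<in>X. \<exists>N L W. x \<in> N \<and> openin (top_of_set X) N \<and>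
        subspace (L :: 'a set) \<and> dim L = m \<and> openin (top_of_set L) W \<and>
        C1_diffeomorphic N W)"

(* Velocities at x of the C^1 curves in X through x; for a C^1 manifold X this is the
   usual linear subspace. *)
definition tangent_space :: "'a::euclidean_space set \<Rightarrow> 'a \<Rightarrow> 'a set" where
  "tangent_space X x =
     {v. \<exists>c e. 0 < e \<and> c C1_differentiable_on {-e<..<e} \<and> c ` {-e<..<e} \<subseteq> X \<and>
           c 0 = x \<and> (c has_vector_derivative v) (at 0)}"

definition normal_field :: "'a::euclidean_space set \<Rightarrow> ('a \<Rightarrow> 'a) \<Rightarrow> bool" where
  "normal_field X g \<longleftrightarrow> (\<forall>x\<in>X. \<forall>v\<in>tangent_space X x. g x \<bullet> v = 0)"

definition level_set :: "'a set \<Rightarrow> ('a \<Rightarrow> real) \<Rightarrow> 'a \<Rightarrow> 'a set" where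
  "level_set V u x = {y \<in> V. u y = u x}"

definition local_max_point :: "'a::topological_space set \<Rightarrow> ('a \<Rightarrow> real) \<Rightarrow> 'a \<Rightarrow> bool" where
  "local_max_point V u x \<longleftrightarrow> x \<in> V \<and> (\<forall>\<^sub>F y in at x within V. u y \<le> u x)"

definition local_min_point :: "'a::topological_space set \<Rightarrow> ('a \<Rightarrow> real) \<Rightarrow> 'a \<Rightarrow> bool" where
  "local_min_point V u x \<longleftrightarrow> x \<in> V \<and> (\<forall>\<^sub>F y in at x within V. u x \<le> u y)"

definition normal_solution ::
    "'a::euclidean_space set \<Rightarrow> ('a \<Rightarrow> 'a) \<Rightarrow> 'a set \<Rightarrow> ('a \<Rightarrow> real) \<Rightarrow> bool" where
  "normal_solution U g V u \<longleftrightarrow>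
     open V \<and> V \<subseteq> U \<and>
     locally_lipschitz_on V u \<and>
     (\<forall>x\<in>V. C1_manifold (DIM('a) - 1) (level_set V u x)) \<and>
     (\<forall>x\<in>V. normal_field (level_set V u x) g) \<and>
     (\<nexists>x. local_max_point V u x) \<and> (\<nexists>x. local_min_point V u x) \<and>
     (\<forall>x\<in>V. \<forall>d. GDERIV u x :> d \<longrightarrow> d \<noteq> 0)"

definition regular_solution ::
    "'a::euclidean_space set \<Rightarrow> ('a \<Rightarrow> 'a) \<Rightarrow> 'a set \<Rightarrow> ('a \<Rightarrow> real) \<Rightarrow> bool" where
  "regular_solution U g V u \<longleftrightarrow>
     normal_solution U g V u \<and> connected V \<and>
     (\<forall>x\<in>V. \<exists>a b. a < 0 \<and> 0 < b \<and> (\<forall>t\<in>{a<..<b}. x + t *\<^sub>R g x \<in> V) \<and>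
        strict_mono_on {a<..<b} (\<lambda>t. u (x + t *\<^sub>R g x)))"

definition quasi_convex_on :: "'a::real_vector set \<Rightarrow> ('a \<Rightarrow> real) \<Rightarrow> bool" where
  "quasi_convex_on C u \<longleftrightarrow>
     (\<forall>x\<in>C. \<forall>y\<in>C. \<forall>t\<in>{0..1}. u ((1 - t) *\<^sub>R x + t *\<^sub>R y) \<le> max (u x) (u y))"

end

theory Submission
  imports Defs
begin

text \<open>Along a segment with direction \<open>v\<close>, the function \<open>t \<mapsto> g (x + t v) \<bullet> v\<close> obeys a linear Dini inequality
  under (ii), since the component of \<open>v\<close> along \<open>g\<close> only contributes a multiple of the function itself.
  Hence once nonnegative it stays nonnegative, which is (i). Along segments a regular solution
  increases strictly where \<open>g \<bullet> v > 0\<close> (its level sets are tangent to the orthogonal complement of \<open>g\<close>) and has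
  derivative zero where \<open>g \<bullet> v = 0\<close>, so the sign pattern gives quasi-convexity, (iii).

  For (iii) \<open>\<Longrightarrow>\<close> (ii) one needs a regular solution near every point, that is, a Frobenius theorem for a
  Lipschitz field with Jacobi's condition almost everywhere. Normalise \<open>g\<close> to \<open>w\<close> with \<open>w \<bullet> e = 1\<close> and build the
  leaves as graphs over the complement of \<open>e\<close> by solving an ODE along rays. Averaging \<open>w\<close> over balls of radius
  \<open>\<epsilon>\<close> gives \<open>C\<^sup>1\<close> fields whose integrability defect is \<open>O(\<epsilon>)\<close> uniformly, because the condition is linear in the
  derivatives with coefficients varying by \<open>O(\<epsilon>)\<close>. For these the graphs satisfy the expected first-order
  equation up to \<open>O(\<epsilon>)\<close>, and one lets \<open>\<epsilon>\<close> tend to zero.\<close>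

section \<open>Dini inequalities and monotonicity of the field\<close>

text \<open>Condition (ii) is only a limsup, so from each point of a segment it controls some later
  point and not all of them; hence the monotonicity lemmas ask for one good \<open>s\<close> after
  each \<open>t\<close> and argue with extrema of continuous functions. The obstacle to building
  leaves is that Jacobi's condition holds off a null set, while a leaf and the rays that sweep it
  out are null sets themselves, so the condition cannot be evaluated along them. Averages see only
  full-measure information. The indicator of a ball suffices as kernel: the almost everywhere
  partial derivatives are bounded, and translating the kernel is continuous in total variation, so
  the averaged field has uniformly continuous partial derivatives. Their modulus may degenerate with
  \<epsilon>; it is therefore eliminated for each fixed \<epsilon>, by adding up small increments
  along a segment, and only then \<epsilon> tends to zero. Rays are kept so short that
  \<open>K * norm a \<le> 1 / 4\<close>, which makes the Picard map a contraction over the whole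
  unit time interval and lets a maximum argument replace Gronwall's inequality.\<close>

text \<open>Adding \<open>\<eta> * t\<close> turns every admissible step into a strict gain, so the
  maximum of the perturbed function can only sit at \<open>b\<close>. The maximum spares any
  iteration of the steps.\<close>

lemma dini_nondecreasing:
  fixes f :: "real \<Rightarrow> real"
  assumes ab: "a \<le> b" and cont: "continuous_on {a..b} f"
    and step: "\<And>t \<eta>. \<lbrakk>a \<le> t; t < b; 0 < \<eta>\<rbrakk> \<Longrightarrow> \<exists>s. t < s \<and> s \<le> b \<and> - \<eta> * (s - t) \<le> f s - f t"
  shows "f a \<le> f b"
proof (rule field_le_epsilon)
  fix e :: real assume e: "0 < e"
  define \<eta> where "\<eta> = e / (b - a + 1)"
  have \<eta>: "0 < \<eta>" using e ab by (simp add: \<eta>_def)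
  define h where "h = (\<lambda>t. f t + \<eta> * t)"
  have "continuous_on {a..b} h" unfolding h_def by (intro continuous_intros cont)
  then obtain m where m: "m \<in> {a..b}" "\<And>t. t \<in> {a..b} \<Longrightarrow> h t \<le> h m"
    using continuous_attains_sup[of "{a..b}" h] ab by auto
  have "m = b"
  proof (rule ccontr)
    assume "m \<noteq> b"
    then have "a \<le> m" "m < b" using m(1) by auto
    \<comment> \<open>The step is taken with half of \<open>\<eta>\<close>; the other half is the
      strict gain.\<close>
    then obtain s where s: "m < s" "s \<le> b" "- (\<eta> / 2) * (s - m) \<le> f s - f m"
      using step[of m "\<eta> / 2"] \<eta> by auto
    have "h s - h m \<ge> (\<eta> / 2) * (s - m)"
      using s(3) by (simp add: h_def field_simps)
    moreover have "(\<eta> / 2) * (s - m) > 0" using s(1) \<eta> by simp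
    ultimately have "h m < h s" by linarith
    moreover have "h s \<le> h m" using m s \<open>a \<le> m\<close> by auto
    ultimately show False by simp
  qed
  then have "f a + \<eta> * a \<le> f b + \<eta> * b" using m(2)[of a] ab by (simp add: h_def)
  moreover have "\<eta> * (b - a) \<le> e" using e ab by (simp add: \<eta>_def divide_simps)
  ultimately show "f a \<le> f b + e" by (simp add: algebra_simps)
qed

text \<open>A Gronwall argument by contradiction: beyond the last point \<open>t0\<close> where
  \<open>f\<close> is nonnegative, slopes are bounded below in terms of
  \<open>C * \<bar>f t\<bar>\<close>. On a stretch so short that \<open>C\<close> times its length
  is below 1, \<open>f\<close> cannot fall from \<open>f t0 \<ge> 0\<close> to its own negative
  minimum.\<close>

lemma dini_sign:
  fixes f :: "real \<Rightarrow> real"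
  assumes ab: "a \<le> b" and cont: "continuous_on {a..b} f" and C: "0 \<le> C"
    and step: "\<And>t \<eta> \<delta>. \<lbrakk>a \<le> t; t < b; 0 < \<eta>; 0 < \<delta>\<rbrakk> \<Longrightarrow>
          \<exists>s. t < s \<and> s < t + \<delta> \<and> - (C * \<bar>f t\<bar> + \<eta>) * (s - t) \<le> f s - f t"
    and fa: "0 \<le> f a"
  shows "0 \<le> f b"
proof (rule ccontr)
  assume neg: "\<not> 0 \<le> f b"
  define Z where "Z = {t \<in> {a..b}. 0 \<le> f t}"
  have Zcl: "compact Z"
  proof -
    have "closed ({a..b} \<inter> f -` {0..})"
      by (intro continuous_closed_preimage cont) auto
    moreover have "Z = {a..b} \<inter> f -` {0..}" by (auto simp: Z_def)
    ultimately show ?thesis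
      by (metis Int_lower1 bounded_closed_interval bounded_subset compact_eq_bounded_closed)
  qed
  have "a \<in> Z" using fa ab by (simp add: Z_def)
  then obtain t0 where t0: "t0 \<in> Z" "\<And>t. t \<in> Z \<Longrightarrow> t \<le> t0"
    using compact_attains_sup[OF Zcl] by auto
  have t0b: "t0 < b" "a \<le> t0" using t0(1) neg by (auto simp: Z_def less_le)
  have negt: "f t < 0" if "t0 < t" "t \<le> b" for t
    using t0(2)[of t] that t0b by (force simp: Z_def not_le)
  define \<tau> where "\<tau> = min b (t0 + 1 / (2 * C + 1))"
  have \<tau>: "t0 < \<tau>" "\<tau> \<le> b" "C * (\<tau> - t0) < 1"
  proof -
    show "t0 < \<tau>" "\<tau> \<le> b" using t0b C by (auto simp: \<tau>_def)
    have "C * (\<tau> - t0) \<le> C * (1 / (2 * C + 1))"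
      using C by (intro mult_left_mono) (auto simp: \<tau>_def)
    also have "\<dots> < 1" using C by (simp add: divide_simps)
    finally show "C * (\<tau> - t0) < 1" .
  qed
  have "continuous_on {t0..\<tau>} f" using \<tau> t0b by (intro continuous_on_subset[OF cont]) auto
  then obtain m where m: "m \<in> {t0..\<tau>}" "\<And>t. t \<in> {t0..\<tau>} \<Longrightarrow> f m \<le> f t"
    using continuous_attains_inf[of "{t0..\<tau>}" f] \<tau> by auto
  have fm: "f m < 0" using m(2)[of \<tau>] negt[of \<tau>] \<tau> by auto
  have mt0: "t0 < m" using fm t0(1) m(1) by (cases "m = t0") (auto simp: Z_def)
  have "f t0 + C * (- f m) * t0 \<le> f m + C * (- f m) * m"
  proof (rule dini_nondecreasing[where f = "\<lambda>t. f t + C * (- f m) * t"])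
    show "t0 \<le> m" using mt0 by simp
    show "continuous_on {t0..m} (\<lambda>t. f t + C * (- f m) * t)"
      using m(1) \<tau> t0b by (intro continuous_intros continuous_on_subset[OF cont]) auto
    fix t \<eta> :: real assume t: "t0 \<le> t" "t < m" "0 < \<eta>"
    obtain s where s: "t < s" "s < t + (m - t)" "- (C * \<bar>f t\<bar> + \<eta>) * (s - t) \<le> f s - f t"
      using step[of t \<eta> "m - t"] t t0b m(1) \<tau> by auto
    \<comment> \<open>At \<open>t0\<close> itself this needs \<open>f t0 = 0\<close>, which follows
      by continuity because \<open>f\<close> is negative immediately afterwards.\<close>
    have "\<bar>f t\<bar> \<le> - f m"
    proof (cases "t = t0")
      case True
      have "f t0 \<le> 0"
      proof (rule ccontr)
        assume "\<not> f t0 \<le> 0"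
        then obtain d where "d > 0" "\<And>x. x \<in> {a..b} \<Longrightarrow> dist x t0 < d \<Longrightarrow> dist (f x) (f t0) < f t0"
          using cont t0(1) unfolding continuous_on_iff Z_def
          by (metis (no_types, lifting) mem_Collect_eq not_le)
        moreover define s where "s = t0 + min (d/2) (b - t0)"
        ultimately have "t0 < s" "s \<le> b" "dist s t0 < d"
          using t0b by (auto simp: dist_real_def min_def)
        moreover from this have "\<bar>f s - f t0\<bar> < f t0"
          using \<open>\<And>x. x \<in> {a..b} \<Longrightarrow> dist x t0 < d \<Longrightarrow> dist (f x) (f t0) < f t0\<close>[of s] t0b
          by (auto simp: dist_real_def)
        ultimately show False using negt[of s] by auto
      qed
      with t0(1) True fm show ?thesis by (auto simp: Z_def)
    next
      case False
      then show ?thesis using negt[of t] m(2)[of t] t m(1) \<tau> by auto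
    qed
    then have "C * \<bar>f t\<bar> * (s - t) \<le> C * (- f m) * (s - t)"
      using C s(1) by (intro mult_right_mono mult_left_mono) auto
    with s(3) have "- \<eta> * (s - t) \<le> f s + C * (- f m) * s - (f t + C * (- f m) * t)"
      by (simp add: algebra_simps)
    then show "\<exists>s>t. s \<le> m \<and> - \<eta> * (s - t) \<le> f s + C * (- f m) * s - (f t + C * (- f m) * t)"
      using s by (intro exI[of _ s]) auto
  qed
  moreover have "0 \<le> f t0" using t0(1) by (simp add: Z_def)
  ultimately have "- f m \<le> C * (m - t0) * (- f m)" by (simp add: algebra_simps)
  moreover have "C * (m - t0) < 1"
  proof -
    have "C * (m - t0) \<le> C * (\<tau> - t0)" using C m(1) by (intro mult_left_mono) auto
    then show ?thesis using \<tau>(3) by simp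
  qed
  then have "C * (m - t0) * (- f m) < 1 * (- f m)" using fm by (intro mult_strict_right_mono) auto
  ultimately show False by simp
qed

lemma locally_lipschitz_on_imp_continuous_on:
  fixes f :: "'a::euclidean_space \<Rightarrow> 'b::metric_space"
  assumes "open U" "locally_lipschitz_on U f"
  shows "continuous_on U f"
proof (rule continuous_at_imp_continuous_on, rule ballI)
  fix x assume "x \<in> U"
  then obtain r where r: "0 < r" "cball x r \<subseteq> U" using assms(1) open_contains_cball by blast
  then obtain L where "L-lipschitz_on (cball x r) f"
    using assms(2) unfolding locally_lipschitz_on_def by (meson compact_cball)
  then have "continuous_on (ball x r) f"
    by (meson ball_subset_cball continuous_on_subset lipschitz_on_continuous_on)
  then show "isCont f x" using r by (simp add: continuous_on_eq_continuous_at)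
qed

section \<open>Equivalence of the two monotonicity conditions on the field\<close>

definition pseudo_monotone_on :: "'a::real_inner set \<Rightarrow> ('a \<Rightarrow> 'a) \<Rightarrow> bool" where
  "pseudo_monotone_on V g \<longleftrightarrow> (\<forall>x\<in>V. \<forall>y\<in>V. g x \<bullet> x \<le> g x \<bullet> y \<longrightarrow> g y \<bullet> x \<le> g y \<bullet> y)"

definition tangentially_monotone_on :: "'a::real_inner set \<Rightarrow> ('a \<Rightarrow> 'a) \<Rightarrow> bool" where
  "tangentially_monotone_on U g \<longleftrightarrow> (\<forall>x\<in>U. \<forall>v. g x \<bullet> v = 0 \<longrightarrow>
     0 \<le> Limsup (at_right 0) (\<lambda>t. ereal (1 / t * (v \<bullet> g (x + t *\<^sub>R v)))))"

lemma line_tendsto: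
  fixes x v :: "'a::real_normed_vector"
  shows "((\<lambda>t. x + t *\<^sub>R v) \<longlongrightarrow> x) (at (0::real) within S)"
  by (auto intro!: tendsto_eq_intros)

lemma eventually_line_in_open:
  fixes x v :: "'a::real_normed_vector"
  assumes "open V" "x \<in> V"
  shows "\<forall>\<^sub>F t in at (0::real) within S. x + t *\<^sub>R v \<in> V"
  using line_tendsto assms by (rule topological_tendstoD)

text \<open>For \<open>g x \<bullet> v = 0\<close> the points \<open>x\<close> and
  \<open>x + t *\<^sub>R v\<close> satisfy the premise of (i) with equality, and its conclusion
  makes the quotient nonnegative for every small positive \<open>t\<close>, which is more than a
  limsup bound.\<close>

lemma pseudo_monotone_imp_tangentially_monotone:
  fixes g :: "'a::euclidean_space \<Rightarrow> 'a"
  assumes "\<And>z. z \<in> U \<Longrightarrow> \<exists>V. open V \<and> z \<in> V \<and> V \<subseteq> U \<and> pseudo_monotone_on V g"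
  shows "tangentially_monotone_on U g"
  unfolding tangentially_monotone_on_def
proof (intro ballI allI impI)
  fix x v assume x: "x \<in> U" and v: "g x \<bullet> v = 0"
  obtain V where V: "open V" "x \<in> V" "pseudo_monotone_on V g" using assms[OF x] by auto
  have "\<forall>\<^sub>F t in at_right 0. 0 \<le> ereal (1 / t * (v \<bullet> g (x + t *\<^sub>R v)))"
    using eventually_line_in_open[OF V(1,2), of v "{0<..}"] eventually_at_right_less[of 0]
  proof eventually_elim
    case (elim t)
    have "g x \<bullet> x \<le> g x \<bullet> (x + t *\<^sub>R v)" using v by (simp add: inner_add_right)
    then have "g (x + t *\<^sub>R v) \<bullet> x \<le> g (x + t *\<^sub>R v) \<bullet> (x + t *\<^sub>R v)"
      using V(2,3) elim unfolding pseudo_monotone_on_def by blast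
    then have "0 \<le> t * (v \<bullet> g (x + t *\<^sub>R v))"
      by (simp add: inner_add_left inner_add_right inner_commute)
    then show ?case using elim by (simp add: zero_le_mult_iff)
  qed
  then show "0 \<le> Limsup (at_right 0) (\<lambda>t. ereal (1 / t * (v \<bullet> g (x + t *\<^sub>R v))))"
    by (intro le_Limsup) auto
qed

text \<open>A nonnegative limsup bounds the quotient from below for arbitrarily small
  \<open>t\<close> only; this frequent form is what \<open>dini_sign\<close> can consume.\<close>

lemma tangentially_monotoneD:
  assumes "tangentially_monotone_on U g" "x \<in> U" "g x \<bullet> v = 0" "0 < \<eta>"
  shows "\<exists>\<^sub>F t in at_right 0. - \<eta> * t \<le> v \<bullet> g (x + t *\<^sub>R v)"
proof (rule ccontr)
  assume "\<not> ?thesis"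
  then have "\<forall>\<^sub>F t in at_right 0. v \<bullet> g (x + t *\<^sub>R v) < - \<eta> * t"
    by (simp add: not_frequently not_le)
  then have "\<forall>\<^sub>F t in at_right 0. ereal (1 / t * (v \<bullet> g (x + t *\<^sub>R v))) \<le> ereal (- \<eta>)"
    using eventually_at_right_less[of 0] by eventually_elim (simp add: field_simps)
  then have "Limsup (at_right 0) (\<lambda>t. ereal (1 / t * (v \<bullet> g (x + t *\<^sub>R v)))) \<le> ereal (- \<eta>)"
    by (rule Limsup_bounded)
  moreover have "0 \<le> Limsup (at_right 0) (\<lambda>t. ereal (1 / t * (v \<bullet> g (x + t *\<^sub>R v))))"
    using assms unfolding tangentially_monotone_on_def by blast
  ultimately have "(0::ereal) \<le> ereal (- \<eta>)" by (rule order_trans[rotated])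
  then show False using assms(4) by simp
qed

text \<open>Along a segment, \<open>g (x + t v) \<bullet> v\<close> satisfies a linear Dini inequality: split \<open>v\<close> into its
  component along \<open>g\<close> and the tangential rest, to which the hypothesis applies.\<close>

lemma tangentially_monotone_segment:
  fixes g :: "'a::euclidean_space \<Rightarrow> 'a"
  assumes U: "open U" and g0: "\<And>x. x \<in> U \<Longrightarrow> g x \<noteq> 0" and lip: "locally_lipschitz_on U g"
    and mono: "tangentially_monotone_on U g"
    and seg: "\<And>t. t \<in> {0..1} \<Longrightarrow> x + t *\<^sub>R v \<in> U"
    and ab: "0 \<le> a" "a \<le> b" "b \<le> 1" and fa: "0 \<le> g (x + a *\<^sub>R v) \<bullet> v"
  shows "0 \<le> g (x + b *\<^sub>R v) \<bullet> v"
proof -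
  define f where "f = (\<lambda>t. g (x + t *\<^sub>R v) \<bullet> v)"
  have contg: "continuous_on U g" using locally_lipschitz_on_imp_continuous_on U lip by blast
  define S where "S = (\<lambda>t. x + t *\<^sub>R v) ` {0..1}"
  have S: "compact S" "S \<subseteq> U" "S \<noteq> {}"
    unfolding S_def using seg by (auto intro!: compact_continuous_image continuous_intros)
  obtain r where r: "0 < r" "(\<Union>s\<in>S. cball s r) \<subseteq> U"
    using compact_subset_open_imp_cball_epsilon_subset[OF S(1) U S(2)] by blast
  \<comment> \<open>A compact tube around the segment: the tangential direction \<open>v'\<close>
    leaves the segment, and the Lipschitz constant must also cover
    \<open>p + s *\<^sub>R v'\<close>.\<close>
  define K where "K = (\<Union>s\<in>S. cball s r)"
  have "K = {s + w |s w. s \<in> S \<and> w \<in> cball 0 r}"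
    unfolding K_def by (force simp: dist_norm norm_minus_commute intro: exI[of _ "_ - _"])
  then have K: "compact K" using compact_sums[OF S(1) compact_cball[of 0 r]] by simp
  have KU: "K \<subseteq> U" using r by (simp add: K_def)
  obtain L where L: "L-lipschitz_on K g" using lip K KU unfolding locally_lipschitz_on_def by blast
  have L0: "0 \<le> L" using L by (rule lipschitz_on_nonneg)
  have "continuous_on S (\<lambda>x. norm (g x))" 
    using contg S by (intro continuous_intros) (auto intro: continuous_on_subset)
  then obtain s0 where s0: "s0 \<in> S" "\<And>s. s \<in> S \<Longrightarrow> norm (g s0) \<le> norm (g s)"
    using continuous_attains_inf[OF S(1,3)] by blast
  define m where "m = norm (g s0)"
  have m: "0 < m" using s0(1) S g0 by (auto simp: m_def)
  have "0 \<le> f b"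
  proof (rule dini_sign[where f = f and C = "2 * L * norm v / m" and a = a])
    show "a \<le> b" by fact
    show "continuous_on {a..b} f"
      unfolding f_def using ab seg
      by (intro continuous_intros continuous_on_compose2[OF contg]) auto
    show "0 \<le> 2 * L * norm v / m" using L0 m by simp
    show "0 \<le> f a" using fa by (simp add: f_def)
    fix t \<eta> \<delta> :: real assume t: "a \<le> t" "t < b" and pos: "0 < \<eta>" "0 < \<delta>"
    define p where "p = x + t *\<^sub>R v"
    have pS: "p \<in> S" unfolding S_def p_def using t ab by auto
    then have pU: "p \<in> U" using S by auto
    have gp: "g p \<noteq> 0" and mp: "m \<le> norm (g p)" using g0 pU s0(2)[OF pS] by (auto simp: m_def)
    define c where "c = f t / (norm (g p))\<^sup>2"
    define v' where "v' = v - c *\<^sub>R g p"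
    have fp: "f t = g p \<bullet> v" by (simp add: f_def p_def)
    have gpp: "g p \<bullet> g p = (norm (g p))\<^sup>2" by (simp add: power2_norm_eq_inner)
    have tang: "g p \<bullet> v' = 0" using gp by (simp add: v'_def inner_diff_right c_def fp gpp)
    have nv': "norm v' \<le> norm v"
    proof -
      have v_eq: "v = v' + c *\<^sub>R g p" by (simp add: v'_def)
      have "v \<bullet> v = v' \<bullet> v' + c\<^sup>2 * (g p \<bullet> g p)"
        using tang by (simp add: v_eq inner_add_left inner_add_right inner_commute power2_eq_square)
      then have "(norm v')\<^sup>2 \<le> (norm v)\<^sup>2" by (simp add: power2_norm_eq_inner)
      then show ?thesis by (rule power2_le_imp_le) simp
    qed
    have cn: "norm (c *\<^sub>R g p) \<le> \<bar>f t\<bar> / m"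
    proof -
      have "norm (c *\<^sub>R g p) = \<bar>f t\<bar> / norm (g p)" using gp by (simp add: c_def power2_eq_square)
      also have "\<dots> \<le> \<bar>f t\<bar> / m" using mp m by (intro divide_left_mono mult_pos_pos) auto
      finally show ?thesis .
    qed
    have nearK: "\<forall>\<^sub>F s in at_right 0. p + s *\<^sub>R w \<in> K" for w
      using eventually_line_in_open[OF open_ball centre_in_ball[THEN iffD2, OF r(1)], of p w "{0<..}"]
      by eventually_elim (use pS in \<open>auto simp: K_def intro!: bexI[of _ p]\<close>)
    have ev: "\<forall>\<^sub>F s in at_right 0. 0 < s \<and> s < \<delta> \<and> p + s *\<^sub>R v \<in> K \<and> p + s *\<^sub>R v' \<in> K"
      using nearK[of v] nearK[of v'] eventually_at_right_real[OF pos(2)]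
      by eventually_elim auto
    have "\<exists>\<^sub>F s in at_right 0. - \<eta> * s \<le> v' \<bullet> g (p + s *\<^sub>R v') \<and>
        (0 < s \<and> s < \<delta> \<and> p + s *\<^sub>R v \<in> K \<and> p + s *\<^sub>R v' \<in> K)"
      by (rule frequently_rev_mp[OF tangentially_monotoneD[OF mono pU tang pos(1)]],
          rule eventually_mono[OF ev]) simp
    then obtain s where s: "- \<eta> * s \<le> v' \<bullet> g (p + s *\<^sub>R v')" "0 < s" "s < \<delta>"
      "p + s *\<^sub>R v \<in> K" "p + s *\<^sub>R v' \<in> K"
      using frequently_ex by blast
    have pK: "p \<in> K" using pS r(1) by (auto simp: K_def intro!: bexI[of _ p])
    have e1: "norm (g (p + s *\<^sub>R v) - g (p + s *\<^sub>R v')) \<le> L * s * norm (c *\<^sub>R g p)"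
    proof -
      have "dist (g (p + s *\<^sub>R v)) (g (p + s *\<^sub>R v')) \<le> L * dist (p + s *\<^sub>R v) (p + s *\<^sub>R v')"
        using lipschitz_onD[OF L s(4,5)] .
      moreover have "(p + s *\<^sub>R v) - (p + s *\<^sub>R v') = s *\<^sub>R (c *\<^sub>R g p)"
        by (simp add: v'_def algebra_simps)
      then have "dist (p + s *\<^sub>R v) (p + s *\<^sub>R v') = s * norm (c *\<^sub>R g p)"
        using s(2) by (simp add: dist_norm abs_mult)
      ultimately show ?thesis by (simp add: dist_norm)
    qed
    have e2: "norm (g (p + s *\<^sub>R v) - g p) \<le> L * s * norm v"
      using lipschitz_onD[OF L s(4) pK] s(2) by (simp add: dist_norm mult.assoc)
    have "f (t + s) = v \<bullet> g (p + s *\<^sub>R v)"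
      by (simp add: f_def p_def algebra_simps inner_commute)
    \<comment> \<open>The first term is controlled by (ii), and the last one is \<open>f t\<close>
      itself. The two terms with differences are each at most
      \<open>norm v * (L * s * (\<bar>f t\<bar> / m))\<close>, which yields the factor 2 in the
      constant \<open>C\<close>.\<close>
    also have "\<dots> = v' \<bullet> g (p + s *\<^sub>R v') + v' \<bullet> (g (p + s *\<^sub>R v) - g (p + s *\<^sub>R v'))
        + (c *\<^sub>R g p) \<bullet> (g (p + s *\<^sub>R v) - g p) + c * (g p \<bullet> g p)"
      by (simp add: v'_def inner_diff_left inner_diff_right)
    also have "c * (g p \<bullet> g p) = f t" using gp by (simp add: c_def gpp)
    finally have eq: "f (t + s) - f t = v' \<bullet> g (p + s *\<^sub>R v')
        + v' \<bullet> (g (p + s *\<^sub>R v) - g (p + s *\<^sub>R v')) + (c *\<^sub>R g p) \<bullet> (g (p + s *\<^sub>R v) - g p)"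
      by simp
    have b1: "\<bar>v' \<bullet> (g (p + s *\<^sub>R v) - g (p + s *\<^sub>R v'))\<bar> \<le> norm v * (L * s * (\<bar>f t\<bar> / m))"
    proof -
      have "\<bar>v' \<bullet> (g (p + s *\<^sub>R v) - g (p + s *\<^sub>R v'))\<bar>
          \<le> norm v' * norm (g (p + s *\<^sub>R v) - g (p + s *\<^sub>R v'))"
        by (rule Cauchy_Schwarz_ineq2)
      also have "\<dots> \<le> norm v * (L * s * norm (c *\<^sub>R g p))"
        using nv' e1 by (intro mult_mono) auto
      also have "\<dots> \<le> norm v * (L * s * (\<bar>f t\<bar> / m))"
        using cn L0 s(2) by (intro mult_left_mono) auto
      finally show ?thesis .
    qed
    have b2: "\<bar>(c *\<^sub>R g p) \<bullet> (g (p + s *\<^sub>R v) - g p)\<bar> \<le> (\<bar>f t\<bar> / m) * (L * s * norm v)"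
    proof -
      have "\<bar>(c *\<^sub>R g p) \<bullet> (g (p + s *\<^sub>R v) - g p)\<bar> \<le> norm (c *\<^sub>R g p) * norm (g (p + s *\<^sub>R v) - g p)"
        by (rule Cauchy_Schwarz_ineq2)
      also have "\<dots> \<le> (\<bar>f t\<bar> / m) * (L * s * norm v)"
        using cn e2 m by (intro mult_mono) auto
      finally show ?thesis .
    qed
    have "- \<eta> * s - 2 * (norm v * (L * s * (\<bar>f t\<bar> / m))) \<le> f (t + s) - f t"
      using eq b1 b2 s(1) by (simp add: abs_le_iff mult.commute mult.left_commute)
    then have "- (2 * L * norm v / m * \<bar>f t\<bar> + \<eta>) * (t + s - t) \<le> f (t + s) - f t"
      by (simp add: algebra_simps)
    then show "\<exists>s. t < s \<and> s < t + \<delta> \<and> - (2 * L * norm v / m * \<bar>f t\<bar> + \<eta>) * (s - t) \<le> f s - f t"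
      using s(2,3) by (intro exI[of _ "t + s"]) auto
  qed
  then show ?thesis by (simp add: f_def)
qed

lemma tangentially_monotone_imp_pseudo_monotone:
  fixes g :: "'a::euclidean_space \<Rightarrow> 'a"
  assumes "open U" "\<And>x. x \<in> U \<Longrightarrow> g x \<noteq> 0" "locally_lipschitz_on U g"
    and "tangentially_monotone_on U g" and V: "convex V" "V \<subseteq> U"
  shows "pseudo_monotone_on V g"
  unfolding pseudo_monotone_on_def
proof (intro ballI impI)
  fix x y assume xy: "x \<in> V" "y \<in> V" "g x \<bullet> x \<le> g x \<bullet> y"
  have "x + t *\<^sub>R (y - x) \<in> U" if "t \<in> {0..1}" for t
    using convexD_alt[OF V(1) xy(1,2), of t] that V(2) by (auto simp: algebra_simps)
  from tangentially_monotone_segment[OF assms(1-4) this, of 0 1] xy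
  show "g y \<bullet> x \<le> g y \<bullet> y" by (simp add: inner_diff_right)
qed

section \<open>Level sets of solutions\<close>

lemma strict_increase_on_interval:
  fixes f :: "real \<Rightarrow> real"
  assumes ab: "a < b" and cont: "continuous_on {a..b} f"
    and step: "\<And>t. \<lbrakk>a \<le> t; t < b\<rbrakk> \<Longrightarrow> \<exists>s. t < s \<and> s \<le> b \<and> f t < f s"
  shows "f a < f b"
proof -
  obtain m where m: "m \<in> {a..b}" "\<And>t. t \<in> {a..b} \<Longrightarrow> f t \<le> f m"
    using continuous_attains_sup[of "{a..b}" f] ab cont by auto
  have max_eq_b: "t = b" if t: "t \<in> {a..b}" "f m \<le> f t" for t
  proof (rule ccontr)
    assume "t \<noteq> b"
    then obtain s where "t < s" "s \<le> b" "f t < f s" using step[of t] t by auto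
    with m(2)[of s] t show False by auto
  qed
  have "f a < f m" using max_eq_b[of a] ab by fastforce
  moreover have "m = b" using max_eq_b[of m] m(1) by simp
  ultimately show ?thesis by simp
qed

section \<open>Tangent spaces of embedded manifolds and of level sets\<close>

lemma has_derivative_line:
  assumes "(F has_derivative F') (at (x + t *\<^sub>R v))"
  shows "((\<lambda>s. F (x + s *\<^sub>R v)) has_vector_derivative F' v) (at t)"
proof -
  have lin: "linear F'" using assms by (simp add: has_derivative_linear)
  have "((\<lambda>s. x + s *\<^sub>R v) has_derivative (\<lambda>s. s *\<^sub>R v)) (at t)"
    by (auto intro!: derivative_eq_intros)
  from has_derivative_compose[OF this, of F F'] assms
  have "((\<lambda>s. F (x + s *\<^sub>R v)) has_derivative (\<lambda>s. F' (s *\<^sub>R v))) (at t)" by simp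
  then show ?thesis
    by (simp add: has_vector_derivative_def linear_cmul[OF lin])
qed

lemma has_derivative_little_o:
  assumes "(F has_derivative F') (at x)" "0 < e"
  obtains d where "0 < d" "\<And>y. norm (y - x) < d \<Longrightarrow> norm (F y - F x - F' (y - x)) \<le> e * norm (y - x)"
proof -
  have "\<exists>d>0. \<forall>y\<in>UNIV. norm (y - x) < d \<longrightarrow> norm (F y - F x - F' (y - x)) \<le> e * norm (y - x)"
    using assms unfolding has_derivative_within_alt by blast
  then show ?thesis using that by blast
qed

text \<open>\<open>T\<close> is the image of the model space under the derivative of the inverse
  chart. Differentiating \<open>F\<close> after \<open>H\<close> along lines in \<open>L\<close>
  gives the identity, so that derivative is injective on \<open>L\<close> and \<open>T\<close> has
  full dimension. The last clause, that \<open>X\<close> deviates from \<open>x + T\<close> by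
  \<open>o(norm (q - x))\<close>, comes from expanding \<open>q = H (f q)\<close> at
  \<open>w\<close> and bounding \<open>f q - w\<close> by a multiple of
  \<open>q - x\<close>.\<close>

lemma C1_manifold_tangent_subspace:
  fixes X :: "'a::euclidean_space set"
  assumes X: "C1_manifold m X" and x: "x \<in> X"
  obtains T where "subspace T" "dim T = m" "T \<subseteq> tangent_space X x"
    "\<And>e. 0 < e \<Longrightarrow> \<exists>d>0. \<forall>q\<in>X. norm (q - x) < d \<longrightarrow> (\<exists>\<tau>\<in>T. norm (q - x - \<tau>) \<le> e * norm (q - x))"
proof -
  obtain N L W where N: "x \<in> N" "openin (top_of_set X) N" and L: "subspace (L :: 'a set)" "dim L = m"
    and W: "openin (top_of_set L) W" and "C1_diffeomorphic N W"
    using X x unfolding C1_manifold_def by blast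
  then obtain f h where fh: "homeomorphism N W f h" and fC1: "C1_map_on N f" and hC1: "C1_map_on W h"
    unfolding C1_diffeomorphic_def by blast
  define w where "w = f x"
  have w: "w \<in> W" "h w = x" using fh N(1) by (auto simp: homeomorphism_def w_def)
  have NX: "N \<subseteq> X" and WL: "W \<subseteq> L" using N(2) W openin_imp_subset by auto
  obtain A F and F' :: "'a \<Rightarrow> 'a \<Rightarrow>\<^sub>L 'a" where A: "open A" "x \<in> A"
    and dF: "\<And>y. y \<in> A \<Longrightarrow> (F has_derivative F' y) (at y)" and Ff: "\<And>y. y \<in> N \<inter> A \<Longrightarrow> F y = f y"
    using fC1 N(1) unfolding C1_map_on_def by metis
  obtain B H and H' :: "'a \<Rightarrow> 'a \<Rightarrow>\<^sub>L 'a" where B: "open B" "w \<in> B"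
    and dH: "\<And>y. y \<in> B \<Longrightarrow> (H has_derivative H' y) (at y)" and cH': "continuous_on B H'"
    and Hh: "\<And>y. y \<in> W \<inter> B \<Longrightarrow> H y = h y"
    using hC1 w(1) unfolding C1_map_on_def by metis
  have Hw: "H w = x" using Hh w B by auto
  define T where "T = H' w ` L"
  have linH': "linear (H' w)" by (simp add: blinfun.bounded_linear_right bounded_linear.linear)
  obtain W0 where W0: "open W0" "W = L \<inter> W0" using W by (auto simp: openin_open)
  \<comment> \<open>\<open>H\<close> is known to agree with the inverse chart only on
    \<open>W\<close>, which is open merely relative to \<open>L\<close>; short segments in
    directions of \<open>L\<close> stay inside.\<close>
  have line: "\<exists>e>0. \<forall>s\<in>{-e<..<e}. w + s *\<^sub>R l \<in> W \<inter> B" if l: "l \<in> L" for l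
  proof -
    have "\<forall>\<^sub>F s in at (0::real). w + s *\<^sub>R l \<in> W0 \<inter> B"
      using eventually_line_in_open[of "W0 \<inter> B" w l UNIV] W0 B w by auto
    then obtain e where e: "e > 0" "\<And>s. s \<noteq> 0 \<Longrightarrow> \<bar>s\<bar> < e \<Longrightarrow> w + s *\<^sub>R l \<in> W0 \<inter> B"
      unfolding eventually_at by (auto simp: dist_real_def)
    have "w + s *\<^sub>R l \<in> W \<inter> B" if "s \<in> {-e<..<e}" for s
    proof (cases "s = 0")
      case True then show ?thesis using w B by simp
    next
      case False
      have "w + s *\<^sub>R l \<in> L" using L(1) l w(1) WL by (auto intro: subspace_add subspace_scale)
      moreover have "w + s *\<^sub>R l \<in> W0 \<inter> B" using e(2)[OF False] that by auto
      ultimately show ?thesis using W0 by auto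
    qed
    then show ?thesis using e(1) by blast
  qed
  have tang: "H' w l \<in> tangent_space X x" if l: "l \<in> L" for l
  proof -
    obtain e where e: "e > 0" "\<And>s. s \<in> {-e<..<e} \<Longrightarrow> w + s *\<^sub>R l \<in> W \<inter> B" using line[OF l] by blast
    define c where "c = (\<lambda>s. H (w + s *\<^sub>R l))"
    have dc: "(c has_vector_derivative H' (w + s *\<^sub>R l) l) (at s)" if "s \<in> {-e<..<e}" for s
      unfolding c_def by (rule has_derivative_line, rule dH) (use e(2)[OF that] in blast)
    have "continuous_on {-e<..<e} (\<lambda>s. H' (w + s *\<^sub>R l))"
      by (rule continuous_on_compose2[OF cH'], intro continuous_intros) (use e(2) in blast)
    then have "continuous_on {-e<..<e} (\<lambda>s. H' (w + s *\<^sub>R l) l)"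
      by (intro continuous_intros)
    then have "c C1_differentiable_on {-e<..<e}"
      unfolding C1_differentiable_on_def
      by (intro exI[of _ "\<lambda>s. H' (w + s *\<^sub>R l) l"] conjI ballI dc)
    moreover have "c s \<in> X" if "s \<in> {-e<..<e}" for s
    proof -
      have "w + s *\<^sub>R l \<in> W" "c s = h (w + s *\<^sub>R l)" using e(2)[OF that] Hh by (auto simp: c_def)
      then show ?thesis using fh NX by (auto simp: homeomorphism_def)
    qed
    moreover have "c 0 = x" by (simp add: c_def Hw)
    moreover have "(c has_vector_derivative H' w l) (at 0)" using dc[of 0] e(1) by simp
    ultimately show ?thesis unfolding tangent_space_def using e(1) by blast
  qed
  have FH: "F' x (H' w l) = l" if l: "l \<in> L" for l
  proof -
    obtain e where e: "e > 0" "\<And>s. s \<in> {-e<..<e} \<Longrightarrow> w + s *\<^sub>R l \<in> W \<inter> B" using line[OF l] by blast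
    have dH0: "((\<lambda>s. H (w + s *\<^sub>R l)) has_vector_derivative H' w l) (at 0)"
      by (rule has_derivative_line) (use dH[OF B(2)] in simp)
    have comp: "((\<lambda>s. F (H (w + s *\<^sub>R l))) has_vector_derivative F' x (H' w l)) (at 0)"
    proof -
      have "(F has_derivative F' x) (at (H (w + 0 *\<^sub>R l)))" using dF[OF A(2)] Hw by simp
      from has_derivative_compose[OF dH0[unfolded has_vector_derivative_def] this]
      show ?thesis by (simp add: has_vector_derivative_def blinfun.scaleR_right)
    qed
    have "((\<lambda>s. H (w + s *\<^sub>R l)) \<longlongrightarrow> x) (at 0)"
      using has_vector_derivative_continuous[OF dH0] Hw by (simp add: continuous_at)
    then have "\<forall>\<^sub>F s in at 0. H (w + s *\<^sub>R l) \<in> A" using A topological_tendstoD by blast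
    moreover have "\<forall>\<^sub>F s in at 0. s \<in> {-e<..<e}" 
      using e(1) by (intro eventually_at_in_open') auto
    ultimately have EV: "\<forall>\<^sub>F s in at 0. F (H (w + s *\<^sub>R l)) = w + s *\<^sub>R l"
    proof eventually_elim
      case (elim s)
      have "w + s *\<^sub>R l \<in> W" and eq: "H (w + s *\<^sub>R l) = h (w + s *\<^sub>R l)" using e(2)[OF elim(2)] Hh by auto
      then have "h (w + s *\<^sub>R l) \<in> N" "f (h (w + s *\<^sub>R l)) = w + s *\<^sub>R l"
        using fh by (auto simp: homeomorphism_def)
      then show ?case using Ff elim(1) eq by auto
    qed
    have E0: "F (H (w + 0 *\<^sub>R l)) = w + 0 *\<^sub>R l" using Hw Ff N(1) A(2) w_def by auto
    have "((\<lambda>s. w + s *\<^sub>R l) has_vector_derivative F' x (H' w l)) (at 0)"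
      unfolding has_vector_derivative_def
      by (rule has_derivative_transform_eventually[OF comp[unfolded has_vector_derivative_def] EV E0 UNIV_I])
    moreover have "((\<lambda>s. w + s *\<^sub>R l) has_vector_derivative l) (at 0)"
      by (auto intro!: derivative_eq_intros)
    ultimately show ?thesis by (rule vector_derivative_unique_at)
  qed
  have "inj_on (H' w) L" by (rule inj_on_inverseI[where g = "F' x"]) (rule FH)
  then have "dim T = m"
    unfolding T_def using dim_image_eq[OF linH'] L by (simp add: span_eq_iff[THEN iffD2])
  moreover have "subspace T" unfolding T_def using linH' L(1) linear_subspace_image by blast
  moreover have "T \<subseteq> tangent_space X x" using tang by (auto simp: T_def)
  moreover have "\<exists>d>0. \<forall>q\<in>X. norm (q - x) < d \<longrightarrow> (\<exists>\<tau>\<in>T. norm (q - x - \<tau>) \<le> e * norm (q - x))"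
    if e: "0 < e" for e
  proof -
    define C where "C = onorm (F' x) + 1"
    have C: "0 < C" using onorm_pos_le[OF blinfun.bounded_linear_right, of "F' x"] by (simp add: C_def)
    obtain d1 where d1: "0 < d1" "\<And>y. norm (y - x) < d1 \<Longrightarrow> norm (F y - F x - F' x (y - x)) \<le> 1 * norm (y - x)"
      using has_derivative_little_o[OF dF[OF A(2)], of 1] by auto
    obtain d2 where d2: "0 < d2" "\<And>y. norm (y - w) < d2 \<Longrightarrow> norm (H y - H w - H' w (y - w)) \<le> (e / C) * norm (y - w)"
      using has_derivative_little_o[OF dH[OF B(2)], of "e / C"] e C by auto
    obtain N0 where N0: "open N0" "N = X \<inter> N0" using N(2) by (auto simp: openin_open)
    obtain d3 where d3: "0 < d3" "ball x d3 \<subseteq> N0 \<inter> A" using N0 A N(1) by (meson IntI Int_iff open_Int openE)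
    obtain d4 where d4: "0 < d4" "ball w d4 \<subseteq> B" using B openE by blast
    define d where "d = min (min d1 d3) (min (d2 / C) (d4 / C))"
    have d: "0 < d" using d1 d2 d3 d4 C by (simp add: d_def)
    have "\<exists>\<tau>\<in>T. norm (q - x - \<tau>) \<le> e * norm (q - x)" if q: "q \<in> X" "norm (q - x) < d" for q
    proof -
      have qd: "norm (q - x) < d1" "norm (q - x) < d3" "C * norm (q - x) < d2" "C * norm (q - x) < d4"
        using q(2) C by (auto simp: d_def field_simps)
      have "q \<in> ball x d3" using qd by (simp add: dist_norm norm_minus_commute)
      then have qN: "q \<in> N" "q \<in> A" using d3 N0 q by auto
      have Fx: "F x = w" using Ff N(1) A(2) w_def by auto
      have Fq: "F q = f q" using Ff qN by auto
      have "norm (f q - w) \<le> norm (F' x (q - x)) + norm (F q - F x - F' x (q - x))"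
        using norm_triangle_ineq[of "F' x (q - x)" "F q - F x - F' x (q - x)"] Fx Fq by simp
      also have "\<dots> \<le> onorm (F' x) * norm (q - x) + 1 * norm (q - x)"
        using d1(2)[OF qd(1)] onorm[OF blinfun.bounded_linear_right, of "F' x" "q - x"] by (intro add_mono) auto
      finally have fq: "norm (f q - w) \<le> C * norm (q - x)" by (simp add: C_def algebra_simps)
      have fqW: "f q \<in> W" "h (f q) = q" using fh qN by (auto simp: homeomorphism_def)
      have "f q \<in> ball w d4" using fq qd(4) by (simp add: dist_norm norm_minus_commute)
      then have Hq: "H (f q) = q" using Hh fqW d4 by auto
      have "f q - w \<in> L" using fqW w WL L(1) subspace_diff by blast
      then have "H' w (f q - w) \<in> T" by (simp add: T_def)
      moreover have "norm (q - x - H' w (f q - w)) \<le> (e / C) * norm (f q - w)"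
        using d2(2)[of "f q"] fq qd(3) Hq Hw by simp
      then have "norm (q - x - H' w (f q - w)) \<le> e * norm (q - x)"
        using mult_left_mono[OF fq, of "e / C"] e C by simp
      ultimately show ?thesis by blast
    qed
    with d show ?thesis by blast
  qed
  ultimately show ?thesis using that by blast
qed

text \<open>The tangent space contains a subspace of dimension \<open>DIM('a) - 1\<close>, which
  normality places inside the hyperplane orthogonal to \<open>g x\<close>; by dimension it is the
  whole hyperplane. Nearby points of the level set are then confined to arbitrarily flat
  neighbourhoods of that hyperplane.\<close>

lemma level_set_tangent:
  fixes g :: "'a::euclidean_space \<Rightarrow> 'a"
  assumes M: "C1_manifold (DIM('a) - 1) M" and nf: "normal_field M g" and x: "x \<in> M" and gx: "g x \<noteq> 0"
  shows "{v. g x \<bullet> v = 0} \<subseteq> tangent_space M x"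
    and "0 < e \<Longrightarrow> \<exists>d>0. \<forall>q\<in>M. norm (q - x) < d \<longrightarrow> \<bar>g x \<bullet> (q - x)\<bar> \<le> e * norm (q - x)"
proof -
  obtain T where T: "subspace T" "dim T = DIM('a) - 1" "T \<subseteq> tangent_space M x"
    and appr: "\<And>e. 0 < e \<Longrightarrow> \<exists>d>0. \<forall>q\<in>M. norm (q - x) < d \<longrightarrow> (\<exists>\<tau>\<in>T. norm (q - x - \<tau>) \<le> e * norm (q - x))"
    using C1_manifold_tangent_subspace[OF M x] by metis
  have T0: "T \<subseteq> {v. g x \<bullet> v = 0}" using T(3) nf x unfolding normal_field_def by blast
  have "T = {v. g x \<bullet> v = 0}"
    using T(1,2) T0 gx by (intro subspace_dim_equal) (auto simp: subspace_hyperplane dim_hyperplane)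
  with T(3) show "{v. g x \<bullet> v = 0} \<subseteq> tangent_space M x" by simp
  assume e: "0 < e"
  obtain d where d: "d > 0" "\<And>q. q \<in> M \<Longrightarrow> norm (q - x) < d \<Longrightarrow>
      \<exists>\<tau>\<in>T. norm (q - x - \<tau>) \<le> (e / norm (g x)) * norm (q - x)"
    using appr[of "e / norm (g x)"] e gx by auto
  have "\<bar>g x \<bullet> (q - x)\<bar> \<le> e * norm (q - x)" if q: "q \<in> M" "norm (q - x) < d" for q
  proof -
    obtain \<tau> where \<tau>: "\<tau> \<in> T" "norm (q - x - \<tau>) \<le> (e / norm (g x)) * norm (q - x)" using d(2)[OF q] by blast
    have "g x \<bullet> (q - x) = g x \<bullet> (q - x - \<tau>)" using \<tau>(1) T0 by (auto simp: inner_diff_right)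
    also have "\<bar>\<dots>\<bar> \<le> norm (g x) * norm (q - x - \<tau>)" by (rule Cauchy_Schwarz_ineq2)
    also have "\<dots> \<le> norm (g x) * ((e / norm (g x)) * norm (q - x))" using \<tau>(2) by (intro mult_left_mono) auto
    finally show ?thesis using gx by simp
  qed
  with d(1) show "\<exists>d>0. \<forall>q\<in>M. norm (q - x) < d \<longrightarrow> \<bar>g x \<bullet> (q - x)\<bar> \<le> e * norm (q - x)" by blast
qed

text \<open>On a segment joining a point where \<open>u\<close> is known to be larger
  than \<open>u x\<close> to a point where it is not, the level set of \<open>x\<close> would be met inside a cone
  around \<open>g x\<close>, contradicting its tangency.\<close>

lemma increase_transfer:
  fixes g :: "'a::euclidean_space \<Rightarrow> 'a" and u :: "'a \<Rightarrow> real"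
  assumes V: "open V" "x \<in> V" and cu: "continuous_on V u"
    and M: "C1_manifold (DIM('a) - 1) (level_set V u x)" and nf: "normal_field (level_set V u x) g"
    and gx: "g x \<noteq> 0"
    and e: "0 < g x \<bullet> e" and inc: "\<forall>\<^sub>F s in at_right 0. u x < u (x + s *\<^sub>R e)"
    and w: "0 < g x \<bullet> w"
  shows "\<forall>\<^sub>F s in at_right 0. u x < u (x + s *\<^sub>R w)"
proof -
  have xM: "x \<in> level_set V u x" using V by (simp add: level_set_def)
  obtain r where r: "0 < r" "ball x r \<subseteq> V" using V openE by blast
  \<comment> \<open>\<open>b\<close> bounds \<open>g x \<bullet> ((1 - \<theta>) *\<^sub>R e +
    \<theta> *\<^sub>R w)\<close> from below and \<open>R\<close> the norm of that vector from
    above. Hence the segment between the two test points lies in a cone that violates the flatness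
    bound \<open>b / (2 * R)\<close> by a factor 2.\<close>
  define b where "b = min (g x \<bullet> e) (g x \<bullet> w)"
  define R where "R = norm e + norm w"
  have b: "0 < b" using e w by (simp add: b_def)
  have R: "0 < R" using e by (cases "e = 0") (auto simp: R_def add_pos_nonneg)
  have "0 < b / (2 * R)" using b R by simp
  from level_set_tangent(2)[OF M nf xM gx this]
  obtain d where d: "d > 0" "\<And>q. q \<in> level_set V u x \<Longrightarrow> norm (q - x) < d \<Longrightarrow>
       \<bar>g x \<bullet> (q - x)\<bar> \<le> b / (2 * R) * norm (q - x)" by blast
  have "\<forall>\<^sub>F s in at_right 0. s < min (r / R) (d / R) \<and> 0 < s"
    using eventually_at_right_real[of 0 "min (r / R) (d / R)"] r(1) d(1) R
    by (auto elim!: eventually_mono)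
  with inc show ?thesis
  proof eventually_elim
    case (elim s)
    then have s: "0 < s" "s * R < r" "s * R < d" using R by (auto simp: field_simps)
    define k where "k = (\<lambda>\<theta>. x + s *\<^sub>R ((1 - \<theta>) *\<^sub>R e + \<theta> *\<^sub>R w))"
    have nk: "norm (k \<theta> - x) \<le> s * R" if "\<theta> \<in> {0..1}" for \<theta>
    proof -
      have "norm ((1 - \<theta>) *\<^sub>R e + \<theta> *\<^sub>R w) \<le> (1 - \<theta>) * norm e + \<theta> * norm w"
        using that norm_triangle_ineq[of "(1 - \<theta>) *\<^sub>R e" "\<theta> *\<^sub>R w"] by simp
      also have "\<dots> \<le> 1 * norm e + 1 * norm w" using that by (intro add_mono mult_right_mono) auto
      finally show ?thesis using s(1) by (simp add: k_def R_def)
    qed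
    have kV: "k \<theta> \<in> V" if "\<theta> \<in> {0..1}" for \<theta>
      using nk[OF that] s(2) r(2) by (auto simp: dist_norm norm_minus_commute)
    show ?case
    proof (rule ccontr)
      assume "\<not> ?case"
      then have "u (k 1) \<le> u x" "u x \<le> u (k 0)" using elim(1) by (auto simp: k_def)
      moreover have "continuous_on {0..1} (\<lambda>\<theta>. u (k \<theta>))"
        by (rule continuous_on_compose2[OF cu]) (use kV in \<open>auto simp: k_def intro!: continuous_intros\<close>)
      ultimately obtain \<theta> where \<theta>: "0 \<le> \<theta>" "\<theta> \<le> 1" "u (k \<theta>) = u x"
        using IVT2'[of "\<lambda>\<theta>. u (k \<theta>)" 1 "u x" 0] by auto
      then have "k \<theta> \<in> level_set V u x" using kV by (simp add: level_set_def)
      from d(2)[OF this] nk[of \<theta>] \<theta> s(3)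
      have "\<bar>g x \<bullet> (k \<theta> - x)\<bar> \<le> b / (2 * R) * norm (k \<theta> - x)" by auto
      also have "\<dots> \<le> b / (2 * R) * (s * R)" using nk[of \<theta>] \<theta> b R by (intro mult_left_mono) auto
      also have "\<dots> = s * b / 2" using R by simp
      finally have "g x \<bullet> (k \<theta> - x) \<le> s * b / 2" by simp
      moreover have "s * b \<le> g x \<bullet> (k \<theta> - x)"
      proof -
        have "b = (1 - \<theta>) * b + \<theta> * b" by (simp add: algebra_simps)
        also have "\<dots> \<le> (1 - \<theta>) * (g x \<bullet> e) + \<theta> * (g x \<bullet> w)"
          using \<theta> by (intro add_mono mult_left_mono) (auto simp: b_def)
        finally show ?thesis using s(1) by (simp add: k_def inner_add_right)
      qed
      moreover have "0 < s * b" using s(1) b by simp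
      ultimately show False by linarith
    qed
  qed
qed

section \<open>Regular solutions along segments, and quasi-convexity\<close>

text \<open>Regularity gives an increase in the single direction \<open>g x\<close>;
  \<open>increase_transfer\<close> spreads it to the open half space
  \<open>0 < g x \<bullet> w\<close>.\<close>

lemma regular_solution_increase:
  fixes g :: "'a::euclidean_space \<Rightarrow> 'a"
  assumes u: "regular_solution U g V u" and g0: "\<And>x. x \<in> U \<Longrightarrow> g x \<noteq> 0"
    and x: "x \<in> V" and w: "0 < g x \<bullet> w"
  shows "\<forall>\<^sub>F s in at_right 0. u x < u (x + s *\<^sub>R w)"
proof (rule increase_transfer[where g = g and e = "g x"])
  have ns: "normal_solution U g V u" using u by (simp add: regular_solution_def)
  then show V: "open V" by (simp add: normal_solution_def)
  show "x \<in> V" by fact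
  show "continuous_on V u" using ns locally_lipschitz_on_imp_continuous_on by (auto simp: normal_solution_def)
  show "C1_manifold (DIM('a) - 1) (level_set V u x)" "normal_field (level_set V u x) g"
    using ns x by (auto simp: normal_solution_def)
  show gx: "g x \<noteq> 0" using ns x g0 by (auto simp: normal_solution_def)
  then show "0 < g x \<bullet> g x" by simp
  obtain a b where ab: "a < 0" "0 < b" "strict_mono_on {a<..<b} (\<lambda>t. u (x + t *\<^sub>R g x))"
    using u x unfolding regular_solution_def by blast
  show "\<forall>\<^sub>F s in at_right 0. u x < u (x + s *\<^sub>R g x)"
    using eventually_at_right_real[OF ab(2)]
  proof eventually_elim
    case (elim s)
    then show ?case using strict_mono_onD[OF ab(3), of 0 s] ab by auto
  qed
  show "0 < g x \<bullet> w" by fact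
qed

text \<open>A \<open>C\<^sup>1\<close> curve in the level set with velocity \<open>v\<close> stays within \<open>o(s)\<close> of the line \<open>x + s v\<close>,
  so the Lipschitz function \<open>u\<close> changes by \<open>o(s)\<close> along the line.\<close>

lemma normal_solution_tangential:
  fixes g :: "'a::euclidean_space \<Rightarrow> 'a"
  assumes u: "normal_solution U g V u" and g0: "\<And>x. x \<in> U \<Longrightarrow> g x \<noteq> 0"
    and x: "x \<in> V" and v: "g x \<bullet> v = 0" and e: "0 < e"
  shows "\<forall>\<^sub>F s in at_right 0. \<bar>u (x + s *\<^sub>R v) - u x\<bar> \<le> e * s"
proof -
  have V: "open V" "V \<subseteq> U" and M: "C1_manifold (DIM('a) - 1) (level_set V u x)"
    and nf: "normal_field (level_set V u x) g" and lip: "locally_lipschitz_on V u"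
    using u x by (auto simp: normal_solution_def)
  have xM: "x \<in> level_set V u x" using x by (simp add: level_set_def)
  have "v \<in> tangent_space (level_set V u x) x"
    using level_set_tangent(1)[OF M nf xM] g0 x V(2) v by auto
  then obtain c d where c: "0 < d" "c ` {-d<..<d} \<subseteq> level_set V u x" "c 0 = x"
    "(c has_vector_derivative v) (at 0)"
    unfolding tangent_space_def by auto
  obtain r where r: "0 < r" "cball x r \<subseteq> V" using V(1) x open_contains_cball by blast
  obtain L where L: "L-lipschitz_on (cball x r) u"
    using lip r(2) unfolding locally_lipschitz_on_def by (meson compact_cball)
  have L0: "0 \<le> L" using L by (rule lipschitz_on_nonneg)
  define \<eta> where "\<eta> = e / (L + 1)"
  have \<eta>: "0 < \<eta>" using e L0 by (simp add: \<eta>_def)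
  obtain d1 where d1: "0 < d1" "\<And>s. norm (s - 0) < d1 \<Longrightarrow> norm (c s - c 0 - (s - 0) *\<^sub>R v) \<le> \<eta> * norm (s - 0)"
    using has_derivative_little_o[OF c(4)[unfolded has_vector_derivative_def] \<eta>] by blast
  have "isCont c 0" using c(4) by (rule has_vector_derivative_continuous)
  then have "(c \<longlongrightarrow> x) (at_right 0)"
    using c(3) by (auto simp: isCont_def intro: tendsto_within_subset)
  then have "\<forall>\<^sub>F s in at_right 0. c s \<in> ball x r" using r(1) by (intro topological_tendstoD) auto
  moreover have "\<forall>\<^sub>F s in at_right 0. x + s *\<^sub>R v \<in> ball x r"
    using r(1) by (intro eventually_line_in_open) auto
  moreover have "\<forall>\<^sub>F s in at_right 0. s \<in> {0<..<min d d1}"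
    using c(1) d1(1) by (intro eventually_at_right_real) auto
  ultimately show ?thesis
  proof eventually_elim
    case (elim s)
    have "c s \<in> level_set V u x" using c(2) elim(3) by force
    then have "u (c s) = u x" by (simp add: level_set_def)
    then have "\<bar>u (x + s *\<^sub>R v) - u x\<bar> = dist (u (x + s *\<^sub>R v)) (u (c s))" by (simp add: dist_real_def)
    also have "\<dots> \<le> L * dist (x + s *\<^sub>R v) (c s)"
      using lipschitz_onD[OF L, of "x + s *\<^sub>R v" "c s"] elim by auto
    also have "dist (x + s *\<^sub>R v) (c s) \<le> \<eta> * s"
    proof -
      have "norm (c s - x - s *\<^sub>R v) \<le> \<eta> * s" using d1(2)[of s] elim(3) c(3) by auto
      moreover have "c s - x - s *\<^sub>R v = c s - (x + s *\<^sub>R v)" by simp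
      ultimately show ?thesis by (simp only: dist_norm norm_minus_commute)
    qed
    then have "L * dist (x + s *\<^sub>R v) (c s) \<le> (L + 1) * (\<eta> * s)"
      using L0 by (intro mult_mono) auto
    also have "\<dots> = e * s" using L0 by (simp add: \<eta>_def)
    finally show ?case by simp
  qed
qed

text \<open>Where \<open>g \<bullet> w\<close> is positive \<open>u\<close> increases at once, and
  where it vanishes \<open>u\<close> changes by \<open>o(s)\<close>. Both fit the one-sided
  hypothesis of \<open>dini_nondecreasing\<close>, so \<open>u\<close> need not be
  differentiable.\<close>

lemma regular_solution_nondecreasing:
  fixes g :: "'a::euclidean_space \<Rightarrow> 'a"
  assumes u: "regular_solution U g V u" and g0: "\<And>x. x \<in> U \<Longrightarrow> g x \<noteq> 0"
    and seg: "\<And>s. s \<in> {0..1} \<Longrightarrow> p + s *\<^sub>R w \<in> V"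
    and pos: "\<And>s. s \<in> {0..1} \<Longrightarrow> 0 \<le> g (p + s *\<^sub>R w) \<bullet> w"
  shows "u p \<le> u (p + w)"
proof -
  have ns: "normal_solution U g V u" using u by (simp add: regular_solution_def)
  have cu: "continuous_on V u"
    using ns locally_lipschitz_on_imp_continuous_on by (auto simp: normal_solution_def)
  have "u (p + 0 *\<^sub>R w) \<le> u (p + 1 *\<^sub>R w)"
  proof (rule dini_nondecreasing[where f = "\<lambda>s. u (p + s *\<^sub>R w)"])
    show "continuous_on {0..1} (\<lambda>s. u (p + s *\<^sub>R w))"
      by (rule continuous_on_compose2[OF cu], intro continuous_intros) (use seg in blast)
    fix t \<eta> :: real assume t: "0 \<le> t" "t < 1" "0 < \<eta>"
    define q where "q = p + t *\<^sub>R w"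
    have q: "q \<in> V" using seg t by (auto simp: q_def)
    have "\<forall>\<^sub>F s in at_right 0. - \<eta> * s \<le> u (q + s *\<^sub>R w) - u q"
    proof (cases "g q \<bullet> w = 0")
      case True
      show ?thesis
        by (rule eventually_mono[OF normal_solution_tangential[OF ns g0 q True t(3)]]) (auto simp: abs_le_iff)
    next
      case False
      then have "0 < g q \<bullet> w" using pos[of t] t by (auto simp: q_def)
      then have "\<forall>\<^sub>F s in at_right 0. u q < u (q + s *\<^sub>R w)"
        using regular_solution_increase[OF u g0 q] by blast
      from this eventually_at_right_less[of 0]
      show ?thesis
      proof eventually_elim
        case (elim s)
        have "0 < \<eta> * s" using elim(2) t(3) by simp
        then show ?case using elim(1) by linarith
      qed
    qed
    moreover have "\<forall>\<^sub>F s in at_right 0. s \<in> {0<..<1 - t}"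
      using t by (intro eventually_at_right_real) auto
    ultimately have "\<forall>\<^sub>F s in at_right 0. s \<in> {0<..<1 - t} \<and> - \<eta> * s \<le> u (q + s *\<^sub>R w) - u q"
      by eventually_elim simp
    then obtain s where s: "s \<in> {0<..<1 - t}" "- \<eta> * s \<le> u (q + s *\<^sub>R w) - u q"
      using eventually_happens trivial_limit_at_right_real by blast
    have eq: "q + s *\<^sub>R w = p + (t + s) *\<^sub>R w" by (simp add: q_def algebra_simps)
    have "- \<eta> * s \<le> u (p + (t + s) *\<^sub>R w) - u (p + t *\<^sub>R w)"
      using s(2)[unfolded eq] by (simp only: q_def)
    then show "\<exists>s>t. s \<le> 1 \<and> - \<eta> * (s - t) \<le> u (p + s *\<^sub>R w) - u (p + t *\<^sub>R w)"
      using s(1) by (intro exI[of _ "t + s"]) auto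
  qed simp
  then show ?thesis by simp
qed

text \<open>At the intermediate point either \<open>g \<bullet> v\<close> is nonnegative, hence
  nonnegative up to \<open>y\<close>, and \<open>u\<close> does not decrease on the way to
  \<open>y\<close>; or it has been negative all the way from \<open>x\<close>, and \<open>u\<close>
  does not decrease on the way back to \<open>x\<close>.\<close>

lemma tangentially_monotone_imp_quasi_convex:
  fixes g :: "'a::euclidean_space \<Rightarrow> 'a"
  assumes U: "open U" and g0: "\<And>x. x \<in> U \<Longrightarrow> g x \<noteq> 0" and lip: "locally_lipschitz_on U g"
    and mono: "tangentially_monotone_on U g" and u: "regular_solution U g V u" and V: "convex V"
  shows "quasi_convex_on V u"
  unfolding quasi_convex_on_def
proof (intro ballI)
  fix x y and t :: real assume xy: "x \<in> V" "y \<in> V" and t: "t \<in> {0..1}"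
  define v where "v = y - x"
  have VU: "V \<subseteq> U" using u by (simp add: regular_solution_def normal_solution_def)
  have seg: "x + s *\<^sub>R v \<in> V" if "s \<in> {0..1}" for s
    using convexD_alt[OF V xy, of s] that by (auto simp: v_def algebra_simps)
  have sign: "0 \<le> g (x + b *\<^sub>R v) \<bullet> v" if "0 \<le> a" "a \<le> b" "b \<le> 1" "0 \<le> g (x + a *\<^sub>R v) \<bullet> v" for a b
    using tangentially_monotone_segment[OF U g0 lip mono _ that] seg VU by blast
  have "u (x + t *\<^sub>R v) \<le> max (u x) (u y)"
  proof (cases "0 \<le> g (x + t *\<^sub>R v) \<bullet> v")
    case True
    have eq: "x + t *\<^sub>R v + s *\<^sub>R ((1 - t) *\<^sub>R v) = x + (t + s * (1 - t)) *\<^sub>R v" for s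
      by (simp add: algebra_simps)
    have in01: "t \<le> t + s * (1 - t)" "t + s * (1 - t) \<le> 1" if "s \<in> {0..1}" for s
    proof -
      show "t \<le> t + s * (1 - t)" using that t by simp
      have "s * (1 - t) \<le> 1 * (1 - t)" using that t by (intro mult_right_mono) auto
      then show "t + s * (1 - t) \<le> 1" by simp
    qed
    have "u (x + t *\<^sub>R v) \<le> u (x + t *\<^sub>R v + (1 - t) *\<^sub>R v)"
    proof (rule regular_solution_nondecreasing[OF u g0])
      fix s :: real assume s: "s \<in> {0..1}"
      show "x + t *\<^sub>R v + s *\<^sub>R ((1 - t) *\<^sub>R v) \<in> V"
        unfolding eq using in01[OF s] t by (intro seg) auto
      show "0 \<le> g (x + t *\<^sub>R v + s *\<^sub>R ((1 - t) *\<^sub>R v)) \<bullet> ((1 - t) *\<^sub>R v)"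
        unfolding eq using sign[OF _ in01[OF s] True] t by simp
    qed
    also have "x + t *\<^sub>R v + (1 - t) *\<^sub>R v = y" by (simp add: v_def algebra_simps)
    finally show ?thesis by simp
  next
    case False
    have eq: "x + t *\<^sub>R v + s *\<^sub>R (- t *\<^sub>R v) = x + (t - s * t) *\<^sub>R v" for s
      by (simp add: algebra_simps)
    have in01: "0 \<le> t - s * t" "t - s * t \<le> t" if "s \<in> {0..1}" for s
    proof -
      show "t - s * t \<le> t" using that t by simp
      have "s * t \<le> 1 * t" using that t by (intro mult_right_mono) auto
      then show "0 \<le> t - s * t" by simp
    qed
    have "u (x + t *\<^sub>R v) \<le> u (x + t *\<^sub>R v + - t *\<^sub>R v)"
    proof (rule regular_solution_nondecreasing[OF u g0])
      fix s :: real assume s: "s \<in> {0..1}"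
      show "x + t *\<^sub>R v + s *\<^sub>R (- t *\<^sub>R v) \<in> V"
        unfolding eq using in01[OF s] t by (intro seg) auto
      have "g (x + (t - s * t) *\<^sub>R v) \<bullet> v < 0"
        using sign[OF in01[OF s]] t False by auto
      then show "0 \<le> g (x + t *\<^sub>R v + s *\<^sub>R (- t *\<^sub>R v)) \<bullet> (- t *\<^sub>R v)"
        unfolding eq using t by (simp add: mult_nonneg_nonpos)
    qed
    then show ?thesis by simp
  qed
  then show "u ((1 - t) *\<^sub>R x + t *\<^sub>R y) \<le> max (u x) (u y)" by (simp add: v_def algebra_simps)
qed

text \<open>By contradiction; a regular solution around \<open>x\<close> turns the negative sign of
  \<open>v \<bullet> g\<close> into a strict decrease of \<open>u\<close> along \<open>v\<close>.
  Then some \<open>z\<close> has \<open>u z < u x\<close> although \<open>u\<close> first rises from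
  \<open>x\<close> towards \<open>z\<close>.\<close>

lemma quasi_convex_imp_tangentially_monotone:
  fixes g :: "'a::euclidean_space \<Rightarrow> 'a"
  assumes g0: "\<And>x. x \<in> U \<Longrightarrow> g x \<noteq> 0"
    and ex: "\<And>x. x \<in> U \<Longrightarrow> \<exists>V u. x \<in> V \<and> regular_solution U g V u \<and> convex V"
    and qc: "\<And>V u. regular_solution U g V u \<Longrightarrow> convex V \<Longrightarrow> quasi_convex_on V u"
  shows "tangentially_monotone_on U g"
  unfolding tangentially_monotone_on_def
proof (intro ballI allI impI, rule ccontr)
  fix x v assume x: "x \<in> U" and gv: "g x \<bullet> v = 0"
    and neg: "\<not> 0 \<le> Limsup (at_right 0) (\<lambda>t. ereal (1 / t * (v \<bullet> g (x + t *\<^sub>R v))))"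
  obtain V u where V: "x \<in> V" "convex V" and u: "regular_solution U g V u" using ex[OF x] by blast
  have ns: "normal_solution U g V u" using u by (simp add: regular_solution_def)
  then have oV: "open V" by (simp add: normal_solution_def)
  have cu: "continuous_on V u"
    using ns locally_lipschitz_on_imp_continuous_on by (auto simp: normal_solution_def)
  have inc: "\<forall>\<^sub>F s in at_right 0. u p < u (p + s *\<^sub>R w)" if "p \<in> V" "0 < g p \<bullet> w" for p w
    using regular_solution_increase[OF u g0 that] by blast
  have "\<forall>\<^sub>F t in at_right 0. ereal (1 / t * (v \<bullet> g (x + t *\<^sub>R v))) < 0"
    using neg by (intro Limsup_lessD) simp
  moreover have "\<forall>\<^sub>F t in at_right 0. x + t *\<^sub>R v \<in> V"
    using eventually_line_in_open[OF oV V(1)] .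
  ultimately have "\<forall>\<^sub>F t in at_right 0. v \<bullet> g (x + t *\<^sub>R v) < 0 \<and> x + t *\<^sub>R v \<in> V"
    using eventually_at_right_less[of 0]
    by eventually_elim (auto simp: divide_less_0_iff)
  then obtain b where b: "0 < b" "\<And>t. \<lbrakk>0 < t; t < b\<rbrakk> \<Longrightarrow> v \<bullet> g (x + t *\<^sub>R v) < 0 \<and> x + t *\<^sub>R v \<in> V"
    unfolding eventually_at_right_field by auto
  define f where "f = (\<lambda>t. u (x + t *\<^sub>R v))"
  have cf: "continuous_on {0..<b} f"
    unfolding f_def
  proof (rule continuous_on_compose2[OF cu], intro continuous_intros, safe)
    fix t assume "t \<in> {0..<b}" then show "x + t *\<^sub>R v \<in> V" using b V(1) by (cases "t = 0") auto
  qed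
  text \<open>\<open>u\<close> strictly decreases along \<open>v\<close>; tilting the end point of the segment towards \<open>g x\<close>
    gives a direction of increase of \<open>u\<close> at \<open>x\<close> while keeping \<open>u\<close> small at the end point.\<close>
  have dec: "f t2 < f t1" if t: "0 < t1" "t1 < t2" "t2 < b" for t1 t2
  proof -
    have "f (- (- t2)) < f (- (- t1))"
    proof (rule strict_increase_on_interval[where f = "\<lambda>t. f (- t)"])
      show "- t2 < - t1" using t by simp
      show "continuous_on {- t2..- t1} (\<lambda>t. f (- t))"
        by (rule continuous_on_compose2[OF cf], intro continuous_intros) (use t in auto)
      fix s assume s: "- t2 \<le> s" "s < - t1"
      define p where "p = x + (- s) *\<^sub>R v"
      have p: "p \<in> V" "0 < g p \<bullet> (- v)" using b(2)[of "- s"] s t by (auto simp: p_def inner_commute)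
      have "\<forall>\<^sub>F \<tau> in at_right 0. \<tau> \<in> {0<..<- t1 - s} \<and> u p < u (p + \<tau> *\<^sub>R (- v))"
        using inc[OF p] eventually_at_right_real[of 0 "- t1 - s"] s by (auto elim: eventually_elim2)
      then obtain \<tau> where \<tau>: "\<tau> \<in> {0<..<- t1 - s}" "u p < u (p + \<tau> *\<^sub>R (- v))"
        using eventually_happens trivial_limit_at_right_real by blast
      have eq: "p + \<tau> *\<^sub>R (- v) = x + (- (s + \<tau>)) *\<^sub>R v" by (simp add: p_def algebra_simps)
      have "f (- s) < f (- (s + \<tau>))" using \<tau>(2)[unfolded eq] by (simp only: f_def p_def)
      then show "\<exists>s'>s. s' \<le> - t1 \<and> f (- s) < f (- s')"
        using \<tau> by (intro exI[of _ "s + \<tau>"]) auto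
    qed
    then show ?thesis by simp
  qed
  define t where "t = b / 2"
  have t: "0 < t" "t < b" using b(1) by (auto simp: t_def)
  \<comment> \<open>At \<open>x\<close> itself \<open>g x \<bullet> v = 0\<close> gives no strict
    decrease, so \<open>dec\<close> stops short of 0 and continuity bridges the gap.\<close>
  have "f (t / 2) \<le> f 0"
  proof (rule tendsto_lowerbound[where F = "at_right 0"])
    have "continuous_on {0..t} f" using cf t by (rule_tac continuous_on_subset) auto
    then have "(f \<longlongrightarrow> f 0) (at 0 within {0..t})" using t by (auto simp: continuous_on_def)
    then show "(f \<longlongrightarrow> f 0) (at_right 0)"
      using t by (simp add: at_within_Icc_at_right)
    show "\<forall>\<^sub>F s in at_right 0. f (t / 2) \<le> f s"
      using eventually_at_right_real[of 0 "t / 2"] t by (auto elim!: eventually_mono intro!: less_imp_le dec)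
  qed simp
  moreover have "f t < f (t / 2)" using dec[of "t / 2" t] t by simp
  ultimately have ft: "u (x + t *\<^sub>R v) < u x" by (simp add: f_def)
  define y where "y = x + t *\<^sub>R v"
  have y: "y \<in> V" using b(2)[OF t] by (simp add: y_def)
  have "isCont u y" using cu oV y by (simp add: continuous_on_eq_continuous_at)
  then have "((\<lambda>\<epsilon>. u (y + \<epsilon> *\<^sub>R g x)) \<longlongrightarrow> u y) (at_right 0)"
    by (rule isCont_tendsto_compose) (rule line_tendsto)
  then have "\<forall>\<^sub>F \<epsilon> in at_right 0. u (y + \<epsilon> *\<^sub>R g x) < u x"
    using ft by (intro order_tendstoD) (auto simp: y_def)
  then have "\<forall>\<^sub>F \<epsilon> in at_right 0. 0 < \<epsilon> \<and> y + \<epsilon> *\<^sub>R g x \<in> V \<and> u (y + \<epsilon> *\<^sub>R g x) < u x"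
    using eventually_line_in_open[OF oV y, of "g x" "{0<..}"] eventually_at_right_less[of 0]
    by eventually_elim simp
  then obtain \<epsilon> where \<epsilon>: "0 < \<epsilon>" "y + \<epsilon> *\<^sub>R g x \<in> V" "u (y + \<epsilon> *\<^sub>R g x) < u x"
    using eventually_happens trivial_limit_at_right_real by blast
  define z where "z = y + \<epsilon> *\<^sub>R g x"
  have "g x \<bullet> (z - x) = \<epsilon> * (g x \<bullet> g x)" using gv by (simp add: z_def y_def inner_add_right)
  then have "0 < g x \<bullet> (z - x)" using \<epsilon>(1) g0[OF x] by simp
  from inc[OF V(1) this] eventually_at_right_real[of 0 1]
  have "\<forall>\<^sub>F s in at_right 0. s \<in> {0<..<1} \<and> u x < u (x + s *\<^sub>R (z - x))" by (auto elim: eventually_elim2)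
  then obtain s where s: "s \<in> {0<..<1}" "u x < u (x + s *\<^sub>R (z - x))"
    using eventually_happens trivial_limit_at_right_real by blast
  have "u ((1 - s) *\<^sub>R x + s *\<^sub>R z) \<le> max (u x) (u z)"
    using qc[OF u V(2)] V(1) \<epsilon>(2) s(1) unfolding quasi_convex_on_def z_def by auto
  moreover have "(1 - s) *\<^sub>R x + s *\<^sub>R z = x + s *\<^sub>R (z - x)" by (simp add: algebra_simps)
  ultimately show False using s(2) \<epsilon>(3) by (simp add: z_def)
qed

section \<open>Almost everywhere differentiability of Lipschitz functions\<close>

lemma strict_mono_image_Icc:
  fixes f :: "real \<Rightarrow> real"
  assumes f: "strict_mono f" "continuous_on UNIV f" and ab: "a \<le> b"
  shows "f ` {a..b} = {f a..f b}"
proof (intro equalityI subsetI)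
  fix y assume "y \<in> f ` {a..b}"
  then show "y \<in> {f a..f b}" using f(1) by (auto simp: strict_mono_less_eq)
next
  fix y assume "y \<in> {f a..f b}"
  then show "y \<in> f ` {a..b}"
    using IVT'[of f a y b] ab continuous_on_subset[OF f(2)] by force
qed

text \<open>Total increments are read as measures of \<open>f\<close>-images, so two families of
  intervals can be compared through the inclusion of their unions, without sorting one family into
  the intervals of the other.\<close>

lemma countable_disjoint_slope_bound:
  fixes f :: "real \<Rightarrow> real"
  assumes f: "strict_mono f" "continuous_on UNIV f"
    and C: "countable C" "disjoint_family_on (\<lambda>i. {a i..b i}) C" "\<And>i. i \<in> C \<Longrightarrow> a i < b i"
    and p: "0 \<le> p"
  shows "(\<And>i. i \<in> C \<Longrightarrow> f (b i) - f (a i) \<le> p * (b i - a i)) \<Longrightarrow>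
           emeasure lborel (f ` (\<Union>i\<in>C. {a i..b i})) \<le> ennreal p * emeasure lborel (\<Union>i\<in>C. {a i..b i})"
    and "(\<And>i. i \<in> C \<Longrightarrow> p * (b i - a i) \<le> f (b i) - f (a i)) \<Longrightarrow>
           ennreal p * emeasure lborel (\<Union>i\<in>C. {a i..b i}) \<le> emeasure lborel (f ` (\<Union>i\<in>C. {a i..b i}))"
    and "f ` (\<Union>i\<in>C. {a i..b i}) \<in> sets borel"
proof -
  have im: "f ` (\<Union>i\<in>C. {a i..b i}) = (\<Union>i\<in>C. {f (a i)..f (b i)})"
    using strict_mono_image_Icc[OF f] C(3) by (auto simp: image_UN less_imp_le)
  show "f ` (\<Union>i\<in>C. {a i..b i}) \<in> sets borel"
    unfolding im using C(1) by (intro sets.countable_UN'') auto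
  have disj: "disjoint_family_on (\<lambda>i. {f (a i)..f (b i)}) C"
    unfolding disjoint_family_on_def
  proof (intro ballI impI)
    fix i j assume ij: "i \<in> C" "j \<in> C" "i \<noteq> j"
    have "inj f" using f(1) by (rule strict_mono_imp_inj_on)
    then have "f ` {a i..b i} \<inter> f ` {a j..b j} = {}"
      using C(2) ij by (auto simp: disjoint_family_on_def image_Int[symmetric])
    then show "{f (a i)..f (b i)} \<inter> {f (a j)..f (b j)} = {}"
      using strict_mono_image_Icc[OF f, of "a i" "b i"] strict_mono_image_Icc[OF f, of "a j" "b j"] C(3)[OF ij(1)] C(3)[OF ij(2)] by simp
  qed
  have e1: "emeasure lborel (f ` (\<Union>i\<in>C. {a i..b i})) = (\<integral>\<^sup>+i. ennreal (f (b i) - f (a i)) \<partial>count_space C)"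
    unfolding im using C(1,3) disj f(1)
    by (subst emeasure_UN_countable) (auto intro!: nn_integral_cong simp: strict_mono_less_eq less_imp_le)
  have e2: "ennreal p * emeasure lborel (\<Union>i\<in>C. {a i..b i}) = (\<integral>\<^sup>+i. ennreal (p * (b i - a i)) \<partial>count_space C)"
    using C p
    by (subst emeasure_UN_countable)
      (auto simp: nn_integral_cmult[symmetric] ennreal_mult' less_imp_le intro!: nn_integral_cong)
  show "(\<And>i. i \<in> C \<Longrightarrow> f (b i) - f (a i) \<le> p * (b i - a i)) \<Longrightarrow>
           emeasure lborel (f ` (\<Union>i\<in>C. {a i..b i})) \<le> ennreal p * emeasure lborel (\<Union>i\<in>C. {a i..b i})"
    unfolding e1 e2 by (intro nn_integral_mono ennreal_leI) auto
  show "(\<And>i. i \<in> C \<Longrightarrow> p * (b i - a i) \<le> f (b i) - f (a i)) \<Longrightarrow>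
           ennreal p * emeasure lborel (\<Union>i\<in>C. {a i..b i}) \<le> emeasure lborel (f ` (\<Union>i\<in>C. {a i..b i}))"
    unfolding e1 e2 by (intro nn_integral_mono ennreal_leI) auto
qed

text \<open>Closed intervals are the closed balls of the line, so the Vitali theorem for balls
  applies; an interval has to contain \<open>t\<close> but need not be centred there.\<close>

lemma Vitali_intervals:
  fixes A G :: "real set"
  assumes G: "open G" "A \<subseteq> G"
    and fine: "\<And>t \<delta>. \<lbrakk>t \<in> A; 0 < \<delta>\<rbrakk> \<Longrightarrow> \<exists>a b. a < b \<and> t \<in> {a..b} \<and> b - a < \<delta> \<and> P a b"
  obtains C where "countable C" "disjoint_family_on (\<lambda>(a, b). {a..b}) C"
    "\<And>a b. (a, b) \<in> C \<Longrightarrow> a < b \<and> {a..b} \<subseteq> G \<and> P a b" "negligible (A - (\<Union>(a, b)\<in>C. {a..b}))"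
proof -
  define I where "I = {(a, b). a < b \<and> {a..b} \<subseteq> G \<and> P a b}"
  have cb: "cball ((a + b) / 2) ((b - a) / 2) = {a..b}" for a b :: real
    by (auto simp: cball_eq_atLeastAtMost field_simps)
  obtain C where C: "countable C" "C \<subseteq> I"
     "pairwise (\<lambda>i j. disjnt (cball ((fst i + snd i) / 2) ((snd i - fst i) / 2)) (cball ((fst j + snd j) / 2) ((snd j - fst j) / 2))) C"
     "negligible (A - (\<Union>i \<in> C. cball ((fst i + snd i) / 2) ((snd i - fst i) / 2)))"
  proof (rule Vitali_covering_theorem_cballs[where K = I and S = A
        and a = "\<lambda>i. (fst i + snd i) / 2" and r = "\<lambda>i. (snd i - fst i) / 2"])
    show "0 < (snd i - fst i) / 2" if "i \<in> I" for i using that by (auto simp: I_def)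
    fix t d :: real assume t: "t \<in> A" "0 < d"
    obtain e where e: "0 < e" "ball t e \<subseteq> G" using G t openE by blast
    obtain a b where ab: "a < b" "t \<in> {a..b}" "b - a < min d e" "P a b"
      using fine[OF t(1), of "min d e"] t(2) e(1) by auto
    have "{a..b} \<subseteq> ball t e" using ab by (auto simp: dist_real_def)
    then have "(a, b) \<in> I" using ab e by (auto simp: I_def)
    moreover have "t \<in> cball ((a + b) / 2) ((b - a) / 2)" using ab(2) unfolding cb .
    moreover have "(b - a) / 2 < d" using ab by simp
    ultimately show "\<exists>i. i \<in> I \<and> t \<in> cball ((fst i + snd i) / 2) ((snd i - fst i) / 2) \<and> (snd i - fst i) / 2 < d"
      by (intro exI[of _ "(a, b)"]) auto
  qed
  show ?thesis
  proof (rule that[OF C(1)])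
    show "disjoint_family_on (\<lambda>(a, b). {a..b}) C"
      using C(3) unfolding cb disjoint_family_on_def pairwise_def disjnt_def by (auto simp: split_beta)
    show "\<And>a b. (a, b) \<in> C \<Longrightarrow> a < b \<and> {a..b} \<subseteq> G \<and> P a b" using C(2) by (auto simp: I_def)
    show "negligible (A - (\<Union>(a, b)\<in>C. {a..b}))" using C(4) unfolding cb by (simp add: split_beta)
  qed
qed

text \<open>Cover \<open>A\<close> by intervals of small slope and then, inside their union, by intervals of large slope;
  the total increments of \<open>f\<close> compare as measures of images under \<open>f\<close>.\<close>

lemma negligible_two_slopes:
  fixes f :: "real \<Rightarrow> real"
  assumes f: "strict_mono f" "continuous_on UNIV f" and A: "A \<in> lmeasurable" and pq: "0 \<le> p" "p < q"
    and lo: "\<And>t \<delta>. \<lbrakk>t \<in> A; 0 < \<delta>\<rbrakk> \<Longrightarrow> \<exists>a b. a < b \<and> t \<in> {a..b} \<and> b - a < \<delta> \<and> f b - f a \<le> p * (b - a)"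
    and hi: "\<And>t \<delta>. \<lbrakk>t \<in> A; 0 < \<delta>\<rbrakk> \<Longrightarrow> \<exists>a b. a < b \<and> t \<in> {a..b} \<and> b - a < \<delta> \<and> q * (b - a) \<le> f b - f a"
  shows "negligible A"
proof -
  have "q * measure lebesgue A \<le> p * measure lebesgue A"
  proof (rule field_le_epsilon)
    fix e :: real assume e: "0 < e"
    \<comment> \<open>The excess of \<open>G\<close> over \<open>A\<close> is multiplied by
      \<open>p\<close> in the end; dividing by \<open>p + 1\<close> keeps the product below
      \<open>e\<close> and covers \<open>p = 0\<close>.\<close>
    have "0 < e / (p + 1)" using e pq(1) by simp
    then obtain G where G: "open G" "A \<subseteq> G" "G - A \<in> lmeasurable"
        "emeasure lebesgue (G - A) < ennreal (e / (p + 1))"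
      using sets_lebesgue_outer_open[of A "e / (p + 1)"] A by (auto simp: fmeasurableD)
    have Gm: "G \<in> lmeasurable" "measure lebesgue G \<le> measure lebesgue A + e / (p + 1)"
    proof -
      have eq: "G = A \<union> (G - A)" using G(2) by auto
      show "G \<in> lmeasurable" by (subst eq) (intro fmeasurable.Un A G(3))
      have "measure lebesgue G = measure lebesgue A + measure lebesgue (G - A)"
        using measure_Un2[OF A G(3)] eq by (simp add: Diff_Diff_Int Diff_eq Int_assoc)
      moreover have "measure lebesgue (G - A) < e / (p + 1)"
        using G(3,4) e pq(1) by (simp add: emeasure_eq_measure2 ennreal_less_iff)
      ultimately show "measure lebesgue G \<le> measure lebesgue A + e / (p + 1)" by simp
    qed
    obtain C where C: "countable C" "disjoint_family_on (\<lambda>(a, b). {a..b}) C"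
      "\<And>a b. (a, b) \<in> C \<Longrightarrow> a < b \<and> {a..b} \<subseteq> G \<and> f b - f a \<le> p * (b - a)"
      "negligible (A - (\<Union>(a, b)\<in>C. {a..b}))"
      using Vitali_intervals[OF G(1,2) lo] by blast
    define X where "X = (\<Union>(a, b)\<in>C. {a..b})"
    \<comment> \<open>The second cover is sought in the open interiors of the first one, since the
      covering lemma asks for an open set; only countably many endpoints are lost.\<close>
    define G' where "G' = (\<Union>(a, b)\<in>C. {a<..<b})"
    have "open G'" by (auto simp: G'_def)
    obtain D where D: "countable D" "disjoint_family_on (\<lambda>(a, b). {a..b}) D"
      "\<And>a b. (a, b) \<in> D \<Longrightarrow> a < b \<and> {a..b} \<subseteq> G' \<and> q * (b - a) \<le> f b - f a"
      "negligible (A \<inter> G' - (\<Union>(a, b)\<in>D. {a..b}))"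
      using Vitali_intervals[OF \<open>open G'\<close>, of "A \<inter> G'" "\<lambda>a b. q * (b - a) \<le> f b - f a"] hi by blast
    define Y where "Y = (\<Union>(a, b)\<in>D. {a..b})"
    have YX: "Y \<subseteq> X" 
    proof -
      have "Y \<subseteq> G'" using D(3) by (auto simp: Y_def)
      also have "\<dots> \<subseteq> X" unfolding G'_def X_def by (intro UN_mono) auto
      finally show ?thesis .
    qed
    have XG: "X \<subseteq> G" using C(3) by (auto simp: X_def)
    have Xb: "X \<in> sets borel" unfolding X_def using C(1) by (intro sets.countable_UN'') auto
    have Yb: "Y \<in> sets borel" unfolding Y_def using D(1) by (intro sets.countable_UN'') auto
    have neg: "negligible (A - Y)"
    proof (rule negligible_subset)
      have "countable (\<Union>(a, b)\<in>C. {a, b})" using C(1) by auto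
      then have "negligible (\<Union>(a, b)\<in>C. {a, b})"
        unfolding negligible_iff_null_sets
        by (intro null_sets_completionI countable_imp_null_set_lborel)
      then show "negligible ((A - X) \<union> (\<Union>(a, b)\<in>C. {a, b}) \<union> (A \<inter> G' - Y))"
        using C(4) D(4) by (intro negligible_Un) (auto simp: X_def Y_def)
      show "A - Y \<subseteq> (A - X) \<union> (\<Union>(a, b)\<in>C. {a, b}) \<union> (A \<inter> G' - Y)"
        by (fastforce simp: X_def G'_def)
    qed
    have eqs: "X = (\<Union>i\<in>C. {fst i..snd i})" "Y = (\<Union>i\<in>D. {fst i..snd i})"
      "disjoint_family_on (\<lambda>i. {fst i..snd i}) C" "disjoint_family_on (\<lambda>i. {fst i..snd i}) D"
      using C(2) D(2) by (simp_all add: X_def Y_def case_prod_beta')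
    have C3: "\<And>i. i \<in> C \<Longrightarrow> fst i < snd i" "\<And>i. i \<in> C \<Longrightarrow> f (snd i) - f (fst i) \<le> p * (snd i - fst i)"
      using C(3) by auto
    have D3: "\<And>i. i \<in> D \<Longrightarrow> fst i < snd i" "\<And>i. i \<in> D \<Longrightarrow> q * (snd i - fst i) \<le> f (snd i) - f (fst i)"
      using D(3) by auto
    have q0: "0 \<le> q" using pq by simp
    note cX = countable_disjoint_slope_bound[OF f C(1) eqs(3) C3(1) pq(1), folded eqs(1)]
    note cY = countable_disjoint_slope_bound[OF f D(1) eqs(4) D3(1) q0, folded eqs(2)]
    have "ennreal q * emeasure lborel Y \<le> emeasure lborel (f ` Y)" using cY(2) D3(2) by blast
    also have "\<dots> \<le> emeasure lborel (f ` X)"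
      using YX cX(3) cY(3) by (intro emeasure_mono) auto
    also have "\<dots> \<le> ennreal p * emeasure lborel X" using cX(1) C3(2) by blast
    finally have main: "ennreal q * emeasure lebesgue Y \<le> ennreal p * emeasure lebesgue X"
      using Xb Yb by simp
    have Xm: "X \<in> lmeasurable" by (rule fmeasurableI2[OF Gm(1) XG]) (use Xb in simp)
    have Ym: "Y \<in> lmeasurable" by (rule fmeasurableI2[OF Xm YX]) (use Yb in simp)
    have main': "q * measure lebesgue Y \<le> p * measure lebesgue X"
    proof -
      have "ennreal (q * measure lebesgue Y) \<le> ennreal (p * measure lebesgue X)"
        using main pq Xm Ym by (simp add: ennreal_mult' emeasure_eq_measure2)
      then show ?thesis using pq by (simp add: ennreal_le_iff)
    qed
    have "measure lebesgue A \<le> measure lebesgue (Y \<union> (A - Y))"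
      using A Ym by (intro measure_mono_fmeasurable) (auto simp: fmeasurableD)
    also have "\<dots> = measure lebesgue Y"
      using neg by (intro measure_Un_null_set) (auto simp: Ym fmeasurableD negligible_iff_null_sets)
    finally have "q * measure lebesgue A \<le> q * measure lebesgue Y" using pq by (intro mult_left_mono) auto
    also note main'
    also have "p * measure lebesgue X \<le> p * measure lebesgue G"
      using XG Xm Gm(1) pq by (intro mult_left_mono measure_mono_fmeasurable) (auto simp: fmeasurableD)
    also have "\<dots> \<le> p * (measure lebesgue A + e / (p + 1))" using Gm(2) pq by (intro mult_left_mono) auto
    also have "\<dots> \<le> p * measure lebesgue A + e" using e pq by (simp add: field_simps)
    finally show "q * measure lebesgue A \<le> p * measure lebesgue A + e" .
  qed
  then have "(q - p) * measure lebesgue A \<le> 0" by (simp add: algebra_simps)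
  then have "measure lebesgue A = 0" using pq(2) by (simp add: mult_le_0_iff measure_le_0_iff)
  then show ?thesis using A by (simp add: negligible_iff_measure0)
qed

section \<open>Directional derivatives almost everywhere\<close>

definition diff_quot :: "('a::real_normed_vector \<Rightarrow> real) \<Rightarrow> 'a \<Rightarrow> 'a \<Rightarrow> real \<Rightarrow> real" where
  "diff_quot f v x s = (f (x + s *\<^sub>R v) - f x) / s"

text \<open>Lower and upper derivative in direction \<open>v\<close> are separated by
  \<open>p\<close> and \<open>q\<close>. For Lipschitz \<open>f\<close>, the sets with rational
  \<open>p < q\<close> cover all points without a directional derivative.\<close>

definition oscillation_set :: "('a::real_normed_vector \<Rightarrow> real) \<Rightarrow> 'a \<Rightarrow> real \<Rightarrow> real \<Rightarrow> 'a set" where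
  "oscillation_set f v p q = {x. (\<exists>\<^sub>F s in at 0. diff_quot f v x s < p) \<and> (\<exists>\<^sub>F s in at 0. q < diff_quot f v x s)}"

lemma frequently_at_0_iff:
  "(\<exists>\<^sub>F s in at (0::real). P s) \<longleftrightarrow> (\<forall>n. \<exists>s. s \<noteq> 0 \<and> \<bar>s\<bar> < 1 / real (Suc n) \<and> P s)"
proof -
  have "(\<exists>\<^sub>F s in at (0::real). P s) \<longleftrightarrow> (\<forall>d>0. \<exists>s. s \<noteq> 0 \<and> \<bar>s\<bar> < d \<and> P s)"
    unfolding frequently_at by (auto simp: dist_real_def)
  also have "\<dots> \<longleftrightarrow> (\<forall>n. \<exists>s. s \<noteq> 0 \<and> \<bar>s\<bar> < 1 / real (Suc n) \<and> P s)"
  proof (intro iffI allI impI)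
    fix d :: real assume *: "\<forall>n. \<exists>s. s \<noteq> 0 \<and> \<bar>s\<bar> < 1 / real (Suc n) \<and> P s" and "0 < d"
    obtain n where "1 / real (Suc n) < d" using nat_approx_posE[OF \<open>0 < d\<close>] by auto
    with * show "\<exists>s. s \<noteq> 0 \<and> \<bar>s\<bar> < d \<and> P s" by (meson less_trans)
  qed simp
  finally show ?thesis .
qed

text \<open>The union over the admissible \<open>s\<close> is uncountable but open, because each
  difference quotient is continuous in \<open>x\<close>; only the intersection over scales has to be
  countable, which \<open>frequently_at_0_iff\<close> achieves.\<close>

lemma oscillation_set_borel:
  fixes f :: "'a::euclidean_space \<Rightarrow> real"
  assumes f: "continuous_on UNIV f"
  shows "oscillation_set f v p q \<in> sets borel"
proof -
  have cont: "continuous_on UNIV (\<lambda>x. diff_quot f v x s)" if "s \<noteq> 0" for s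
    unfolding diff_quot_def using that by (intro continuous_intros continuous_on_compose2[OF f]; simp)
  have op: "open {x. diff_quot f v x s < p}" "open {x. q < diff_quot f v x s}" if "s \<noteq> 0" for s
    using open_Collect_less[OF cont[OF that] continuous_on_const] open_Collect_less[OF continuous_on_const cont[OF that]] by auto
  have eq: "oscillation_set f v p q =
      (\<Inter>n. \<Union>s\<in>{s. s \<noteq> 0 \<and> \<bar>s\<bar> < 1 / real (Suc n)}. {x. diff_quot f v x s < p}) \<inter>
      (\<Inter>n. \<Union>s\<in>{s. s \<noteq> 0 \<and> \<bar>s\<bar> < 1 / real (Suc n)}. {x. q < diff_quot f v x s})"
    unfolding oscillation_set_def frequently_at_0_iff by auto
  have "(\<Union>s\<in>{s. s \<noteq> 0 \<and> \<bar>s\<bar> < 1 / real (Suc n)}. {x. diff_quot f v x s < p}) \<in> sets borel"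
    "(\<Union>s\<in>{s. s \<noteq> 0 \<and> \<bar>s\<bar> < 1 / real (Suc n)}. {x. q < diff_quot f v x s}) \<in> sets borel" for n
    using op by (auto intro!: borel_open open_UN)
  then show ?thesis unfolding eq by (intro sets.Int sets.countable_INT'') auto
qed

lemma slope_interval:
  fixes h :: "real \<Rightarrow> real"
  assumes s: "s \<noteq> 0" "\<bar>s\<bar> < \<delta>"
  obtains a b where "a < b" "t \<in> {a..b}" "b - a < \<delta>" "(h (t + s) - h t) / s = (h b - h a) / (b - a)"
proof (cases "0 < s")
  case True
  then show ?thesis using s by (intro that[of t "t + s"]) auto
next
  case False
  have "(h (t + s) - h t) / s = (h t - h (t + s)) / (t - (t + s))"
    by (simp add: minus_divide_left[symmetric] divide_simps)
  then show ?thesis using s False by (intro that[of "t + s" t]) auto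
qed

text \<open>Adding \<open>(L + 1) * t\<close> shifts all slopes by a constant and makes them at
  least 1, so \<open>negligible_two_slopes\<close> applies to \<open>h\<close>. The shifted bounds
  are raised to at least 0 and 1: raising the upper bound is harmless, and the lower one stays valid
  because no slope of \<open>h\<close> is below 1.\<close>

lemma negligible_oscillation_set_real:
  fixes f :: "real \<Rightarrow> real"
  assumes lip: "L-lipschitz_on UNIV f" and pq: "p < q"
  shows "negligible (oscillation_set f 1 p q)"
proof -
  define h where "h = (\<lambda>t. f t + (L + 1) * t)"
  have fl: "\<bar>f x - f y\<bar> \<le> L * \<bar>x - y\<bar>" for x y
    using lipschitz_onD[OF lip, of x y] by (simp add: dist_real_def)
  have hslope: "b - a \<le> h b - h a" if "a < b" for a b
    using fl[of b a] that by (simp add: h_def algebra_simps abs_le_iff)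
  have hm: "strict_mono h" using hslope by (intro strict_monoI) fastforce
  have hc: "continuous_on UNIV h"
    unfolding h_def using lipschitz_on_continuous_on[OF lip] by (intro continuous_intros)
  have quot: "diff_quot f 1 t s = (h (t + s) - h t) / s - (L + 1)" if "s \<noteq> 0" for t s
    using that by (simp add: diff_quot_def h_def field_simps)
  have piece: "negligible (oscillation_set f 1 p q \<inter> cball 0 (real n))" (is "negligible ?A") for n
  proof (rule negligible_two_slopes[OF hm hc])
    have "?A \<in> sets borel"
      using oscillation_set_borel[OF lipschitz_on_continuous_on[OF lip]] by auto
    then show "?A \<in> lmeasurable"
      by (intro bounded_set_imp_lmeasurable) (auto intro: bounded_Int)
    show "0 \<le> max 0 (p + (L + 1))" by simp
    have Sgt: "p + (L + 1) < q + (L + 1)" using pq by simp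
    show lo: "\<exists>a b. a < b \<and> t \<in> {a..b} \<and> b - a < \<delta> \<and> h b - h a \<le> max 0 (p + (L + 1)) * (b - a)"
      if t: "t \<in> ?A" "0 < \<delta>" for t \<delta>
    proof -
      obtain s where s: "s \<noteq> 0" "\<bar>s\<bar> < \<delta>" "diff_quot f 1 t s < p"
        using t unfolding oscillation_set_def frequently_at by (auto simp: dist_real_def)
      obtain a b where ab: "a < b" "t \<in> {a..b}" "b - a < \<delta>" "(h (t + s) - h t) / s = (h b - h a) / (b - a)"
        using slope_interval[OF s(1,2)] by blast
      have "(h b - h a) / (b - a) \<le> max 0 (p + (L + 1))" using quot[OF s(1), of t] s(3) ab(4) by simp
      then show ?thesis using ab by (auto simp: pos_divide_le_eq)
    qed
    show hi: "\<exists>a b. a < b \<and> t \<in> {a..b} \<and> b - a < \<delta> \<and> max 1 (q + (L + 1)) * (b - a) \<le> h b - h a"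
      if t: "t \<in> ?A" "0 < \<delta>" for t \<delta>
    proof -
      obtain s where s: "s \<noteq> 0" "\<bar>s\<bar> < \<delta>" "q < diff_quot f 1 t s"
        using t unfolding oscillation_set_def frequently_at by (auto simp: dist_real_def)
      obtain a b where ab: "a < b" "t \<in> {a..b}" "b - a < \<delta>" "(h (t + s) - h t) / s = (h b - h a) / (b - a)"
        using slope_interval[OF s(1,2)] by blast
      have "1 \<le> (h b - h a) / (b - a)" using hslope[OF ab(1)] ab(1) by (simp add: pos_le_divide_eq)
      moreover have "q + (L + 1) \<le> (h b - h a) / (b - a)" using quot[OF s(1), of t] s(3) ab(4) by simp
      ultimately have "max 1 (q + (L + 1)) \<le> (h b - h a) / (b - a)" by simp
      then have "max 1 (q + (L + 1)) * (b - a) \<le> h b - h a" using ab(1) by (simp only: pos_le_divide_eq diff_gt_0_iff_gt)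
      then show ?thesis using ab by blast
    qed
    show "max 0 (p + (L + 1)) < max 1 (q + (L + 1))" using Sgt by linarith
  qed
  have "oscillation_set f 1 p q = (\<Union>n. oscillation_set f 1 p q \<inter> cball 0 (real n))"
    using real_arch_simple by auto
  moreover have "negligible (\<Union>n. oscillation_set f 1 p q \<inter> cball 0 (real n))"
    using piece by (intro negligible_countable_Union) auto
  ultimately show ?thesis by simp
qed

lemma diff_quot_convergent:
  fixes f :: "'a::real_normed_vector \<Rightarrow> real"
  assumes lip: "L-lipschitz_on UNIV f"
    and x: "\<And>p q. \<lbrakk>p \<in> \<rat>; q \<in> \<rat>; p < q\<rbrakk> \<Longrightarrow> x \<notin> oscillation_set f v p q"
  shows "\<exists>D. (diff_quot f v x \<longlongrightarrow> D) (at 0)"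
proof -
  define M where "M = L * norm v"
  have bd: "\<bar>diff_quot f v x s\<bar> \<le> M" if "s \<noteq> 0" for s
    using lipschitz_onD[OF lip, of "x + s *\<^sub>R v" x] that
    by (simp add: diff_quot_def M_def dist_norm dist_real_def field_simps abs_divide)
  define l where "l = Liminf (at 0) (\<lambda>s. ereal (diff_quot f v x s))"
  define u where "u = Limsup (at 0) (\<lambda>s. ereal (diff_quot f v x s))"
  have ev: "\<forall>\<^sub>F s in at 0. s \<noteq> (0::real)" by (simp add: eventually_at_filter)
  have l1: "ereal (- M) \<le> l" unfolding l_def
    by (rule Liminf_bounded, rule eventually_mono[OF ev]) (use bd in \<open>force simp: abs_le_iff\<close>)
  have u1: "u \<le> ereal M" unfolding u_def
    by (rule Limsup_bounded, rule eventually_mono[OF ev]) (use bd in \<open>force simp: abs_le_iff\<close>)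
  have lu: "l \<le> u" unfolding l_def u_def by (rule Liminf_le_Limsup) simp
  have "l = u"
  proof (rule ccontr)
    assume "l \<noteq> u"
    with lu have "l < u" by simp
    then obtain a where a: "l < ereal a" "ereal a < u" using ereal_dense2 by blast
    then obtain b where b: "ereal a < ereal b" "ereal b < u" using ereal_dense2 by blast
    then have "a < b" by simp
    then obtain p where p: "p \<in> \<rat>" "a < p" "p < b" using Rats_dense_in_real by blast
    then obtain q where q: "q \<in> \<rat>" "p < q" "q < b" using Rats_dense_in_real by blast
    have "\<exists>\<^sub>F s in at 0. diff_quot f v x s < p"
    proof (rule ccontr)
      assume "\<not> ?thesis"
      then have "\<forall>\<^sub>F s in at 0. ereal p \<le> ereal (diff_quot f v x s)" by (simp add: not_frequently not_less)
      then have "ereal p \<le> l" unfolding l_def by (rule Liminf_bounded)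
      with a p show False by (metis less_ereal.simps(1) less_le_trans not_less_iff_gr_or_eq)
    qed
    moreover have "\<exists>\<^sub>F s in at 0. q < diff_quot f v x s"
    proof (rule ccontr)
      assume "\<not> ?thesis"
      then have "\<forall>\<^sub>F s in at 0. ereal (diff_quot f v x s) \<le> ereal q" by (simp add: not_frequently not_less)
      then have "u \<le> ereal q" unfolding u_def by (rule Limsup_bounded)
      with b q show False by (metis less_ereal.simps(1) less_le_trans not_less_iff_gr_or_eq)
    qed
    ultimately show False using x[OF p(1) q(1,2)] by (simp add: oscillation_set_def)
  qed
  obtain D where D: "l = ereal D" using l1 u1 \<open>l = u\<close> by (cases l) auto
  have "((\<lambda>s. ereal (diff_quot f v x s)) \<longlongrightarrow> ereal D) (at 0)"
    by (rule Liminf_eq_Limsup) (use D \<open>l = u\<close> in \<open>simp_all add: l_def u_def\<close>)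
  then show ?thesis by auto
qed

text \<open>Fubini without a change of coordinates: among the pairs \<open>(x, t)\<close> with
  \<open>x + t *\<^sub>R v\<close> in the oscillation set, each section with \<open>x\<close> fixed
  is null by the one-dimensional case, whereas each section with \<open>t\<close> fixed is a
  translate of the oscillation set. The measure of that set, integrated over an infinite line, is 0,
  so it vanishes.\<close>

lemma AE_diff_quot_convergent:
  fixes f :: "'a::euclidean_space \<Rightarrow> real"
  assumes lip: "L-lipschitz_on UNIV f"
  shows "AE x in lborel. \<exists>D. (diff_quot f v x \<longlongrightarrow> D) (at 0)"
proof -
  have null: "oscillation_set f v p q \<in> null_sets lborel" (is "?B \<in> _") if pq: "p < q" for p q
  proof -
    have B: "?B \<in> sets borel" using oscillation_set_borel lipschitz_on_continuous_on[OF lip] by blast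
    define E where "E = (\<lambda>z. fst z + snd z *\<^sub>R v) -` ?B"
    have E: "E \<in> sets (lborel \<Otimes>\<^sub>M lborel)"
    proof -
      have "(\<lambda>z. fst z + snd z *\<^sub>R v) \<in> borel_measurable (lborel \<Otimes>\<^sub>M lborel)"
        by measurable
      from measurable_sets[OF this B] show ?thesis by (simp add: E_def space_pair_measure)
    qed
    have "emeasure lborel (Pair x -` E) = 0" for x
    proof -
      have "negligible (oscillation_set (\<lambda>t. f (x + t *\<^sub>R v)) 1 p q)"
      proof (rule negligible_oscillation_set_real[OF _ pq])
        show "(L * norm v)-lipschitz_on UNIV (\<lambda>t. f (x + t *\<^sub>R v))"
        proof (rule lipschitz_onI)
          show "0 \<le> L * norm v" using lipschitz_on_nonneg[OF lip] by simp
          fix s t :: real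
          have "(x + s *\<^sub>R v) - (x + t *\<^sub>R v) = (s - t) *\<^sub>R v" by (simp add: algebra_simps)
          then have eq: "dist (x + s *\<^sub>R v) (x + t *\<^sub>R v) = norm v * dist s t"
            by (simp add: dist_norm)
          show "dist (f (x + s *\<^sub>R v)) (f (x + t *\<^sub>R v)) \<le> L * norm v * dist s t"
            using lipschitz_onD[OF lip, of "x + s *\<^sub>R v" "x + t *\<^sub>R v"] unfolding eq
            by (simp add: mult.assoc)
        qed
      qed
      moreover have "oscillation_set (\<lambda>t. f (x + t *\<^sub>R v)) 1 p q = Pair x -` E"
        by (auto simp: oscillation_set_def E_def diff_quot_def algebra_simps)
      ultimately have "Pair x -` E \<in> null_sets lebesgue" by (simp add: negligible_iff_null_sets)
      moreover have "Pair x -` E \<in> sets lborel" using sets_Pair1[OF E] .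
      ultimately show ?thesis by (auto simp: null_sets_def)
    qed
    then have "emeasure (lborel \<Otimes>\<^sub>M lborel) E = 0"
      using lborel.emeasure_pair_measure_alt[OF E] by simp
    moreover have "emeasure (lborel \<Otimes>\<^sub>M lborel) E = (\<integral>\<^sup>+t. emeasure lborel ((\<lambda>x. (x, t)) -` E) \<partial>lborel)"
      using lborel_pair.emeasure_pair_measure_alt2[OF E] .
    moreover have "emeasure lborel ((\<lambda>x. (x, t)) -` E) = emeasure lborel ?B" for t
    proof -
      have "emeasure (distr lborel borel ((+) (t *\<^sub>R v))) ?B = emeasure lborel ((\<lambda>x. (x, t)) -` E)"
        by (subst emeasure_distr) (use B in \<open>auto simp: E_def add.commute vimage_def\<close>)
      then show ?thesis by (simp add: lborel_distr_plus)
    qed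
    ultimately have "emeasure lborel ?B * \<infinity> = 0" by simp
    then have "emeasure lborel ?B = 0" by (simp add: ennreal_mult_eq_top_iff)
    then show ?thesis using B by (simp add: null_sets_def)
  qed
  have "(\<Union>(p, q)\<in>{(p, q). p \<in> \<rat> \<and> q \<in> \<rat> \<and> p < q}. oscillation_set f v p q) \<in> null_sets lborel"
  proof (rule null_sets_UN')
    show "countable {(p::real, q::real). p \<in> \<rat> \<and> q \<in> \<rat> \<and> p < q}"
      by (rule countable_subset[of _ "\<rat> \<times> \<rat>"]) (auto simp: countable_rat)
  qed (use null in auto)
  from AE_not_in[OF this] show ?thesis
    by (rule eventually_mono) (rule diff_quot_convergent[OF lip], auto)
qed

section \<open>Surfaces swept out by rays\<close>

text \<open>Over unit time the maximum of \<open>\<bar>\<eta>\<bar>\<close> contributes only a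
  quarter of itself to its own bound and can be absorbed; this produces the factors 4/3 and
  1/3.\<close>

lemma derivative_estimate:
  fixes \<eta> \<eta>' :: "real \<Rightarrow> real"
  assumes d: "\<And>t. t \<in> {0..1} \<Longrightarrow> (\<eta> has_real_derivative \<eta>' t) (at t within {0..1})"
    and bd: "\<And>t. t \<in> {0..1} \<Longrightarrow> \<bar>\<eta>' t\<bar> \<le> \<delta> + \<bar>\<eta> t\<bar> / 4" and t: "t \<in> {0..1}"
  shows "\<bar>\<eta> t - \<eta> 0\<bar> \<le> (4 * \<delta> + \<bar>\<eta> 0\<bar>) / 3"
proof -
  have "continuous_on {0..1} \<eta>" using d by (rule DERIV_continuous_on)
  then have "continuous_on {0..1} (\<lambda>t. \<bar>\<eta> t\<bar>)" by (intro continuous_intros)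
  then obtain m where m: "m \<in> {0..1}" "\<And>t. t \<in> {0..1} \<Longrightarrow> \<bar>\<eta> t\<bar> \<le> \<bar>\<eta> m\<bar>"
    using continuous_attains_sup[of "{0..1::real}" "\<lambda>t. \<bar>\<eta> t\<bar>"] by auto
  have B0: "0 \<le> \<delta> + \<bar>\<eta> m\<bar> / 4" using bd[OF m(1)] by linarith
  have var: "\<bar>\<eta> t - \<eta> 0\<bar> \<le> \<delta> + \<bar>\<eta> m\<bar> / 4" if "t \<in> {0..1}" for t
  proof -
    have "norm (\<eta> t - \<eta> 0) \<le> (\<delta> + \<bar>\<eta> m\<bar> / 4) * norm (t - 0)"
    proof (rule field_differentiable_bound[where S = "{0..1}" and f' = \<eta>'])
      show "norm (\<eta>' s) \<le> \<delta> + \<bar>\<eta> m\<bar> / 4" if "s \<in> {0..1}" for s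
        using bd[OF that] m(2)[OF that] by simp
    qed (use d that in auto)
    also have "\<dots> \<le> (\<delta> + \<bar>\<eta> m\<bar> / 4) * 1" using B0 that by (intro mult_left_mono) auto
    finally show ?thesis by simp
  qed
  have "\<bar>\<eta> m\<bar> \<le> \<bar>\<eta> 0\<bar> + \<bar>\<eta> m - \<eta> 0\<bar>" by linarith
  with var[OF t] var[OF m(1)] show ?thesis by simp
qed

text \<open>The curve \<open>z0 + t *\<^sub>R a + y t *\<^sub>R e\<close> is to be orthogonal to
  \<open>w\<close>: its velocity is \<open>a + y' *\<^sub>R e\<close>, and
  \<open>w \<bullet> e = 1\<close> in the intended setting. The direction \<open>a\<close> is not
  confined to the complement of \<open>e\<close>, so that heights can be differentiated on an open
  set of directions.\<close>

definition ray :: "('a::euclidean_space \<Rightarrow> 'a) \<Rightarrow> 'a \<Rightarrow> 'a \<Rightarrow> 'a \<Rightarrow> real \<Rightarrow> (real \<Rightarrow> real) \<Rightarrow> bool" where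
  "ray w e z0 a c y \<longleftrightarrow> y 0 = c \<and>
     (\<forall>t\<in>{0..1}. (y has_real_derivative - (w (z0 + t *\<^sub>R a + y t *\<^sub>R e) \<bullet> a)) (at t within {0..1}))"

text \<open>The choice is immaterial when \<open>K * norm a \<le> 1 / 4\<close>, by
  \<open>ray_height\<close>.\<close>

definition height :: "('a::euclidean_space \<Rightarrow> 'a) \<Rightarrow> 'a \<Rightarrow> 'a \<Rightarrow> 'a \<Rightarrow> real \<Rightarrow> real" where
  "height w e z0 a c = (SOME y. ray w e z0 a c y) 1"

text \<open>All bounds hold on the whole space, so rays run for unit time without leaving a domain;
  the localisation takes place when \<open>w\<close> is built from \<open>g\<close>.\<close>

locale transversal_field =
  fixes w :: "'a::euclidean_space \<Rightarrow> 'a" and e :: 'a and K M :: real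
  assumes norm_e: "norm e = 1"
    and w_e: "\<And>p. w p \<bullet> e = 1"
    and w_lip: "\<And>p q. norm (w p - w q) \<le> K * norm (p - q)"
    and w_bd: "\<And>p. norm (w p) \<le> M"
    and K_pos: "0 < K"
begin

lemma M_pos: "1 \<le> M"
proof -
  have "1 = w 0 \<bullet> e" by (simp add: w_e)
  also have "\<dots> \<le> norm (w 0) * norm e" by (rule norm_cauchy_schwarz)
  also have "\<dots> \<le> M" using w_bd[of 0] norm_e by simp
  finally show ?thesis .
qed

lemma w_cont: "continuous_on S w"
  using w_lip K_pos
  by (intro lipschitz_on_continuous_on[of K] lipschitz_onI) (auto simp: dist_norm)

lemma ray_exists:
  assumes a: "K * norm a \<le> 1 / 4"
  shows "\<exists>y. ray w e z0 a c y"
proof -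
  \<comment> \<open>Clamping time turns the problem on \<open>{0..1}\<close> into a fixed point
    problem in the complete space of bounded continuous functions on the line.\<close>
  define \<kappa> where "\<kappa> = (\<lambda>t::real. max 0 (min 1 t))"
  have \<kappa>: "\<kappa> t \<in> {0..1}" "continuous_on S \<kappa>" for t S
    by (auto simp: \<kappa>_def intro!: continuous_intros)
  define F where "F = (\<lambda>(y::real \<Rightarrow> real) s. w (z0 + s *\<^sub>R a + y s *\<^sub>R e) \<bullet> a)"
  have Fc: "continuous_on S (F (apply_bcontfun y))" for S and y :: "real \<Rightarrow>\<^sub>C real"
    unfolding F_def
    by (intro continuous_intros continuous_on_compose2[OF w_cont[of UNIV]]) auto
  have Fi: "F (apply_bcontfun y) integrable_on {0..b}" for b and y :: "real \<Rightarrow>\<^sub>C real"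
    by (intro integrable_continuous_real Fc)
  define T where "T = (\<lambda>(y::real \<Rightarrow>\<^sub>C real) t. c - integral {0..\<kappa> t} (F (apply_bcontfun y)))"
  have Tb: "T y \<in> bcontfun" for y
  proof (rule bcontfun_normI)
    have "continuous_on {0..1} (\<lambda>t. integral {0..t} (F (apply_bcontfun y)))"
      by (rule indefinite_integral_continuous_1[OF Fi])
    then have "continuous_on UNIV (\<lambda>t. integral {0..\<kappa> t} (F (apply_bcontfun y)))"
      by (rule continuous_on_compose2[OF _ \<kappa>(2)]) (use \<kappa>(1) in auto)
    then show "continuous_on UNIV (T y)" unfolding T_def by (intro continuous_intros)
    fix t
    have "norm (integral {0..\<kappa> t} (F (apply_bcontfun y))) \<le> M * norm a * (\<kappa> t - 0)"
    proof (rule integral_bound)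
      fix s
      have "norm (F (apply_bcontfun y) s) \<le> norm (w (z0 + s *\<^sub>R a + apply_bcontfun y s *\<^sub>R e)) * norm a"
        unfolding F_def by (simp add: Cauchy_Schwarz_ineq2)
      also have "\<dots> \<le> M * norm a" using w_bd by (intro mult_right_mono) auto
      finally show "norm (F (apply_bcontfun y) s) \<le> M * norm a" .
    qed (use \<kappa>(1)[of t] Fc in auto)
    also have "\<dots> \<le> M * norm a * 1" using \<kappa>(1)[of t] M_pos by (intro mult_left_mono) auto
    finally show "norm (T y t) \<le> \<bar>c\<bar> + M * norm a" unfolding T_def by simp
  qed
  have Ta: "apply_bcontfun (Bcontfun (T y)) = T y" for y
    using Tb by (simp add: Bcontfun_inverse)
  have "\<exists>!y. Bcontfun (T y) = y"
  proof (rule banach_fix_type[where c = "1/4"])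
    show "\<forall>y z. dist (Bcontfun (T y)) (Bcontfun (T z)) \<le> 1 / 4 * dist y z"
    proof (intro allI dist_bound)
      fix y z :: "real \<Rightarrow>\<^sub>C real" and t
      have "T y t - T z t = integral {0..\<kappa> t} (\<lambda>s. F (apply_bcontfun z) s - F (apply_bcontfun y) s)"
        unfolding T_def by (simp add: integral_diff[OF Fi Fi])
      also have "norm \<dots> \<le> (1/4 * dist y z) * (\<kappa> t - 0)"
      proof (rule integral_bound)
        fix s
        have "norm (F (apply_bcontfun z) s - F (apply_bcontfun y) s) \<le>
            norm (w (z0 + s *\<^sub>R a + apply_bcontfun z s *\<^sub>R e) - w (z0 + s *\<^sub>R a + apply_bcontfun y s *\<^sub>R e)) * norm a"
          unfolding F_def by (simp add: Cauchy_Schwarz_ineq2 flip: inner_diff_left)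
        also have "\<dots> \<le> (K * norm ((z0 + s *\<^sub>R a + apply_bcontfun z s *\<^sub>R e) - (z0 + s *\<^sub>R a + apply_bcontfun y s *\<^sub>R e))) * norm a"
          by (intro mult_right_mono w_lip norm_ge_zero)
        also have "(z0 + s *\<^sub>R a + apply_bcontfun z s *\<^sub>R e) - (z0 + s *\<^sub>R a + apply_bcontfun y s *\<^sub>R e)
            = (apply_bcontfun z s - apply_bcontfun y s) *\<^sub>R e" by (simp add: algebra_simps)
        also have "K * norm ((apply_bcontfun z s - apply_bcontfun y s) *\<^sub>R e) * norm a
            = (K * norm a) * dist (apply_bcontfun y s) (apply_bcontfun z s)"
          by (simp add: norm_e dist_norm abs_minus_commute)
        also have "\<dots> \<le> 1/4 * dist y z" using a K_pos by (intro mult_mono dist_bounded) auto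
        finally show "norm (F (apply_bcontfun z) s - F (apply_bcontfun y) s) \<le> 1/4 * dist y z" .
      qed (use \<kappa>(1)[of t] Fc in \<open>auto intro!: continuous_intros\<close>)
      also have "\<dots> \<le> (1/4 * dist y z) * 1" using \<kappa>(1)[of t] by (intro mult_left_mono) auto
      finally show "dist (apply_bcontfun (Bcontfun (T y)) t) (apply_bcontfun (Bcontfun (T z)) t) \<le> 1/4 * dist y z"
        by (simp add: Ta dist_norm)
    qed
  qed auto
  then obtain y where "Bcontfun (T y) = y" by blast
  then have fixp: "apply_bcontfun y = T y" using Ta by metis
  have on01: "apply_bcontfun y t = c - integral {0..t} (F (apply_bcontfun y))" if "t \<in> {0..1}" for t
    using that by (subst fixp) (simp add: T_def \<kappa>_def)
  have "ray w e z0 a c (apply_bcontfun y)"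
    unfolding ray_def
  proof (intro conjI ballI)
    show "apply_bcontfun y 0 = c" using on01[of 0] by simp
    fix t :: real assume t: "t \<in> {0..1}"
    have "((\<lambda>t. integral {0..t} (F (apply_bcontfun y))) has_real_derivative F (apply_bcontfun y) t) (at t within {0..1})"
      by (rule integral_has_real_derivative[OF Fc t])
    then have "((\<lambda>t. c - integral {0..t} (F (apply_bcontfun y))) has_real_derivative 0 - F (apply_bcontfun y) t) (at t within {0..1})"
      by (intro DERIV_diff DERIV_const)
    then have "(apply_bcontfun y has_real_derivative 0 - F (apply_bcontfun y) t) (at t within {0..1})"
      unfolding has_field_derivative_def by (rule has_derivative_transform[OF t, rotated]) (rule on01)
    then show "(apply_bcontfun y has_real_derivative
        - (w (z0 + t *\<^sub>R a + apply_bcontfun y t *\<^sub>R e) \<bullet> a)) (at t within {0..1})"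
      by (simp add: F_def)
  qed
  then show ?thesis by blast
qed

end

lemma ray_const: "ray w e z0 0 c (\<lambda>_. c)"
  by (simp add: ray_def)

text \<open>One estimate for simultaneous perturbations of the field, the direction and the starting
  height. Its special cases give a bound on rays, their uniqueness, Lipschitz dependence on
  \<open>a\<close>, near-identity dependence on \<open>c\<close>, and stability under
  averaging.\<close>

lemma ray_compare:
  assumes w1: "transversal_field w1 e K M" and w2: "transversal_field w2 e K M"
    and close: "\<And>p. norm (w1 p - w2 p) \<le> d"
    and y1: "ray w1 e z0 a1 c1 y1" and y2: "ray w2 e z0 a2 c2 y2"
    and a1: "K * norm a1 \<le> 1 / 4" and t: "t \<in> {0..1}"
  shows "\<bar>y1 t - y2 t - (c1 - c2)\<bar> \<le> ((1 + 4 * M) * norm (a1 - a2) + 4 * d * norm a1 + \<bar>c1 - c2\<bar>) / 3"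
proof -
  interpret w1: transversal_field w1 e K M by fact
  interpret w2: transversal_field w2 e K M by fact
  define q1 where "q1 = (\<lambda>t. z0 + t *\<^sub>R a1 + y1 t *\<^sub>R e)"
  define q2 where "q2 = (\<lambda>t. z0 + t *\<^sub>R a2 + y2 t *\<^sub>R e)"
  define \<delta> where "\<delta> = (1 / 4 + M) * norm (a1 - a2) + d * norm a1"
  have "\<bar>(y1 t - y2 t) - (y1 0 - y2 0)\<bar> \<le> (4 * \<delta> + \<bar>y1 0 - y2 0\<bar>) / 3"
  proof (rule derivative_estimate[where \<eta> = "\<lambda>t. y1 t - y2 t"])
    show "((\<lambda>t. y1 t - y2 t) has_real_derivative - (w1 (q1 t) \<bullet> a1) - - (w2 (q2 t) \<bullet> a2)) (at t within {0..1})"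
      if "t \<in> {0..1}" for t
      using y1 y2 that unfolding ray_def q1_def q2_def by (intro DERIV_diff) auto
    fix t :: real assume t: "t \<in> {0..1}"
    have q12: "norm (q1 t - q2 t) \<le> norm (a1 - a2) + \<bar>y1 t - y2 t\<bar>"
    proof -
      have "q1 t - q2 t = t *\<^sub>R (a1 - a2) + (y1 t - y2 t) *\<^sub>R e" by (simp add: q1_def q2_def algebra_simps)
      also have "norm \<dots> \<le> \<bar>t\<bar> * norm (a1 - a2) + \<bar>y1 t - y2 t\<bar>"
        using norm_triangle_ineq[of "t *\<^sub>R (a1 - a2)" "(y1 t - y2 t) *\<^sub>R e"] w1.norm_e by simp
      also have "\<dots> \<le> 1 * norm (a1 - a2) + \<bar>y1 t - y2 t\<bar>" using t by (intro add_mono mult_right_mono) auto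
      finally show ?thesis by simp
    qed
    have e1: "\<bar>(w1 (q1 t) - w1 (q2 t)) \<bullet> a1\<bar> \<le> 1 / 4 * (norm (a1 - a2) + \<bar>y1 t - y2 t\<bar>)"
    proof -
      have "\<bar>(w1 (q1 t) - w1 (q2 t)) \<bullet> a1\<bar> \<le> norm (w1 (q1 t) - w1 (q2 t)) * norm a1"
        by (rule Cauchy_Schwarz_ineq2)
      also have "\<dots> \<le> (K * norm (q1 t - q2 t)) * norm a1" using w1.w_lip by (intro mult_right_mono) auto
      also have "\<dots> = (K * norm a1) * norm (q1 t - q2 t)" by simp
      also have "\<dots> \<le> 1 / 4 * (norm (a1 - a2) + \<bar>y1 t - y2 t\<bar>)"
        using q12 a1 w1.K_pos by (intro mult_mono) auto
      finally show ?thesis .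
    qed
    have e2: "\<bar>(w1 (q2 t) - w2 (q2 t)) \<bullet> a1\<bar> \<le> d * norm a1"
      using Cauchy_Schwarz_ineq2[of "w1 (q2 t) - w2 (q2 t)" a1] mult_right_mono[OF close[of "q2 t"] norm_ge_zero[of a1]]
      by linarith
    have e3: "\<bar>w2 (q2 t) \<bullet> (a1 - a2)\<bar> \<le> M * norm (a1 - a2)"
      using Cauchy_Schwarz_ineq2[of "w2 (q2 t)" "a1 - a2"] mult_right_mono[OF w2.w_bd[of "q2 t"] norm_ge_zero[of "a1 - a2"]]
      by linarith
    have eq: "w1 (q1 t) \<bullet> a1 - w2 (q2 t) \<bullet> a2 =
        (w1 (q1 t) - w1 (q2 t)) \<bullet> a1 + (w1 (q2 t) - w2 (q2 t)) \<bullet> a1 + w2 (q2 t) \<bullet> (a1 - a2)"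
      by (simp add: inner_diff_left inner_diff_right)
    have "\<bar>w1 (q1 t) \<bullet> a1 - w2 (q2 t) \<bullet> a2\<bar> \<le> \<delta> + \<bar>y1 t - y2 t\<bar> / 4"
      unfolding eq \<delta>_def using e1 e2 e3 by (simp add: algebra_simps abs_le_iff)
    then show "\<bar>- (w1 (q1 t) \<bullet> a1) - - (w2 (q2 t) \<bullet> a2)\<bar> \<le> \<delta> + \<bar>y1 t - y2 t\<bar> / 4" by simp
  qed (rule t)
  moreover have "y1 0 = c1" "y2 0 = c2" using y1 y2 by (auto simp: ray_def)
  ultimately show ?thesis by (simp add: \<delta>_def algebra_simps)
qed

context transversal_field
begin

lemma ray_bound:
  assumes "ray w e z0 a c y" "K * norm a \<le> 1 / 4" "t \<in> {0..1}"
  shows "\<bar>y t - c\<bar> \<le> (1 + 4 * M) / 3 * norm a"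
  using ray_compare[OF transversal_field_axioms transversal_field_axioms _ assms(1) ray_const[of w e z0 c] assms(2,3), of 0]
  by simp

lemma ray_height:
  assumes y: "ray w e z0 a c y" and a: "K * norm a \<le> 1 / 4"
  shows "height w e z0 a c = y 1"
proof -
  have "ray w e z0 a c (SOME y. ray w e z0 a c y)" using y by (rule someI[of "ray w e z0 a c"])
  from ray_compare[OF transversal_field_axioms transversal_field_axioms _ this y a, of 0 1]
  show ?thesis by (simp add: height_def)
qed

end

lemma height_compare:
  assumes w1: "transversal_field w1 e K M" and w2: "transversal_field w2 e K M"
    and close: "\<And>p. norm (w1 p - w2 p) \<le> d"
    and a: "K * norm a1 \<le> 1 / 4" "K * norm a2 \<le> 1 / 4"
  shows "\<bar>height w1 e z0 a1 c1 - height w2 e z0 a2 c2 - (c1 - c2)\<bar> \<le>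
     ((1 + 4 * M) * norm (a1 - a2) + 4 * d * norm a1 + \<bar>c1 - c2\<bar>) / 3"
proof -
  interpret w1: transversal_field w1 e K M by fact
  interpret w2: transversal_field w2 e K M by fact
  obtain y1 y2 where y: "ray w1 e z0 a1 c1 y1" "ray w2 e z0 a2 c2 y2"
    using w1.ray_exists[OF a(1)] w2.ray_exists[OF a(2)] by blast
  show ?thesis
    using ray_compare[OF w1 w2 close y a(1), of 1] w1.ray_height[OF y(1) a(1)] w2.ray_height[OF y(2) a(2)] by simp
qed

section \<open>First-order expansion of the height function\<close>

text \<open>The projection along \<open>e\<close> to the orthogonal complement of
  \<open>w p\<close>, when \<open>w p \<bullet> e = 1\<close>; velocities of rays have this
  form.\<close>

definition lifted :: "('a::real_inner \<Rightarrow> 'a) \<Rightarrow> 'a \<Rightarrow> 'a \<Rightarrow> 'a \<Rightarrow> 'a" where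
  "lifted w e p v = v - (w p \<bullet> v) *\<^sub>R e"

text \<open>The remainder is small uniformly in \<open>p\<close>, because a single modulus has to
  serve along entire rays.\<close>

locale smooth_transversal_field = transversal_field w e K M
  for w :: "'a::euclidean_space \<Rightarrow> 'a" and e K M +
  fixes D :: "'a \<Rightarrow> 'a \<Rightarrow> 'a"
  assumes D_linear: "\<And>p. linear (D p)"
    and D_uniform: "\<And>\<kappa>. 0 < \<kappa> \<Longrightarrow> \<exists>d>0. \<forall>p q. norm (q - p) < d \<longrightarrow> norm (w q - w p - D p (q - p)) \<le> \<kappa> * norm (q - p)"
begin

lemma D_deriv: "(w has_derivative D p) (at p)"
  unfolding has_derivative_within_alt
  using D_linear[of p] D_uniform by (auto simp: linear_conv_bounded_linear) blast

lemma D_bound: "norm (D p v) \<le> K * norm v"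
proof (rule field_le_epsilon)
  fix r :: real assume r: "0 < r"
  define \<kappa> where "\<kappa> = r / (norm v + 1)"
  have \<kappa>: "0 < \<kappa>" using r by (simp add: \<kappa>_def add_nonneg_pos)
  obtain d where d: "0 < d" "\<And>p q. norm (q - p) < d \<Longrightarrow> norm (w q - w p - D p (q - p)) \<le> \<kappa> * norm (q - p)"
    using D_uniform[OF \<kappa>] by blast
  define t where "t = d / (2 * (norm v + 1))"
  have nv: "0 < norm v + 1" by (simp add: add_nonneg_pos)
  have t: "0 < t" "t * norm v < d"
    using d(1) nv by (auto simp: t_def divide_simps)
  have "t * norm (D p v) = norm (D p (t *\<^sub>R v))" using t(1) by (simp add: linear_cmul[OF D_linear])
  also have "\<dots> \<le> norm (w (p + t *\<^sub>R v) - w p) + norm (w (p + t *\<^sub>R v) - w p - D p (t *\<^sub>R v))"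
    by norm
  also have "\<dots> \<le> K * norm (t *\<^sub>R v) + \<kappa> * norm (t *\<^sub>R v)"
    using w_lip[of "p + t *\<^sub>R v" p] d(2)[of "p + t *\<^sub>R v" p] t by (intro add_mono) auto
  also have "\<dots> = t * (K * norm v + \<kappa> * norm v)" using t(1) by (simp add: algebra_simps)
  finally have "norm (D p v) \<le> K * norm v + \<kappa> * norm v" using t(1) by simp
  also have "\<kappa> * norm v \<le> r" using r nv by (simp add: \<kappa>_def divide_simps)
  finally show "norm (D p v) \<le> K * norm v + r" by simp
qed

text \<open>When the direction moves by \<open>h\<close>, the expected change of height at time
  \<open>t\<close> is \<open>- t * (w (p t) \<bullet> h)\<close>, and \<open>\<eta>\<close> is the
  deviation from it. In its derivative the terms of first order in \<open>h\<close> combine into the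
  antisymmetric expression of \<open>defect\<close>, and the term proportional to
  \<open>\<eta>\<close> carries the factor \<open>D (p t) e \<bullet> a\<close>, at most 1/4 in
  size, so \<open>derivative_estimate\<close> applies.\<close>

lemma height_taylor_defect:
  assumes a: "K * norm a \<le> 1 / 4" "K * norm (a + h) \<le> 1 / 4" "norm a \<le> 1"
    and S: "\<And>y t. \<lbrakk>ray w e z0 a c y; t \<in> {0..1}\<rbrakk> \<Longrightarrow> z0 + t *\<^sub>R a + y t *\<^sub>R e \<in> S"
    and defect: "\<And>p x h. p \<in> S \<Longrightarrow> \<bar>D p (lifted w e p x) \<bullet> h - D p (lifted w e p h) \<bullet> x\<bar> \<le> \<delta> * norm x * norm h"
    and \<delta>: "0 \<le> \<delta>" and \<kappa>: "0 \<le> \<kappa>"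
    and modulus: "\<And>p q. norm (q - p) < d \<Longrightarrow> norm (w q - w p - D p (q - p)) \<le> \<kappa> * norm (q - p)"
    and B: "B = 1 + (1 + 4 * M) / 3" and h: "B * norm h < d"
  shows "\<bar>height w e z0 (a + h) c - height w e z0 a c + w (z0 + a + height w e z0 a c *\<^sub>R e) \<bullet> h\<bar>
    \<le> 4 / 3 * (\<delta> + \<kappa> * B + K * B * norm h) * norm h"
proof -
  obtain y0 y1 where y0: "ray w e z0 a c y0" and y1: "ray w e z0 (a + h) c y1"
    using ray_exists[OF a(1)] ray_exists[OF a(2)] by blast
  define p where "p = (\<lambda>t. z0 + t *\<^sub>R a + y0 t *\<^sub>R e)"
  define q where "q = (\<lambda>t. z0 + t *\<^sub>R (a + h) + y1 t *\<^sub>R e)"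
  define \<eta> where "\<eta> = (\<lambda>t. y1 t - y0 t + t * (w (p t) \<bullet> h))"
  define \<eta>' where "\<eta>' = (\<lambda>t. - (w (q t) \<bullet> (a + h)) - - (w (p t) \<bullet> a)
      + (t * (D (p t) (lifted w e (p t) a) \<bullet> h) + 1 * (w (p t) \<bullet> h)))"
  define \<Delta> where "\<Delta> = (\<delta> + \<kappa> * B + K * B * norm h) * norm h"
  have dy0: "(y0 has_real_derivative - (w (p t) \<bullet> a)) (at t within {0..1})"
    and dy1: "(y1 has_real_derivative - (w (q t) \<bullet> (a + h))) (at t within {0..1})" if "t \<in> {0..1}" for t
    using y0 y1 that unfolding ray_def p_def q_def by auto
  have dp: "(p has_vector_derivative lifted w e (p t) a) (at t within {0..1})" if "t \<in> {0..1}" for t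
  proof -
    note dy0[OF that, unfolded p_def, derivative_intros]
    show ?thesis
      unfolding p_def lifted_def by (auto intro!: derivative_eq_intros)
  qed
  have dwp: "((\<lambda>t. w (p t) \<bullet> h) has_real_derivative D (p t) (lifted w e (p t) a) \<bullet> h) (at t within {0..1})"
    if "t \<in> {0..1}" for t
  proof -
    have "((\<lambda>t. w (p t)) has_derivative (\<lambda>s. D (p t) (s *\<^sub>R lifted w e (p t) a))) (at t within {0..1})"
      by (rule has_derivative_compose[OF dp[OF that, unfolded has_vector_derivative_def] D_deriv])
    then have "((\<lambda>t. w (p t) \<bullet> h) has_derivative (\<lambda>s. D (p t) (s *\<^sub>R lifted w e (p t) a) \<bullet> h)) (at t within {0..1})"
      by (rule has_derivative_inner_left)
    then show ?thesis
      by (simp add: has_field_derivative_def linear_cmul[OF D_linear] mult.commute[of _ "_ \<bullet> _"])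
  qed
  have "\<bar>\<eta> 1 - \<eta> 0\<bar> \<le> (4 * \<Delta> + \<bar>\<eta> 0\<bar>) / 3"
  proof (rule derivative_estimate)
    fix t :: real assume t: "t \<in> {0..1}"
    show "(\<eta> has_real_derivative \<eta>' t) (at t within {0..1})"
      unfolding \<eta>_def \<eta>'_def
      by (rule DERIV_add[OF DERIV_diff[OF dy1[OF t] dy0[OF t]]])
        (use DERIV_mult[OF DERIV_ident dwp[OF t]] in \<open>simp add: add.commute mult.commute\<close>)
    \<comment> \<open>The displacement between the two rays is a tangential lift plus the deviation,
      which is how \<open>\<eta>\<close> enters its own derivative.\<close>
    have qp: "q t - p t = t *\<^sub>R lifted w e (p t) h + \<eta> t *\<^sub>R e"
      by (simp add: q_def p_def \<eta>_def lifted_def algebra_simps)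
    have nqp: "norm (q t - p t) \<le> B * norm h"
    proof -
      have "q t - p t = t *\<^sub>R h + (y1 t - y0 t) *\<^sub>R e" by (simp add: q_def p_def algebra_simps)
      also have "norm \<dots> \<le> \<bar>t\<bar> * norm h + \<bar>y1 t - y0 t\<bar>"
        using norm_triangle_ineq[of "t *\<^sub>R h" "(y1 t - y0 t) *\<^sub>R e"] norm_e by simp
      also have "\<bar>t\<bar> * norm h \<le> 1 * norm h" using t by (intro mult_right_mono) auto
      also have "\<bar>y1 t - y0 t\<bar> \<le> (1 + 4 * M) / 3 * norm h"
        using ray_compare[OF transversal_field_axioms transversal_field_axioms _ y1 y0 a(2) t, of 0] by simp
      finally show ?thesis by (simp add: B algebra_simps)
    qed
    define R where "R = w (q t) - w (p t) - D (p t) (q t - p t)"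
    have nR: "norm R \<le> \<kappa> * (B * norm h)"
    proof -
      have "norm R \<le> \<kappa> * norm (q t - p t)" unfolding R_def using nqp h by (intro modulus) linarith
      also have "\<dots> \<le> \<kappa> * (B * norm h)" using nqp \<kappa> by (intro mult_left_mono) auto
      finally show ?thesis .
    qed
    have Dqp: "D (p t) (q t - p t) = t *\<^sub>R D (p t) (lifted w e (p t) h) + \<eta> t *\<^sub>R D (p t) e"
      unfolding qp by (simp add: linear_add[OF D_linear] linear_cmul[OF D_linear])
    have eq: "\<eta>' t = t * (D (p t) (lifted w e (p t) a) \<bullet> h - D (p t) (lifted w e (p t) h) \<bullet> a)
        - \<eta> t * (D (p t) e \<bullet> a) - R \<bullet> a - (w (q t) - w (p t)) \<bullet> h"
      unfolding R_def Dqp \<eta>'_def by (simp add: algebra_simps inner_diff_left inner_add_left inner_add_right)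
    have b1: "\<bar>t * (D (p t) (lifted w e (p t) a) \<bullet> h - D (p t) (lifted w e (p t) h) \<bullet> a)\<bar> \<le> \<delta> * norm h"
    proof -
      have "p t \<in> S" unfolding p_def using S[OF y0 t] .
      from defect[OF this, of a h]
      have "\<bar>t\<bar> * \<bar>D (p t) (lifted w e (p t) a) \<bullet> h - D (p t) (lifted w e (p t) h) \<bullet> a\<bar> \<le> 1 * (\<delta> * norm a * norm h)"
        using t by (intro mult_mono) auto
      also have "\<dots> \<le> 1 * (\<delta> * 1 * norm h)"
        using a(3) \<delta> by (intro mult_left_mono mult_right_mono) auto
      finally show ?thesis by (simp add: abs_mult)
    qed
    have b2: "\<bar>\<eta> t * (D (p t) e \<bullet> a)\<bar> \<le> \<bar>\<eta> t\<bar> / 4"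
    proof -
      have "\<bar>D (p t) e \<bullet> a\<bar> \<le> norm (D (p t) e) * norm a" by (rule Cauchy_Schwarz_ineq2)
      also have "\<dots> \<le> K * norm e * norm a" using D_bound by (intro mult_right_mono) auto
      also have "\<dots> \<le> 1 / 4" using a(1) norm_e by simp
      finally have "\<bar>\<eta> t\<bar> * \<bar>D (p t) e \<bullet> a\<bar> \<le> \<bar>\<eta> t\<bar> * (1 / 4)" by (intro mult_left_mono) auto
      then show ?thesis by (simp add: abs_mult)
    qed
    have b3: "\<bar>R \<bullet> a\<bar> \<le> \<kappa> * (B * norm h)"
    proof -
      have "\<bar>R \<bullet> a\<bar> \<le> norm R * norm a" by (rule Cauchy_Schwarz_ineq2)
      also have "\<dots> \<le> norm R * 1" using a(3) by (intro mult_left_mono) auto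
      finally show ?thesis using nR by simp
    qed
    have b4: "\<bar>(w (q t) - w (p t)) \<bullet> h\<bar> \<le> K * (B * norm h) * norm h"
    proof -
      have "\<bar>(w (q t) - w (p t)) \<bullet> h\<bar> \<le> norm (w (q t) - w (p t)) * norm h" by (rule Cauchy_Schwarz_ineq2)
      also have "\<dots> \<le> (K * norm (q t - p t)) * norm h" by (intro mult_right_mono w_lip norm_ge_zero)
      also have "\<dots> \<le> (K * (B * norm h)) * norm h"
        using nqp K_pos by (intro mult_right_mono mult_left_mono) auto
      finally show ?thesis .
    qed
    have "\<bar>\<eta>' t\<bar> \<le> \<delta> * norm h + \<bar>\<eta> t\<bar> / 4 + \<kappa> * (B * norm h) + K * (B * norm h) * norm h"
      unfolding eq using b1 b2 b3 b4 by linarith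
    then show "\<bar>\<eta>' t\<bar> \<le> \<Delta> + \<bar>\<eta> t\<bar> / 4" by (simp add: \<Delta>_def algebra_simps)
  qed simp
  moreover have "\<eta> 0 = 0" using y0 y1 by (simp add: \<eta>_def ray_def)
  ultimately have "\<bar>\<eta> 1\<bar> \<le> 4 / 3 * \<Delta>" by simp
  moreover have "\<eta> 1 = height w e z0 (a + h) c - height w e z0 a c + w (z0 + a + height w e z0 a c *\<^sub>R e) \<bullet> h"
    by (simp add: \<eta>_def p_def ray_height[OF y0 a(1)] ray_height[OF y1 a(2)])
  ultimately show ?thesis by (simp only: \<Delta>_def mult.assoc)
qed

end

context transversal_field
begin

lemma height_lipschitz:
  assumes "K * norm a1 \<le> 1 / 4" "K * norm a2 \<le> 1 / 4"
  shows "\<bar>height w e z0 a1 c - height w e z0 a2 c\<bar> \<le> (1 + 4 * M) / 3 * norm (a1 - a2)"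
  using height_compare[OF transversal_field_axioms transversal_field_axioms _ assms, of 0 z0 c c] by simp

lemma graph_point_lipschitz:
  assumes a: "K * norm a1 \<le> 1 / 4" "K * norm a2 \<le> 1 / 4" and B: "B = 1 + (1 + 4 * M) / 3"
  shows "norm ((z0 + a1 + height w e z0 a1 c *\<^sub>R e) - (z0 + a2 + height w e z0 a2 c *\<^sub>R e)) \<le> B * norm (a1 - a2)"
proof -
  have "(z0 + a1 + height w e z0 a1 c *\<^sub>R e) - (z0 + a2 + height w e z0 a2 c *\<^sub>R e)
      = (a1 - a2) + (height w e z0 a1 c - height w e z0 a2 c) *\<^sub>R e" by (simp add: algebra_simps)
  also have "norm \<dots> \<le> norm (a1 - a2) + \<bar>height w e z0 a1 c - height w e z0 a2 c\<bar>"
    using norm_triangle_ineq[of "a1 - a2" "(height w e z0 a1 c - height w e z0 a2 c) *\<^sub>R e"] norm_e by simp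
  also have "\<dots> \<le> norm (a1 - a2) + (1 + 4 * M) / 3 * norm (a1 - a2)"
    using height_lipschitz[OF a] by simp
  finally show ?thesis by (simp add: B algebra_simps)
qed

end

context smooth_transversal_field
begin

text \<open>\<open>height_taylor_defect\<close> is limited to steps below the modulus
  \<open>d\<close>, which is not uniform over the approximating fields. Tiny steps along the segment
  remove it: \<open>\<kappa>\<close> can be taken arbitrarily small at each step and disappears from
  the bound, while replacing \<open>w\<close> at the current graph point by \<open>w\<close> at the
  initial one costs the quadratic term.\<close>

lemma height_taylor_segment:
  assumes \<rho>: "\<rho> \<le> 1" "K * \<rho> \<le> 1 / 4"
    and S: "\<And>a y t. \<lbrakk>norm a < \<rho>; ray w e z0 a c y; t \<in> {0..1}\<rbrakk> \<Longrightarrow> z0 + t *\<^sub>R a + y t *\<^sub>R e \<in> S"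
    and defect: "\<And>p x h. p \<in> S \<Longrightarrow> \<bar>D p (lifted w e p x) \<bullet> h - D p (lifted w e p h) \<bullet> x\<bar> \<le> \<delta> * norm x * norm h"
    and \<delta>: "0 \<le> \<delta>" and B: "B = 1 + (1 + 4 * M) / 3" and ab: "norm a < \<rho>" "norm b < \<rho>"
  shows "\<bar>height w e z0 b c - height w e z0 a c + w (z0 + a + height w e z0 a c *\<^sub>R e) \<bullet> (b - a)\<bar>
    \<le> (2 * \<delta> + K * B * norm (b - a)) * norm (b - a)"
proof -
  define h where "h = b - a"
  define E where "E = (\<lambda>x. height w e z0 x c)"
  define P where "P = (\<lambda>x. z0 + x + E x *\<^sub>R e)"
  define \<Theta> where "\<Theta> = (\<lambda>s. E (a + s *\<^sub>R h) - E a + s * (w (P a) \<bullet> h))"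
  define N where "N = (2 * \<delta> + K * B * norm h) * norm h"
  have B1: "1 \<le> B" using M_pos by (simp add: B)
  have small: "K * norm x \<le> 1 / 4" if "norm x < \<rho>" for x
  proof -
    have "K * norm x \<le> K * \<rho>" using that K_pos by (intro mult_left_mono) auto
    with \<rho>(2) show ?thesis by simp
  qed
  have seg: "norm (a + s *\<^sub>R h) < \<rho>" if "s \<in> {0..1}" for s
  proof -
    have "a + s *\<^sub>R h \<in> ball 0 \<rho>"
      using convexD_alt[OF convex_ball, of a 0 \<rho> b s] ab that by (simp add: h_def algebra_simps)
    then show ?thesis by simp
  qed
  have E_lip: "\<bar>E x - E y\<bar> \<le> (1 + 4 * M) / 3 * norm (x - y)" if "norm x < \<rho>" "norm y < \<rho>" for x y
    unfolding E_def using height_lipschitz small that by blast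
  have "((1 + 4 * M) / 3)-lipschitz_on (ball 0 \<rho>) E"
    using E_lip M_pos by (intro lipschitz_onI) (auto simp: dist_norm)
  then have cE: "continuous_on (ball 0 \<rho>) E" by (rule lipschitz_on_continuous_on)
  have c\<Theta>: "continuous_on {0..1} \<Theta>"
    unfolding \<Theta>_def
    by (intro continuous_intros continuous_on_compose2[OF cE]) (use seg in auto)
  have incr: "\<exists>\<sigma>>0. s + \<sigma> \<le> 1 \<and> \<bar>\<Theta> (s + \<sigma>) - \<Theta> s\<bar> \<le> (N + \<eta>) * \<sigma>" if s: "0 \<le> s" "s < 1" and \<eta>: "0 < \<eta>" for s \<eta>
  proof -
    \<comment> \<open>With the factor 4/3 of the preceding estimate, this choice keeps the
      contribution of \<open>\<kappa>\<close> below \<open>\<eta> / 2\<close>; a small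
      \<open>\<sigma>\<close> takes care of the other half.\<close>
    define \<kappa> where "\<kappa> = \<eta> / (4 * B * (norm h + 1))"
    have nh: "0 < norm h + 1" by (simp add: add_nonneg_pos)
    have \<kappa>: "0 < \<kappa>" using \<eta> B1 nh by (simp add: \<kappa>_def)
    have \<kappa>h: "4 / 3 * \<kappa> * B * norm h \<le> \<eta> / 2"
    proof -
      have "4 / 3 * \<kappa> * B * norm h = \<eta> / 3 * (norm h / (norm h + 1))" using B1 by (simp add: \<kappa>_def)
      also have "\<dots> \<le> \<eta> / 3 * 1" using \<eta> nh by (intro mult_left_mono) (auto simp: divide_simps)
      finally show ?thesis using \<eta> by linarith
    qed
    obtain d where d: "0 < d" "\<And>p q. norm (q - p) < d \<Longrightarrow> norm (w q - w p - D p (q - p)) \<le> \<kappa> * norm (q - p)"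
      using D_uniform[OF \<kappa>] by blast
    have "((\<lambda>\<sigma>. B * (\<sigma> * norm h)) \<longlongrightarrow> B * (0 * norm h)) (at_right 0)"
      "((\<lambda>\<sigma>. 4 / 3 * K * B * (\<sigma> * norm h) * norm h) \<longlongrightarrow> 4 / 3 * K * B * (0 * norm h) * norm h) (at_right 0)"
      by (intro tendsto_intros)+
    from order_tendstoD(2)[OF this(1), of d] order_tendstoD(2)[OF this(2), of "\<eta> / 2"]
    have "\<forall>\<^sub>F \<sigma> in at_right 0. B * (\<sigma> * norm h) < d"
      "\<forall>\<^sub>F \<sigma> in at_right 0. 4 / 3 * K * B * (\<sigma> * norm h) * norm h < \<eta> / 2"
      using d(1) \<eta> by simp_all
    moreover have "\<forall>\<^sub>F \<sigma> in at_right 0. \<sigma> \<in> {0<..<1 - s}" using s by (intro eventually_at_right_real) auto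
    ultimately have "\<forall>\<^sub>F \<sigma> in at_right 0. B * (\<sigma> * norm h) < d \<and>
        4 / 3 * K * B * (\<sigma> * norm h) * norm h < \<eta> / 2 \<and> \<sigma> \<in> {0<..<1 - s}"
      by eventually_elim simp
    then obtain \<sigma> where \<sigma>: "B * (\<sigma> * norm h) < d" "4 / 3 * K * B * (\<sigma> * norm h) * norm h < \<eta> / 2" "\<sigma> \<in> {0<..<1 - s}"
      using eventually_happens trivial_limit_at_right_real by blast
    define as where "as = a + s *\<^sub>R h"
    have nas: "norm as < \<rho>" "norm (as + \<sigma> *\<^sub>R h) < \<rho>"
      using seg[of s] seg[of "s + \<sigma>"] s \<sigma>(3) by (auto simp: as_def algebra_simps)
    have main: "\<bar>E (as + \<sigma> *\<^sub>R h) - E as + w (P as) \<bullet> (\<sigma> *\<^sub>R h)\<bar>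
        \<le> 4 / 3 * (\<delta> + \<kappa> * B + K * B * norm (\<sigma> *\<^sub>R h)) * norm (\<sigma> *\<^sub>R h)"
      unfolding E_def P_def
    proof (rule height_taylor_defect[OF small small _ _ defect \<delta> _ d(2) B])
      show "norm as < \<rho>" "norm (as + \<sigma> *\<^sub>R h) < \<rho>" by fact+
      show "norm as \<le> 1" using nas \<rho> by simp
      show "0 \<le> \<kappa>" using \<kappa> by simp
      show "B * norm (\<sigma> *\<^sub>R h) < d" using \<sigma> by simp
    qed (use S nas in auto)
    have drift: "\<bar>(w (P as) - w (P a)) \<bullet> h\<bar> \<le> K * B * norm h * norm h"
    proof -
      have "\<bar>(w (P as) - w (P a)) \<bullet> h\<bar> \<le> norm (w (P as) - w (P a)) * norm h" by (rule Cauchy_Schwarz_ineq2)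
      also have "\<dots> \<le> (K * norm (P as - P a)) * norm h" by (intro mult_right_mono w_lip norm_ge_zero)
      also have "\<dots> \<le> (K * (B * norm (as - a))) * norm h"
        using graph_point_lipschitz[OF small[OF nas(1)] small[OF ab(1)] B, of z0 c] K_pos
        unfolding P_def E_def by (intro mult_right_mono mult_left_mono) auto
      also have "norm (as - a) \<le> 1 * norm h" using s mult_right_mono[of s 1 "norm h"] by (simp add: as_def)
      then have "(K * (B * norm (as - a))) * norm h \<le> (K * (B * (1 * norm h))) * norm h"
        using K_pos B1 by (intro mult_right_mono mult_left_mono) auto
      finally show ?thesis by (simp add: mult.assoc)
    qed
    have eq: "\<Theta> (s + \<sigma>) - \<Theta> s = (E (as + \<sigma> *\<^sub>R h) - E as + w (P as) \<bullet> (\<sigma> *\<^sub>R h)) - \<sigma> * ((w (P as) - w (P a)) \<bullet> h)"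
      by (simp add: \<Theta>_def as_def algebra_simps inner_diff_left)
    have "\<bar>\<Theta> (s + \<sigma>) - \<Theta> s\<bar> \<le> 4 / 3 * (\<delta> + \<kappa> * B + K * B * (\<sigma> * norm h)) * (\<sigma> * norm h) + \<sigma> * (K * B * norm h * norm h)"
    proof -
      have "\<bar>\<sigma> * ((w (P as) - w (P a)) \<bullet> h)\<bar> \<le> \<sigma> * (K * B * norm h * norm h)"
        using drift \<sigma>(3) by (simp add: abs_mult)
      moreover have n\<sigma>: "norm (\<sigma> *\<^sub>R h) = \<sigma> * norm h" using \<sigma>(3) by simp
      ultimately show ?thesis using main[unfolded n\<sigma>] unfolding eq by linarith
    qed
    also have "\<dots> = (4 / 3 * \<delta> * norm h + 4 / 3 * \<kappa> * B * norm h
        + 4 / 3 * K * B * (\<sigma> * norm h) * norm h + K * B * norm h * norm h) * \<sigma>"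
      by (simp add: algebra_simps)
    also have "\<dots> \<le> (N + \<eta>) * \<sigma>"
    proof (rule mult_right_mono)
      have "4 / 3 * \<delta> * norm h \<le> 2 * \<delta> * norm h" using \<delta> by (intro mult_right_mono) auto
      with \<kappa>h \<sigma>(2) show "4 / 3 * \<delta> * norm h + 4 / 3 * \<kappa> * B * norm h
        + 4 / 3 * K * B * (\<sigma> * norm h) * norm h + K * B * norm h * norm h \<le> N + \<eta>"
        unfolding N_def distrib_right by linarith
      show "0 \<le> \<sigma>" using \<sigma>(3) by simp
    qed
    finally show ?thesis using \<sigma>(3) by (intro exI[of _ \<sigma>]) auto
  qed
  \<comment> \<open>The Dini lemma is one-sided, so it is run for both signs \<open>k\<close> to
    bound \<open>\<bar>\<Theta> 1\<bar>\<close>.\<close>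
  have one_sided: "- N \<le> k * \<Theta> 1" if k: "\<bar>k\<bar> = 1" for k :: real
  proof -
    have "N * 0 + k * \<Theta> 0 \<le> N * 1 + k * \<Theta> 1"
    proof (rule dini_nondecreasing[where f = "\<lambda>s. N * s + k * \<Theta> s"])
      show "continuous_on {0..1} (\<lambda>s. N * s + k * \<Theta> s)" by (intro continuous_intros c\<Theta>)
      fix s \<eta> :: real assume s: "0 \<le> s" "s < 1" "0 < \<eta>"
      obtain \<sigma> where \<sigma>: "0 < \<sigma>" "s + \<sigma> \<le> 1" "\<bar>\<Theta> (s + \<sigma>) - \<Theta> s\<bar> \<le> (N + \<eta>) * \<sigma>"
        using incr[OF s] by blast
      have "\<bar>k * (\<Theta> (s + \<sigma>) - \<Theta> s)\<bar> \<le> (N + \<eta>) * \<sigma>" using \<sigma>(3) k by (simp add: abs_mult)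
      then have "- \<eta> * \<sigma> \<le> N * \<sigma> + k * (\<Theta> (s + \<sigma>) - \<Theta> s)" by (simp add: abs_le_iff algebra_simps)
      then have "- \<eta> * (s + \<sigma> - s) \<le> N * (s + \<sigma>) + k * \<Theta> (s + \<sigma>) - (N * s + k * \<Theta> s)"
        by (simp add: algebra_simps)
      then show "\<exists>s'>s. s' \<le> 1 \<and> - \<eta> * (s' - s) \<le> N * s' + k * \<Theta> s' - (N * s + k * \<Theta> s)"
        using \<sigma> by (intro exI[of _ "s + \<sigma>"]) auto
    qed simp
    moreover have "\<Theta> 0 = 0" by (simp add: \<Theta>_def)
    ultimately show ?thesis by simp
  qed
  have "\<bar>\<Theta> 1\<bar> \<le> N" using one_sided[of 1] one_sided[of "-1"] by (simp add: abs_le_iff)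
  then show ?thesis by (simp add: \<Theta>_def N_def E_def P_def h_def)
qed

end

text \<open>The approximants share the constants \<open>K\<close> and \<open>M\<close> of
  \<open>w\<close>, which makes all height estimates uniform in \<epsilon>.\<close>

definition nearly_integrable_approx ::
    "('a::euclidean_space \<Rightarrow> 'a) \<Rightarrow> 'a \<Rightarrow> real \<Rightarrow> real \<Rightarrow> 'a set \<Rightarrow> real \<Rightarrow> real \<Rightarrow> bool" where
  "nearly_integrable_approx w e K M S C \<epsilon> \<longleftrightarrow> (\<exists>w' D. smooth_transversal_field w' e K M D \<and>
     (\<forall>p. norm (w p - w' p) \<le> K * \<epsilon>) \<and>
     (\<forall>p\<in>S. \<forall>x h. \<bar>D p (lifted w' e p x) \<bullet> h - D p (lifted w' e p h) \<bullet> x\<bar> \<le> C * \<epsilon> * norm x * norm h))"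

lemma le_by_linear_error:
  fixes x y Q :: real
  assumes "0 < \<epsilon>0" "\<And>\<epsilon>. \<lbrakk>0 < \<epsilon>; \<epsilon> < \<epsilon>0\<rbrakk> \<Longrightarrow> x \<le> y + Q * \<epsilon>"
  shows "x \<le> y"
proof (rule tendsto_lowerbound[where F = "at_right 0"])
  have "((\<lambda>\<epsilon>. y + Q * \<epsilon>) \<longlongrightarrow> y + Q * 0) (at_right 0)" by (intro tendsto_intros)
  then show "((\<lambda>\<epsilon>. y + Q * \<epsilon>) \<longlongrightarrow> y) (at_right 0)" by simp
  show "\<forall>\<^sub>F \<epsilon> in at_right 0. x \<le> y + Q * \<epsilon>"
    using eventually_at_right_real[OF assms(1)] by eventually_elim (use assms(2) in auto)
qed simp

context transversal_field
begin

text \<open>Heights for \<open>w'\<close> and \<open>w\<close> differ by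
  \<open>O(\<epsilon>)\<close> and the defect \<open>C * \<epsilon>\<close> vanishes in the limit,
  whereas the quadratic term does not depend on \<epsilon>. The hypothesis \<open>region\<close>
  keeps every ray in the ball where the defect is controlled.\<close>

lemma height_taylor:
  assumes approx: "\<And>\<epsilon>. \<lbrakk>0 < \<epsilon>; \<epsilon> < \<epsilon>0\<rbrakk> \<Longrightarrow> nearly_integrable_approx w e K M (ball z0 r) C \<epsilon>"
    and pos: "0 < \<epsilon>0" "0 \<le> C"
    and \<rho>: "\<rho> \<le> 1" "K * \<rho> \<le> 1 / 4" and B: "B = 1 + (1 + 4 * M) / 3" and region: "B * \<rho> + \<bar>c\<bar> \<le> r"
    and ab: "norm a < \<rho>" "norm b < \<rho>"
  shows "\<bar>height w e z0 b c - height w e z0 a c + w (z0 + a + height w e z0 a c *\<^sub>R e) \<bullet> (b - a)\<bar>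
    \<le> K * B * norm (b - a) * norm (b - a)"
proof (rule le_by_linear_error[OF pos(1)])
  define h where "h = b - a"
  define Q where "Q = 2 * C * norm h + 2 * (4 / 3 * K) + (K + K * (4 / 3 * K)) * norm h"
  fix \<epsilon> :: real assume \<epsilon>: "0 < \<epsilon>" "\<epsilon> < \<epsilon>0"
  obtain w' D where w': "smooth_transversal_field w' e K M D" and close: "\<And>p. norm (w p - w' p) \<le> K * \<epsilon>"
    and defect: "\<And>p x h. p \<in> ball z0 r \<Longrightarrow>
      \<bar>D p (lifted w' e p x) \<bullet> h - D p (lifted w' e p h) \<bullet> x\<bar> \<le> C * \<epsilon> * norm x * norm h"
    using approx[OF \<epsilon>] unfolding nearly_integrable_approx_def by blast
  interpret w': smooth_transversal_field w' e K M D by fact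
  have B1: "1 \<le> B" using M_pos by (simp add: B)
  have small: "K * norm x \<le> 1 / 4" if "norm x < \<rho>" for x
  proof -
    have "K * norm x \<le> K * \<rho>" using that K_pos by (intro mult_left_mono) auto
    with \<rho>(2) show ?thesis by simp
  qed
  have in_ball: "z0 + t *\<^sub>R x + y t *\<^sub>R e \<in> ball z0 r"
    if x: "norm x < \<rho>" and y: "ray w' e z0 x c y" and t: "t \<in> {0..1}" for x y t
  proof -
    have yt: "\<bar>y t\<bar> \<le> \<bar>c\<bar> + (1 + 4 * M) / 3 * norm x"
      using w'.ray_bound[OF y small[OF x] t] by linarith
    have "norm (t *\<^sub>R x + y t *\<^sub>R e) \<le> \<bar>t\<bar> * norm x + \<bar>y t\<bar>"
      using norm_triangle_ineq[of "t *\<^sub>R x" "y t *\<^sub>R e"] norm_e by simp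
    also have "\<dots> \<le> 1 * norm x + (\<bar>c\<bar> + (1 + 4 * M) / 3 * norm x)"
      using t by (intro add_mono mult_right_mono yt) auto
    also have "\<dots> = \<bar>c\<bar> + B * norm x" by (simp add: B algebra_simps)
    also have "\<dots> < \<bar>c\<bar> + B * \<rho>" using x B1 by simp
    also have "\<dots> \<le> r" using region by simp
    finally have "norm (t *\<^sub>R x + y t *\<^sub>R e) < r" .
    moreover have "z0 - (z0 + t *\<^sub>R x + y t *\<^sub>R e) = - (t *\<^sub>R x + y t *\<^sub>R e)" by simp
    ultimately show ?thesis unfolding mem_ball dist_norm by (metis norm_minus_cancel)
  qed
  define E where "E = (\<lambda>x. height w e z0 x c)"
  define E' where "E' = (\<lambda>x. height w' e z0 x c)"
  have EE': "\<bar>E x - E' x\<bar> \<le> 4 / 3 * K * \<epsilon>" if "norm x < \<rho>" for x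
  proof -
    have "\<bar>E x - E' x\<bar> \<le> 4 * (K * \<epsilon>) * norm x / 3"
      using height_compare[OF transversal_field_axioms w'.transversal_field_axioms close small[OF that] small[OF that], of z0 c c]
      by (simp add: E_def E'_def)
    also have "\<dots> \<le> 4 * (K * \<epsilon>) * 1 / 3"
      using that \<rho>(1) K_pos \<epsilon>(1) by (intro divide_right_mono mult_left_mono) auto
    finally show ?thesis by simp
  qed
  define p where "p = z0 + a + E a *\<^sub>R e"
  define p' where "p' = z0 + a + E' a *\<^sub>R e"
  have nh: "norm (w p - w' p') \<le> (K + K * (4 / 3 * K)) * \<epsilon>"
  proof -
    have "p - p' = (E a - E' a) *\<^sub>R e" by (simp add: p_def p'_def algebra_simps)
    then have "norm (p - p') \<le> 4 / 3 * K * \<epsilon>" using EE'[OF ab(1)] norm_e by simp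
    then have "norm (w p - w p') \<le> K * (4 / 3 * K * \<epsilon>)"
      using w_lip[of p p'] K_pos by (meson less_imp_le mult_left_mono order_trans)
    moreover have "norm (w p - w' p') \<le> norm (w p - w p') + norm (w p' - w' p')" by norm
    ultimately show ?thesis using close[of p'] by (simp add: algebra_simps)
  qed
  have "\<bar>(w p - w' p') \<bullet> h\<bar> \<le> (K + K * (4 / 3 * K)) * \<epsilon> * norm h"
    using Cauchy_Schwarz_ineq2[of "w p - w' p'" h] mult_right_mono[OF nh norm_ge_zero[of h]] by linarith
  moreover have "\<bar>E' b - E' a + w' p' \<bullet> h\<bar> \<le> (2 * (C * \<epsilon>) + K * B * norm h) * norm h"
    unfolding E'_def p'_def h_def
    by (rule w'.height_taylor_segment[where S = "ball z0 r", OF \<rho> _ _ _ B ab])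
      (use pos \<epsilon> in \<open>auto intro: in_ball defect simp del: mem_ball\<close>)
  moreover have "E b - E a + w p \<bullet> h = (E' b - E' a + w' p' \<bullet> h) + (E b - E' b) - (E a - E' a) + (w p - w' p') \<bullet> h"
    by (simp add: inner_diff_left)
  ultimately have "\<bar>E b - E a + w p \<bullet> h\<bar> \<le> (2 * (C * \<epsilon>) + K * B * norm h) * norm h + 4 / 3 * K * \<epsilon> + 4 / 3 * K * \<epsilon>
      + (K + K * (4 / 3 * K)) * \<epsilon> * norm h"
    using EE'[OF ab(1)] EE'[OF ab(2)] by linarith
  also have "\<dots> = K * B * norm h * norm h + Q * \<epsilon>" by (simp add: Q_def algebra_simps)
  finally show "\<bar>height w e z0 b c - height w e z0 a c + w (z0 + a + height w e z0 a c *\<^sub>R e) \<bullet> (b - a)\<bar>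
    \<le> K * B * norm (b - a) * norm (b - a) + (2 * C * norm (b - a) + 2 * (4 / 3 * K) + (K + K * (4 / 3 * K)) * norm (b - a)) * \<epsilon>"
    by (simp only: E_def p_def h_def Q_def)
qed

end

section \<open>Averaging a Lipschitz field\<close>

text \<open>Beyond mass and support, the kernel has to be absolutely continuous
  (\<open>translate_AE\<close>), so that almost everywhere information survives, and its translates
  continuous in total variation (\<open>translate_cont\<close>, with one \<open>\<delta>\<close> for
  all integrands), so that averages of merely bounded functions are uniformly continuous.\<close>

locale averaging_measure = finite_measure \<mu> for \<mu> :: "'a::euclidean_space measure" +
  fixes \<epsilon> :: real
  assumes sets_\<mu> [measurable_cong]: "sets \<mu> = sets borel"
    and mass: "measure \<mu> UNIV = 1"
    and supp: "AE z in \<mu>. norm z < \<epsilon>"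
    and eps_pos: "0 < \<epsilon>"
    and translate_AE: "\<And>P p. (AE q in lborel. P q) \<Longrightarrow> AE z in \<mu>. P (p + z)"
    and translate_cont: "\<And>\<kappa>. 0 < \<kappa> \<Longrightarrow> \<exists>\<delta>>0. \<forall>(f :: 'a \<Rightarrow> 'a) B p q. f \<in> borel_measurable borel \<longrightarrow>
        (\<forall>x. norm (f x) \<le> B) \<longrightarrow> norm (q - p) < \<delta> \<longrightarrow>
        norm ((LINT z|\<mu>. f (q + z)) - (LINT z|\<mu>. f (p + z))) \<le> \<kappa> * B"
begin

lemma space_\<mu> [simp]: "space \<mu> = UNIV"
  using sets_eq_imp_space_eq[OF sets_\<mu>] by simp

lemma integrable_bounded:
  fixes f :: "'a \<Rightarrow> 'b::{banach, second_countable_topology}"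
  assumes "f \<in> borel_measurable borel" "AE z in \<mu>. norm (f z) \<le> B"
  shows "integrable \<mu> f"
  using assms by (intro integrable_const_bound[of _ B]) auto

lemma average_bound:
  fixes f :: "'a \<Rightarrow> 'b::{banach, second_countable_topology}"
  assumes f: "f \<in> borel_measurable borel" and B: "AE z in \<mu>. norm (f z) \<le> B"
  shows "norm (LINT z|\<mu>. f z) \<le> B"
proof -
  have "norm (LINT z|\<mu>. f z) \<le> (LINT z|\<mu>. norm (f z))" by simp
  also have "\<dots> \<le> (LINT z|\<mu>. B)"
    using B integrable_bounded[OF f B] by (intro integral_mono_AE) auto
  also have "\<dots> = B" by (simp add: mass)
  finally show ?thesis .
qed

end

lemma has_vector_derivative_quotient:
  fixes f :: "real \<Rightarrow> 'a::real_normed_vector"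
  assumes "((\<lambda>s. (f (t + s) - f t) /\<^sub>R s) \<longlongrightarrow> f') (at 0)"
  shows "(f has_vector_derivative f') (at t)"
proof -
  have "((\<lambda>s. norm ((f (t + s) - f t) /\<^sub>R s - f')) \<longlongrightarrow> 0) (at 0)"
    using assms by (simp add: LIM_zero tendsto_norm_zero)
  moreover have "norm ((f (t + s) - f t) /\<^sub>R s - f') = norm (f (t + s) - f t - s *\<^sub>R f') / norm s" if "s \<noteq> 0" for s
  proof -
    have "(f (t + s) - f t) /\<^sub>R s - f' = (f (t + s) - f t - s *\<^sub>R f') /\<^sub>R s"
      using that by (simp add: scaleR_diff_right)
    then show ?thesis by (simp add: divide_inverse mult.commute)
  qed
  then have "\<forall>\<^sub>F s in at 0. norm ((f (t + s) - f t) /\<^sub>R s - f') = norm (f (t + s) - f t - s *\<^sub>R f') / norm s"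
    by (simp add: eventually_at_filter)
  ultimately have "((\<lambda>s. norm (f (t + s) - f t - s *\<^sub>R f') / norm s) \<longlongrightarrow> 0) (at 0)"
    by (rule Lim_transform_eventually)
  then show ?thesis
    by (simp add: has_vector_derivative_def has_derivative_at bounded_linear_scaleR_left)
qed

text \<open>Coordinates are moved one at a time, with the mean value inequality for each move;
  uniform continuity of the partial derivatives makes the remainder uniform in \<open>p\<close>. The
  factor \<open>n\<close> in \<open>\<kappa>'\<close> and \<open>\<delta>0\<close> pays for
  estimating the sum of the coordinates by the norm.\<close>

lemma uniform_derivative_from_partials:
  fixes f :: "real ^ 'n \<Rightarrow> 'b::real_normed_vector" and d :: "'n::finite \<Rightarrow> real ^ 'n \<Rightarrow> 'b"
  assumes part: "\<And>k p. ((\<lambda>s. f (p + s *\<^sub>R axis k 1)) has_vector_derivative d k p) (at 0)"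
    and unif: "\<And>k \<kappa>. 0 < \<kappa> \<Longrightarrow> \<exists>\<delta>>0. \<forall>p q. norm (q - p) < \<delta> \<longrightarrow> norm (d k q - d k p) \<le> \<kappa>"
    and \<kappa>: "0 < \<kappa>"
  shows "\<exists>\<delta>>0. \<forall>p q. norm (q - p) < \<delta> \<longrightarrow> norm (f q - f p - (\<Sum>k\<in>UNIV. (q - p) $ k *\<^sub>R d k p)) \<le> \<kappa> * norm (q - p)"
proof -
  define n where "n = real CARD('n)"
  have n: "0 < n" by (simp add: n_def)
  define \<kappa>' where "\<kappa>' = \<kappa> / n"
  have \<kappa>': "0 < \<kappa>'" using \<kappa> n by (simp add: \<kappa>'_def)
  have "\<exists>\<delta>. \<forall>k. 0 < \<delta> k \<and> (\<forall>p q. norm (q - p) < \<delta> k \<longrightarrow> norm (d k q - d k p) \<le> \<kappa>')"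
    using unif[OF \<kappa>'] by (intro choice) blast
  then obtain \<delta> where \<delta>: "\<And>k. 0 < \<delta> k" "\<And>k p q. norm (q - p) < \<delta> k \<Longrightarrow> norm (d k q - d k p) \<le> \<kappa>'"
    by blast
  define \<delta>0 where "\<delta>0 = Min (range \<delta>) / n"
  have Min0: "0 < Min (range \<delta>)" using \<delta>(1) by (simp add: Min_gr_iff)
  have \<delta>0: "0 < \<delta>0" using Min0 n by (simp add: \<delta>0_def)
  have step: "norm (f (p + v + t *\<^sub>R axis k 1) - f (p + v) - t *\<^sub>R d k p) \<le> \<kappa>' * \<bar>t\<bar>"
    if small: "norm v + \<bar>t\<bar> < Min (range \<delta>)" for p v k t
  proof -
    define F where "F = (\<lambda>s. f (p + v + s *\<^sub>R axis k 1) - s *\<^sub>R d k p)"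
    have dF: "(F has_vector_derivative d k (p + v + s *\<^sub>R axis k 1) - d k p) (at s)" for s
    proof -
      have "((\<lambda>h. h - s) has_vector_derivative 1) (at s)"
        by (auto simp: has_vector_derivative_def intro!: derivative_eq_intros)
      then have "((\<lambda>h. f ((p + v + s *\<^sub>R axis k 1) + (h - s) *\<^sub>R axis k 1)) has_vector_derivative d k (p + v + s *\<^sub>R axis k 1)) (at s)"
        using part[where p = "p + v + s *\<^sub>R axis k 1" and k = k]
          vector_diff_chain_at[of "\<lambda>h. h - s" 1 s "\<lambda>s'. f ((p + v + s *\<^sub>R axis k 1) + s' *\<^sub>R axis k 1)" "d k (p + v + s *\<^sub>R axis k 1)"]
        by (simp add: o_def)
      then have "((\<lambda>h. f (p + v + h *\<^sub>R axis k 1)) has_vector_derivative d k (p + v + s *\<^sub>R axis k 1)) (at s)"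
        by (simp add: algebra_simps)
      then show ?thesis unfolding F_def by (auto intro!: derivative_eq_intros)
    qed
    have "norm (F t - F 0) \<le> \<kappa>' * norm (t - 0)"
    proof (rule differentiable_bound[where S = "closed_segment 0 t" and f' = "\<lambda>s h. h *\<^sub>R (d k (p + v + s *\<^sub>R axis k 1) - d k p)"])
      fix s assume s: "s \<in> closed_segment 0 t"
      show "(F has_derivative (\<lambda>h. h *\<^sub>R (d k (p + v + s *\<^sub>R axis k 1) - d k p))) (at s within closed_segment 0 t)"
        using dF[of s] by (simp add: has_vector_derivative_def has_derivative_at_withinI)
      have "\<bar>s\<bar> \<le> \<bar>t\<bar>" using s by (auto simp: closed_segment_eq_real_ivl split: if_splits)
      moreover have "norm ((p + v + s *\<^sub>R axis k 1) - p) \<le> norm v + \<bar>s\<bar>"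
        using norm_triangle_ineq[of v "s *\<^sub>R axis k (1::real)"] by (simp add: add.assoc)
      moreover have "norm v + \<bar>t\<bar> < \<delta> k" using small by simp
      ultimately have "norm ((p + v + s *\<^sub>R axis k 1) - p) < \<delta> k" by linarith
      then have "norm (d k (p + v + s *\<^sub>R axis k 1) - d k p) \<le> \<kappa>'" by (rule \<delta>(2))
      then show "onorm (\<lambda>h. h *\<^sub>R (d k (p + v + s *\<^sub>R axis k 1) - d k p)) \<le> \<kappa>'"
        by (simp add: onorm_scaleR_left[OF bounded_linear_ident] onorm_id)
    qed auto
    then show ?thesis by (simp add: F_def algebra_simps)
  qed
  have tele: "norm (f (p + (\<Sum>k\<in>S. u k *\<^sub>R axis k 1)) - f p - (\<Sum>k\<in>S. u k *\<^sub>R d k p)) \<le> \<kappa>' * (\<Sum>k\<in>S. \<bar>u k\<bar>)"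
    if "finite S" "(\<Sum>k\<in>S. \<bar>u k\<bar>) < Min (range \<delta>)" for S and u :: "'n \<Rightarrow> real" and p
    using that
  proof (induction S)
    case empty
    then show ?case by simp
  next
    case (insert j S)
    define v where "v = (\<Sum>k\<in>S. u k *\<^sub>R axis k (1::real))"
    have nv: "norm v \<le> (\<Sum>k\<in>S. \<bar>u k\<bar>)" unfolding v_def by (rule sum_norm_le) simp
    have "(\<Sum>k\<in>S. \<bar>u k\<bar>) \<le> (\<Sum>k\<in>insert j S. \<bar>u k\<bar>)" using insert.hyps by simp
    then have "(\<Sum>k\<in>S. \<bar>u k\<bar>) < Min (range \<delta>)" using insert.prems by (rule le_less_trans)
    then have "norm (f (p + v) - f p - (\<Sum>k\<in>S. u k *\<^sub>R d k p)) \<le> \<kappa>' * (\<Sum>k\<in>S. \<bar>u k\<bar>)"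
      unfolding v_def by (rule insert.IH)
    moreover have "norm (f (p + v + u j *\<^sub>R axis j 1) - f (p + v) - u j *\<^sub>R d j p) \<le> \<kappa>' * \<bar>u j\<bar>"
    proof (rule step)
      have "norm v + \<bar>u j\<bar> \<le> (\<Sum>k\<in>insert j S. \<bar>u k\<bar>)" using nv insert.hyps by simp
      then show "norm v + \<bar>u j\<bar> < Min (range \<delta>)" using insert.prems by (rule le_less_trans)
    qed
    moreover have "norm (f (p + v + u j *\<^sub>R axis j 1) - f p - (u j *\<^sub>R d j p + (\<Sum>k\<in>S. u k *\<^sub>R d k p)))
      \<le> norm (f (p + v + u j *\<^sub>R axis j 1) - f (p + v) - u j *\<^sub>R d j p) + norm (f (p + v) - f p - (\<Sum>k\<in>S. u k *\<^sub>R d k p))"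
      by (rule order_trans[OF eq_refl norm_triangle_ineq]) (simp add: algebra_simps)
    ultimately show ?case
      using insert.hyps by (simp add: v_def[symmetric] algebra_simps)
  qed
  show ?thesis
  proof (intro exI[of _ \<delta>0] conjI allI impI \<delta>0)
    fix p q :: "real ^ 'n" assume pq: "norm (q - p) < \<delta>0"
    have sum_le: "(\<Sum>k\<in>UNIV. \<bar>(q - p) $ k\<bar>) \<le> n * norm (q - p)"
      unfolding n_def using sum_bounded_above[of UNIV "\<lambda>k. \<bar>(q - p) $ k\<bar>" "norm (q - p)"] component_le_norm_cart[of "q - p"]
      by simp
    have "n * norm (q - p) < Min (range \<delta>)" using pq n by (simp add: \<delta>0_def field_simps)
    then have "(\<Sum>k\<in>UNIV. \<bar>(q - p) $ k\<bar>) < Min (range \<delta>)" using sum_le by linarith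
    from tele[OF finite this, of p]
    have "norm (f (p + (\<Sum>k\<in>UNIV. (q - p) $ k *\<^sub>R axis k 1)) - f p - (\<Sum>k\<in>UNIV. (q - p) $ k *\<^sub>R d k p))
       \<le> \<kappa>' * (\<Sum>k\<in>UNIV. \<bar>(q - p) $ k\<bar>)" .
    also have "(\<Sum>k\<in>UNIV. (q - p) $ k *\<^sub>R axis k 1) = q - p"
      using basis_expansion[of "q - p"] by (simp add: scalar_mult_eq_scaleR)
    also have "\<kappa>' * (\<Sum>k\<in>UNIV. \<bar>(q - p) $ k\<bar>) \<le> \<kappa>' * (n * norm (q - p))"
      using sum_le \<kappa>' by (intro mult_left_mono) auto
    also have "\<dots> = \<kappa> * norm (q - p)" using n by (simp add: \<kappa>'_def)
    finally show "norm (f q - f p - (\<Sum>k\<in>UNIV. (q - p) $ k *\<^sub>R d k p)) \<le> \<kappa> * norm (q - p)" by simp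
  qed
qed

text \<open>The linear map with columns \<open>d k\<close>. For the Lipschitz field it is a formal
  derivative: only partial derivatives, not total ones, are established almost everywhere.\<close>

definition partial_sum :: "('n::finite \<Rightarrow> 'b::real_vector) \<Rightarrow> real ^ 'n \<Rightarrow> 'b" where
  "partial_sum d v = (\<Sum>k\<in>UNIV. v $ k *\<^sub>R d k)"

lemma linear_partial_sum: "linear (partial_sum d)"
  by (rule linearI) (simp_all add: partial_sum_def scaleR_left_distrib sum.distrib scaleR_sum_right)

lemma norm_partial_sum_le:
  fixes d :: "'n::finite \<Rightarrow> 'b::real_normed_vector" and K :: real
  assumes "\<And>k. norm (d k) \<le> K"
  shows "norm (partial_sum d v) \<le> CARD('n) * K * norm v"
proof -
  have "norm (partial_sum d v) \<le> (\<Sum>k\<in>(UNIV::'n set). norm v * K)"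
    unfolding partial_sum_def using assms component_le_norm_cart[of v]
    by (intro sum_norm_le) (auto intro!: mult_mono simp: order_trans[OF norm_ge_zero assms])
  then show ?thesis by (simp add: mult.commute mult.left_commute)
qed

locale averaged_field = averaging_measure \<mu> \<epsilon> + transversal_field w e K M
  for \<mu> :: "(real ^ 'n::finite) measure" and \<epsilon> and w :: "real ^ 'n \<Rightarrow> real ^ 'n" and e K M +
  fixes d :: "'n \<Rightarrow> real ^ 'n \<Rightarrow> real ^ 'n"
  assumes d_measurable [measurable]: "\<And>k. d k \<in> borel_measurable borel"
    and d_bound: "\<And>k q. norm (d k q) \<le> K"
    and d_limit: "AE q in lborel. \<forall>k. ((\<lambda>s. (w (q + s *\<^sub>R axis k 1) - w q) /\<^sub>R s) \<longlongrightarrow> d k q) (at 0)"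
begin

definition avg :: "real ^ 'n \<Rightarrow> real ^ 'n" where "avg p = (LINT z|\<mu>. w (p + z))"
definition avg_d :: "'n \<Rightarrow> real ^ 'n \<Rightarrow> real ^ 'n" where "avg_d k p = (LINT z|\<mu>. d k (p + z))"

lemma w_measurable [measurable]: "w \<in> borel_measurable borel"
  using w_cont by (rule borel_measurable_continuous_onI)

lemma integrable_w: "integrable \<mu> (\<lambda>z. w (p + z))"
  by (rule integrable_bounded[where B = M]) (use w_bd in auto)

lemma integrable_d: "integrable \<mu> (\<lambda>z. d k (p + z))"
  by (rule integrable_bounded[where B = K]) (use d_bound in auto)

lemma avg_close: "norm (w p - avg p) \<le> K * \<epsilon>"
proof -
  have "w p - avg p = (LINT z|\<mu>. w p - w (p + z))"
    using integrable_w by (simp add: avg_def mass)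
  also have "norm \<dots> \<le> K * \<epsilon>"
  proof (rule average_bound)
    show "AE z in \<mu>. norm (w p - w (p + z)) \<le> K * \<epsilon>"
      using supp
    proof eventually_elim
      case (elim z)
      have "norm (w p - w (p + z)) \<le> K * norm (p - (p + z))" by (rule w_lip)
      also have "\<dots> \<le> K * \<epsilon>" using elim K_pos by (intro mult_left_mono) auto
      finally show ?case .
    qed
  qed simp
  finally show ?thesis .
qed

lemma avg_transversal: "transversal_field avg e K M"
proof
  show "norm e = 1" "0 < K" by (rule norm_e, rule K_pos)
  show "avg p \<bullet> e = 1" for p
  proof -
    have "avg p \<bullet> e = (LINT z|\<mu>. w (p + z) \<bullet> e)"
      unfolding avg_def using integrable_w by (intro integral_inner_left[symmetric]) auto
    then show ?thesis by (simp add: w_e mass)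
  qed
  show "norm (avg p - avg q) \<le> K * norm (p - q)" for p q
  proof -
    have "avg p - avg q = (LINT z|\<mu>. w (p + z) - w (q + z))"
      using integrable_w by (simp add: avg_def)
    also have "norm \<dots> \<le> K * norm (p - q)"
    proof (rule average_bound)
      have "norm (w (p + z) - w (q + z)) \<le> K * norm (p - q)" for z
        using w_lip[of "p + z" "q + z"] by simp
      then show "AE z in \<mu>. norm (w (p + z) - w (q + z)) \<le> K * norm (p - q)" by simp
    qed simp
    finally show ?thesis .
  qed
  show "norm (avg p) \<le> M" for p
    unfolding avg_def by (rule average_bound) (use w_bd in auto)
qed

text \<open>Dominated convergence: the difference quotients of \<open>w\<close> are bounded by
  \<open>K\<close>, and for almost every \<open>z\<close> they converge at
  \<open>p + z\<close>.\<close>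

lemma avg_partial: "((\<lambda>s. avg (p + s *\<^sub>R axis k 1)) has_vector_derivative avg_d k p) (at 0)"
proof (rule has_vector_derivative_quotient)
  show "((\<lambda>s. (avg (p + (0 + s) *\<^sub>R axis k 1) - avg (p + 0 *\<^sub>R axis k 1)) /\<^sub>R s) \<longlongrightarrow> avg_d k p) (at 0)"
    unfolding tendsto_at_iff_sequentially
  proof (intro allI impI)
    fix X :: "nat \<Rightarrow> real" assume X0: "\<forall>i. X i \<in> UNIV - {0}" and X: "X \<longlonglongrightarrow> 0"
    define Q where "Q = (\<lambda>i z. (w (p + z + X i *\<^sub>R axis k 1) - w (p + z)) /\<^sub>R X i)"
    have "(\<lambda>i. LINT z|\<mu>. Q i z) \<longlonglongrightarrow> (LINT z|\<mu>. d k (p + z))"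
    proof (rule integral_dominated_convergence[where w = "\<lambda>_. K"])
      show "(\<lambda>z. d k (p + z)) \<in> borel_measurable \<mu>" "Q i \<in> borel_measurable \<mu>" for i
        unfolding Q_def by measurable
      show "integrable \<mu> (\<lambda>_. K)" by simp
      have "AE z in \<mu>. \<forall>k. ((\<lambda>s. (w (p + z + s *\<^sub>R axis k 1) - w (p + z)) /\<^sub>R s) \<longlongrightarrow> d k (p + z)) (at 0)"
        using translate_AE[OF d_limit] .
      then show "AE z in \<mu>. (\<lambda>i. Q i z) \<longlonglongrightarrow> d k (p + z)"
      proof eventually_elim
        case (elim z)
        then have "((\<lambda>s. (w (p + z + s *\<^sub>R axis k 1) - w (p + z)) /\<^sub>R s) \<longlongrightarrow> d k (p + z)) (at 0)" by blast
        from this[unfolded tendsto_at_iff_sequentially, rule_format, of X] X0 X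
        show ?case by (simp add: Q_def o_def)
      qed
      fix i
      have "norm (Q i z) \<le> K" for z
      proof -
        have "norm (w (p + z + X i *\<^sub>R axis k 1) - w (p + z)) \<le> K * \<bar>X i\<bar>"
          using w_lip[of "p + z + X i *\<^sub>R axis k 1" "p + z"] by (simp add: norm_axis_1)
        then show ?thesis using X0 by (simp add: Q_def divide_simps mult.commute)
      qed
      then show "AE z in \<mu>. norm (Q i z) \<le> K" by simp
    qed
    moreover have "(LINT z|\<mu>. Q i z) = (avg (p + X i *\<^sub>R axis k 1) - avg p) /\<^sub>R X i" for i
    proof -
      have "integrable \<mu> (\<lambda>z. w (p + z + X i *\<^sub>R axis k 1))"
        using integrable_w[of "p + X i *\<^sub>R axis k 1"] by (simp add: algebra_simps)
      then show ?thesis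
        using integrable_w[of p] unfolding Q_def avg_def by (simp add: algebra_simps)
    qed
    ultimately show "((\<lambda>s. (avg (p + (0 + s) *\<^sub>R axis k 1) - avg (p + 0 *\<^sub>R axis k 1)) /\<^sub>R s) \<circ> X) \<longlonglongrightarrow> avg_d k p"
      by (simp add: o_def avg_d_def)
  qed
qed

lemma avg_smooth: "smooth_transversal_field avg e K M (\<lambda>p. partial_sum (\<lambda>k. avg_d k p))"
proof (intro smooth_transversal_field.intro avg_transversal smooth_transversal_field_axioms.intro linear_partial_sum)
  fix \<kappa> :: real assume \<kappa>: "0 < \<kappa>"
  show "\<exists>d>0. \<forall>p q. norm (q - p) < d \<longrightarrow> norm (avg q - avg p - partial_sum (\<lambda>k. avg_d k p) (q - p)) \<le> \<kappa> * norm (q - p)"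
    unfolding partial_sum_def
  proof (rule uniform_derivative_from_partials[OF avg_partial _ \<kappa>])
    fix k and \<kappa> :: real assume "0 < \<kappa>"
    then have "0 < \<kappa> / K" using K_pos by simp
    from translate_cont[OF this] obtain \<delta> where \<delta>: "0 < \<delta>" "\<And>p q. norm (q - p) < \<delta> \<Longrightarrow> norm (avg_d k q - avg_d k p) \<le> \<kappa> / K * K"
      unfolding avg_d_def using d_measurable[of k] d_bound[of k] by blast
    then show "\<exists>\<delta>>0. \<forall>p q. norm (q - p) < \<delta> \<longrightarrow> norm (avg_d k q - avg_d k p) \<le> \<kappa>"
      using K_pos by auto
  qed
qed

text \<open>The integrability condition is linear in the derivative, and its coefficients vary by
  \<open>O(\<epsilon>)\<close> on the ball over which one averages.\<close>

lemma avg_nearly_integrable: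
  assumes J: "AE q in lborel. q \<in> ball z0 r' \<longrightarrow> (\<forall>x h. partial_sum (\<lambda>k. d k q) (lifted w e q x) \<bullet> h
        = partial_sum (\<lambda>k. d k q) (lifted w e q h) \<bullet> x)"
    and r: "r + \<epsilon> \<le> r'"
  shows "nearly_integrable_approx w e K M (ball z0 r) (4 * K * (CARD('n) * K)) \<epsilon>"
  unfolding nearly_integrable_approx_def
proof (rule exI[of _ avg], rule exI[of _ "\<lambda>p. partial_sum (\<lambda>k. avg_d k p)"], intro conjI allI ballI avg_smooth avg_close)
  fix p x h assume p: "p \<in> ball z0 r"
  define N where "N = CARD('n) * K"
  define D where "D = partial_sum (\<lambda>k. avg_d k p)"
  define G where "G = (\<lambda>z. partial_sum (\<lambda>k. d k (p + z)))"
  have G_meas [measurable]: "(\<lambda>z. G z v) \<in> borel_measurable borel" for v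
    unfolding G_def partial_sum_def by measurable
  have G_bound: "norm (G z v) \<le> N * norm v" for z v
    using norm_partial_sum_le[of "\<lambda>k. d k (p + z)" K v] d_bound unfolding G_def N_def by blast
  have G_int: "integrable \<mu> (\<lambda>z. G z v)" for v
    by (rule integrable_bounded[where B = "N * norm v"]) (use G_bound in auto)
  have D_G: "D v = (LINT z|\<mu>. G z v)" for v
    unfolding D_def G_def partial_sum_def avg_d_def using integrable_d
    by (subst Bochner_Integration.integral_sum) auto
  have D_inner: "D v \<bullet> h = (LINT z|\<mu>. G z v \<bullet> h)" for v h
    unfolding D_G using G_int by (intro integral_inner_left[symmetric]) auto
  have lin: "partial_sum f (lifted w' e q v) = partial_sum f v - (w' q \<bullet> v) *\<^sub>R partial_sum f e" for f :: "'n \<Rightarrow> real ^ 'n" and w' q v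
    unfolding lifted_def by (simp add: linear_diff[OF linear_partial_sum] linear_cmul[OF linear_partial_sum])
  \<comment> \<open>What is left after subtracting the exact identity at \<open>p + z\<close>: its
    coefficients \<open>w (p + z)\<close> are exchanged for \<open>avg p\<close>. Each of the two
    exchanges costs \<open>2 * K * \<epsilon>\<close>, whence the constant
    \<open>4 * K\<close>.\<close>
  define F where "F = (\<lambda>z. ((w (p + z) - avg p) \<bullet> x) * (G z e \<bullet> h) - ((w (p + z) - avg p) \<bullet> h) * (G z e \<bullet> x))"
  have "D (lifted avg e p x) \<bullet> h - D (lifted avg e p h) \<bullet> x
      = D x \<bullet> h - D h \<bullet> x - (avg p \<bullet> x) * (D e \<bullet> h) + (avg p \<bullet> h) * (D e \<bullet> x)"
    unfolding D_def lin by (simp add: inner_diff_left)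
  also have "\<dots> = (LINT z|\<mu>. G z x \<bullet> h - G z h \<bullet> x - (avg p \<bullet> x) * (G z e \<bullet> h) + (avg p \<bullet> h) * (G z e \<bullet> x))"
    unfolding D_inner using G_int by simp
  also have "\<dots> = (LINT z|\<mu>. F z)"
  proof (rule integral_cong_AE)
    show "AE z in \<mu>. G z x \<bullet> h - G z h \<bullet> x - (avg p \<bullet> x) * (G z e \<bullet> h) + (avg p \<bullet> h) * (G z e \<bullet> x) = F z"
      using translate_AE[OF J, of p] supp
    proof eventually_elim
      case (elim z)
      have "dist z0 (p + z) \<le> dist z0 p + norm z" using dist_triangle[of z0 "p + z" p] by (simp add: dist_norm)
      then have "p + z \<in> ball z0 r'" using p elim(2) r by simp
      with elim(1) have "G z (lifted w e (p + z) x) \<bullet> h = G z (lifted w e (p + z) h) \<bullet> x"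
        by (simp add: G_def)
      then show ?case
        unfolding G_def lin F_def by (simp add: inner_diff_left algebra_simps)
    qed
  qed (unfold F_def, measurable)
  also have "norm \<dots> \<le> 4 * K * N * \<epsilon> * norm x * norm h"
  proof (rule average_bound)
    show "F \<in> borel_measurable borel" unfolding F_def by measurable
    show "AE z in \<mu>. norm (F z) \<le> 4 * K * N * \<epsilon> * norm x * norm h"
      using supp
    proof eventually_elim
      case (elim z)
      have wz: "norm (w (p + z) - avg p) \<le> 2 * K * \<epsilon>"
      proof -
        have "norm (w (p + z) - w p) \<le> K * norm (p + z - p)" by (rule w_lip)
        also have "\<dots> \<le> K * \<epsilon>" using elim K_pos by (intro mult_left_mono) auto
        finally have "norm (w (p + z) - w p) \<le> K * \<epsilon>" .
        moreover have "norm (w (p + z) - avg p) \<le> norm (w (p + z) - w p) + norm (w p - avg p)" by norm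
        ultimately show ?thesis using avg_close[of p] by linarith
      qed
      have prod: "\<bar>((w (p + z) - avg p) \<bullet> a) * (G z e \<bullet> b)\<bar> \<le> (2 * K * \<epsilon> * norm a) * (N * norm b)" for a b
      proof -
        have "\<bar>(w (p + z) - avg p) \<bullet> a\<bar> \<le> norm (w (p + z) - avg p) * norm a" by (rule Cauchy_Schwarz_ineq2)
        also have "\<dots> \<le> 2 * K * \<epsilon> * norm a" using wz by (intro mult_right_mono) auto
        finally have 1: "\<bar>(w (p + z) - avg p) \<bullet> a\<bar> \<le> 2 * K * \<epsilon> * norm a" .
        have "\<bar>G z e \<bullet> b\<bar> \<le> norm (G z e) * norm b" by (rule Cauchy_Schwarz_ineq2)
        also have "\<dots> \<le> N * norm b" using G_bound[of z e] norm_e by (intro mult_right_mono) auto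
        finally have 2: "\<bar>G z e \<bullet> b\<bar> \<le> N * norm b" .
        show ?thesis unfolding abs_mult using 1 2 K_pos eps_pos by (intro mult_mono) auto
      qed
      have "norm (F z) \<le> (2 * K * \<epsilon> * norm x) * (N * norm h) + (2 * K * \<epsilon> * norm h) * (N * norm x)"
        unfolding F_def real_norm_def using prod[of x h] prod[of h x] by linarith
      then show ?case by (simp add: algebra_simps)
    qed
  qed
  finally show "\<bar>partial_sum (\<lambda>k. avg_d k p) (lifted avg e p x) \<bullet> h - partial_sum (\<lambda>k. avg_d k p) (lifted avg e p h) \<bullet> x\<bar>
      \<le> 4 * K * (CARD('n) * K) * \<epsilon> * norm x * norm h"
    by (simp add: D_def N_def)
qed

end

section \<open>The uniform distribution on a small ball as averaging kernel\<close>

lemma indicator_ball_diff_le: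
  fixes p q y :: "'a::euclidean_space"
  assumes "norm (q - p) \<le> t"
  shows "\<bar>indicat_real (ball q \<epsilon>) y - indicat_real (ball p \<epsilon>) y\<bar> \<le> indicat_real (ball p (\<epsilon> + t) - ball p (\<epsilon> - t)) y"
proof -
  have "dist p y \<le> dist q y + t" "dist q y \<le> dist p y + t"
    using dist_triangle[of p y q] dist_triangle[of q y p] assms by (auto simp: dist_norm norm_minus_commute)
  then show ?thesis using order_trans[OF norm_ge_zero assms] by (auto simp: indicator_def)
qed

text \<open>Two balls of radius \<open>\<epsilon>\<close> with centres at distance \<open>t\<close>
  differ only within the shell between radii \<open>\<epsilon> - t\<close> and
  \<open>\<epsilon> + t\<close>, whose relative volume tends to 0 with \<open>t\<close>. This gives
  \<open>translate_cont\<close> although the kernel is discontinuous.\<close>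

lemma ball_averaging_measure:
  assumes \<epsilon>: "0 < \<epsilon>"
  shows "averaging_measure (density lborel (\<lambda>z::'a::euclidean_space. ennreal (indicator (ball 0 \<epsilon>) z / measure lborel (ball (0::'a) \<epsilon>)))) \<epsilon>"
    (is "averaging_measure ?\<mu> \<epsilon>")
proof -
  define vol where "vol = measure lborel (ball (0::'a) \<epsilon>)"
  have vol: "0 < vol" using content_ball_pos[OF \<epsilon>] by (simp add: vol_def)
  define \<mu> where "\<mu> = ?\<mu>"
  define \<phi> where "\<phi> = (\<lambda>z::'a. indicat_real (ball 0 \<epsilon>) z / vol)"
  have \<mu>: "\<mu> = density lborel (\<lambda>z. ennreal (\<phi> z))" by (simp add: \<mu>_def \<phi>_def vol_def)
  have \<phi>_meas [measurable]: "\<phi> \<in> borel_measurable borel"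
    unfolding \<phi>_def by (intro borel_measurable_divide borel_measurable_indicator borel_measurable_const) simp
  have \<phi>0: "0 \<le> \<phi> z" for z using vol by (simp add: \<phi>_def)
  have tot: "emeasure \<mu> UNIV = 1"
  proof -
    have em: "emeasure \<mu> UNIV = (\<integral>\<^sup>+z. ennreal (\<phi> z) \<partial>lborel)"
      unfolding \<mu> by (subst emeasure_density) auto
    have ev: "emeasure lborel (ball (0::'a) \<epsilon>) = ennreal vol"
      unfolding vol_def using emeasure_lborel_ball_finite[of "0::'a" \<epsilon>]
      by (intro emeasure_eq_ennreal_measure) auto
    have "(\<integral>\<^sup>+z. ennreal (\<phi> z) \<partial>lborel) = (\<integral>\<^sup>+z. ennreal (1 / vol) * indicator (ball (0::'a) \<epsilon>) z \<partial>lborel)"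
      by (intro nn_integral_cong) (auto simp: \<phi>_def indicator_def)
    also have "\<dots> = ennreal (1 / vol) * ennreal vol"
      using ev by (subst nn_integral_cmult_indicator) auto
    also have "\<dots> = 1" using vol by (simp add: ennreal_mult[symmetric])
    finally show ?thesis unfolding em .
  qed
  have space: "space \<mu> = UNIV" by (simp add: \<mu>)
  interpret finite_measure \<mu> by (rule finite_measureI) (simp add: space tot)
  have "averaging_measure \<mu> \<epsilon>"
  proof (intro averaging_measure.intro averaging_measure_axioms.intro)
    show "finite_measure \<mu>" by (rule finite_measure_axioms)
    show "sets \<mu> = sets borel" by (simp add: \<mu>)
    show "measure \<mu> UNIV = 1" using tot by (simp add: measure_def)
    show "0 < \<epsilon>" by fact
    show "AE z in \<mu>. norm z < \<epsilon>"
      unfolding \<mu> by (subst AE_density) (auto simp: \<phi>_def indicator_def split: if_splits)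
    show "AE z in \<mu>. P (p + z)" if "AE q in lborel. P q" for P p
    proof -
      have "AE q in distr lborel borel ((+) p). P q" using that unfolding lborel_distr_plus .
      from AE_distrD[OF _ this] have "AE z in lborel. P (p + z)" by simp
      then show ?thesis unfolding \<mu> by (subst AE_density) auto
    qed
    fix \<kappa> :: real assume \<kappa>: "0 < \<kappa>"
    define n where "n = DIM('a)"
    define c where "c = unit_ball_vol (real n)"
    define shell where "shell = (\<lambda>t. (c * (\<epsilon> + t) ^ n - c * (\<epsilon> - t) ^ n) / vol)"
    have "isCont shell 0" unfolding shell_def using vol by (intro continuous_intros) auto
    then have "(shell \<longlongrightarrow> shell 0) (nhds 0)" by (simp add: isCont_def tendsto_nhds_iff)
    moreover have "shell 0 < \<kappa>" using \<kappa> by (simp add: shell_def)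
    ultimately have "\<forall>\<^sub>F t in nhds 0. shell t < \<kappa>" by (rule order_tendstoD)
    then obtain \<delta> where \<delta>: "0 < \<delta>" "\<And>t. \<bar>t\<bar> < \<delta> \<Longrightarrow> shell t < \<kappa>"
      unfolding eventually_nhds_metric by (auto simp: dist_real_def)
    have "norm ((LINT z|\<mu>. f (q + z)) - (LINT z|\<mu>. f (p + z))) \<le> \<kappa> * B"
      if f [measurable]: "f \<in> borel_measurable borel" and B: "\<And>x. norm (f x) \<le> B" and pq: "norm (q - p) < min \<delta> \<epsilon>"
      for f :: "'a \<Rightarrow> 'a" and B p q
    proof -
      define t where "t = norm (q - p)"
      have t: "0 \<le> t" "t < \<delta>" "t < \<epsilon>" using pq by (auto simp: t_def)
      have B0: "0 \<le> B" using order_trans[OF norm_ge_zero B[of 0]] .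
      define \<psi> where "\<psi> = (\<lambda>(r::'a) y. indicat_real (ball r \<epsilon>) y / vol)"
      have \<psi>_meas [measurable]: "\<psi> r \<in> borel_measurable borel" for r
        unfolding \<psi>_def by (intro borel_measurable_divide borel_measurable_indicator borel_measurable_const) simp
      have shift: "(LINT z|\<mu>. f (r + z)) = (LINT y|lborel. \<psi> r y *\<^sub>R f y)" for r
      proof -
        have "(LINT z|\<mu>. f (r + z)) = (LINT z|lborel. \<phi> z *\<^sub>R f (r + z))"
          unfolding \<mu> by (rule integral_density) (use \<phi>0 in auto)
        also have "\<dots> = (LINT z|lborel. \<psi> r (r + z) *\<^sub>R f (r + z))"
          by (intro Bochner_Integration.integral_cong) (auto simp: \<phi>_def \<psi>_def indicator_def dist_norm)
        also have "\<dots> = (LINT y|distr lborel borel ((+) r). \<psi> r y *\<^sub>R f y)"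
          by (subst integral_distr) auto
        finally show ?thesis by (simp add: lborel_distr_plus)
      qed
      have ib: "integrable lborel (\<lambda>y. indicat_real (ball r s) y)" for r :: 'a and s
        by (rule integrable_real_indicator) (use emeasure_lborel_ball_finite[of r s] in simp_all)
      have int: "integrable lborel (\<lambda>y. \<psi> r y *\<^sub>R f y)" for r
      proof (rule Bochner_Integration.integrable_bound)
        show "integrable lborel (\<lambda>y. (B / vol) * indicat_real (ball r \<epsilon>) y)" using ib by simp
        show "(\<lambda>y. \<psi> r y *\<^sub>R f y) \<in> borel_measurable lborel" by measurable
        show "AE y in lborel. norm (\<psi> r y *\<^sub>R f y) \<le> norm ((B / vol) * indicat_real (ball r \<epsilon>) y)"
          using B B0 vol by (auto simp: \<psi>_def indicator_def divide_right_mono)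
      qed
      define A where "A = ball p (\<epsilon> + t) - ball p (\<epsilon> - t)"
      have Ai: "integrable lborel (indicat_real A)"
      proof (rule integrable_real_indicator)
        show "A \<in> sets lborel" by (simp add: A_def)
        have "emeasure lborel A \<le> emeasure lborel (ball p (\<epsilon> + t))"
          unfolding A_def by (intro emeasure_mono) auto
        then show "emeasure lborel A < \<infinity>" using emeasure_lborel_ball_finite[of p "\<epsilon> + t"]
          by (rule le_less_trans)
      qed
      have Am: "measure lborel A = vol * shell t"
      proof -
        have "measure lborel A = measure lborel (ball p (\<epsilon> + t)) - measure lborel (ball p (\<epsilon> - t))"
          unfolding A_def using t emeasure_lborel_ball_finite[of p "\<epsilon> + t"]
          by (intro measure_Diff) (auto simp: less_top)
        then show ?thesis using t vol by (simp add: content_ball shell_def c_def n_def)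
      qed
      have "(LINT z|\<mu>. f (q + z)) - (LINT z|\<mu>. f (p + z)) = (LINT y|lborel. \<psi> q y *\<^sub>R f y - \<psi> p y *\<^sub>R f y)"
        unfolding shift using int by simp
      also have "norm \<dots> \<le> (LINT y|lborel. norm (\<psi> q y *\<^sub>R f y - \<psi> p y *\<^sub>R f y))" by simp
      also have "\<dots> \<le> (LINT y|lborel. (B / vol) * indicat_real A y)"
      proof (rule integral_mono)
        show "integrable lborel (\<lambda>y. norm (\<psi> q y *\<^sub>R f y - \<psi> p y *\<^sub>R f y))" using int by simp
        show "integrable lborel (\<lambda>y. (B / vol) * indicat_real A y)" using Ai by simp
        fix y
        have "\<psi> q y *\<^sub>R f y - \<psi> p y *\<^sub>R f y = ((indicat_real (ball q \<epsilon>) y - indicat_real (ball p \<epsilon>) y) / vol) *\<^sub>R f y"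
          by (simp add: \<psi>_def diff_divide_distrib scaleR_diff_left)
        also have "norm \<dots> = \<bar>indicat_real (ball q \<epsilon>) y - indicat_real (ball p \<epsilon>) y\<bar> / vol * norm (f y)"
          using vol by simp
        also have "\<dots> \<le> indicat_real A y / vol * B"
          using indicator_ball_diff_le[of q p t \<epsilon> y] vol B unfolding A_def t_def
          by (intro mult_mono divide_right_mono) auto
        finally show "norm (\<psi> q y *\<^sub>R f y - \<psi> p y *\<^sub>R f y) \<le> (B / vol) * indicat_real A y" by (simp add: mult.commute)
      qed
      also have "\<dots> = B / vol * measure lborel A" using Ai by simp
      also have "\<dots> = shell t * B" using vol by (simp add: Am)
      also have "\<dots> \<le> \<kappa> * B" using \<delta>(2)[of t] t B0 by (intro mult_right_mono) auto
      finally show ?thesis .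
    qed
    then show "\<exists>\<delta>>0. \<forall>(f :: 'a \<Rightarrow> 'a) B p q. f \<in> borel_measurable borel \<longrightarrow>
        (\<forall>x. norm (f x) \<le> B) \<longrightarrow> norm (q - p) < \<delta> \<longrightarrow>
        norm ((LINT z|\<mu>. f (q + z)) - (LINT z|\<mu>. f (p + z))) \<le> \<kappa> * B"
      using \<delta>(1) \<epsilon> by (intro exI[of _ "min \<delta> \<epsilon>"]) auto
  qed
  then show ?thesis by (simp add: \<mu>_def)
qed

section \<open>Almost everywhere integrability of the normalised field\<close>

text \<open>Contracting the cyclic identity with \<open>e\<close> in one index shows that the
  antisymmetric part of the derivative is a wedge product of \<open>w\<close> and
  \<open>P e\<close>; here \<open>w \<bullet> e = 1\<close> and \<open>W k \<bullet> e = 0\<close>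
  remove the other terms. Contracting with \<open>x\<close> and \<open>h\<close> then gives symmetry
  on lifted vectors, the form in which the height expansion uses integrability.\<close>

lemma jacobi_contraction:
  fixes W :: "'n::finite \<Rightarrow> real ^ 'n" and w e x h :: "real ^ 'n"
  assumes J: "\<And>i j k. w $ i * (W k $ j - W j $ k) + w $ j * (W i $ k - W k $ i) + w $ k * (W j $ i - W i $ j) = 0"
    and we: "w \<bullet> e = 1" and We: "\<And>k. W k \<bullet> e = 0"
  shows "partial_sum W (x - (w \<bullet> x) *\<^sub>R e) \<bullet> h = partial_sum W (h - (w \<bullet> h) *\<^sub>R e) \<bullet> x"
proof -
  define P where "P = partial_sum W"
  have P_nth: "P v $ j = (\<Sum>k\<in>UNIV. v $ k * W k $ j)" for v j
    by (simp add: P_def partial_sum_def)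
  have P_inner: "P v \<bullet> u = (\<Sum>k\<in>UNIV. v $ k * (W k \<bullet> u))" for v u
    by (simp add: P_def partial_sum_def inner_sum_left)
  have B: "W k $ j - W j $ k + w $ j * P e $ k - w $ k * P e $ j = 0" for j k
  proof -
    have "0 = (\<Sum>i\<in>UNIV. e $ i * (w $ i * (W k $ j - W j $ k) + w $ j * (W i $ k - W k $ i) + w $ k * (W j $ i - W i $ j)))"
      using J by simp
    also have "\<dots> = (\<Sum>i\<in>UNIV. w $ i * e $ i) * (W k $ j - W j $ k)
        + w $ j * ((\<Sum>i\<in>UNIV. e $ i * W i $ k) - (\<Sum>i\<in>UNIV. W k $ i * e $ i))
        + w $ k * ((\<Sum>i\<in>UNIV. W j $ i * e $ i) - (\<Sum>i\<in>UNIV. e $ i * W i $ j))"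
      by (simp add: algebra_simps sum.distrib sum_subtractf sum_distrib_left sum_distrib_right)
    also have "\<dots> = W k $ j - W j $ k + w $ j * P e $ k - w $ k * P e $ j"
      using we We by (simp add: inner_vec_def P_nth)
    finally show ?thesis by simp
  qed
  have C: "W k \<bullet> x - P x $ k + (w \<bullet> x) * P e $ k - w $ k * (P e \<bullet> x) = 0" for k
  proof -
    have "0 = (\<Sum>j\<in>UNIV. x $ j * (W k $ j - W j $ k + w $ j * P e $ k - w $ k * P e $ j))" using B by simp
    also have "\<dots> = (\<Sum>j\<in>UNIV. W k $ j * x $ j) - (\<Sum>j\<in>UNIV. x $ j * W j $ k)
        + (\<Sum>j\<in>UNIV. w $ j * x $ j) * P e $ k - w $ k * (\<Sum>j\<in>UNIV. P e $ j * x $ j)"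
      by (simp add: algebra_simps sum.distrib sum_subtractf sum_distrib_left sum_distrib_right)
    finally show ?thesis by (simp add: inner_vec_def P_nth)
  qed
  have "0 = (\<Sum>k\<in>UNIV. h $ k * (W k \<bullet> x - P x $ k + (w \<bullet> x) * P e $ k - w $ k * (P e \<bullet> x)))" using C by simp
  also have "\<dots> = P h \<bullet> x - (\<Sum>k\<in>UNIV. P x $ k * h $ k) + (w \<bullet> x) * (\<Sum>k\<in>UNIV. P e $ k * h $ k)
      - (\<Sum>k\<in>UNIV. w $ k * h $ k) * (P e \<bullet> x)"
    by (simp add: P_inner[of h] algebra_simps sum.distrib sum_subtractf sum_distrib_left sum_distrib_right)
  also have "\<dots> = P h \<bullet> x - P x \<bullet> h + (w \<bullet> x) * (P e \<bullet> h) - (w \<bullet> h) * (P e \<bullet> x)"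
    by (simp add: inner_vec_def)
  finally have "P x \<bullet> h - (w \<bullet> x) * (P e \<bullet> h) = P h \<bullet> x - (w \<bullet> h) * (P e \<bullet> x)" by simp
  then show ?thesis
    unfolding P_def
    by (simp add: linear_diff[OF linear_partial_sum] linear_cmul[OF linear_partial_sum] inner_diff_left)
qed

text \<open>Averaging requires a version of the partial derivatives that is Borel and bounded
  everywhere, including the null set where they fail to exist.\<close>

lemma lipschitz_partial_derivatives:
  fixes w :: "real ^ 'n::finite \<Rightarrow> real ^ 'n"
  assumes lip: "\<And>p q. norm (w p - w q) \<le> K * norm (p - q)" and K: "0 \<le> K"
  shows "\<exists>d. (\<forall>k. d k \<in> borel_measurable borel) \<and> (\<forall>k q. norm (d k q :: real ^ 'n) \<le> K) \<and>
    (AE q in lborel. \<forall>k. ((\<lambda>s. (w (q + s *\<^sub>R axis k 1) - w q) /\<^sub>R s) \<longlongrightarrow> d k q) (at 0))"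
proof -
  have wc: "continuous_on UNIV w"
    using lip K by (intro lipschitz_on_continuous_on[of K] lipschitz_onI) (auto simp: dist_norm)
  then have w_meas [measurable]: "w \<in> borel_measurable borel" by (rule borel_measurable_continuous_onI)
  define Q where "Q = (\<lambda>k q s. (w (q + s *\<^sub>R axis k 1) - w q) /\<^sub>R s)"
  define X where "X = (\<lambda>n. 1 / real (Suc n))"
  have X: "X \<longlonglongrightarrow> 0" "\<And>n. X n \<noteq> 0" unfolding X_def using lim_1_over_n[THEN LIMSEQ_Suc] by auto
  \<comment> \<open>The limit along \<open>X\<close> is measurable in \<open>q\<close>. Where it
    does not exist, \<open>lim\<close> is unspecified; projecting to the ball of radius
    \<open>K\<close> enforces the bound there and leaves genuine derivatives unchanged.\<close>
  define d where "d = (\<lambda>k q. closest_point (cball 0 K) (lim (\<lambda>n. Q k q (X n))))"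
  have comp: "AE q in lborel. \<exists>D. (diff_quot (\<lambda>p. w p $ j) (axis k 1) q \<longlongrightarrow> D) (at 0)" for j k
  proof (rule AE_diff_quot_convergent)
    show "K-lipschitz_on UNIV (\<lambda>p. w p $ j)"
    proof (rule lipschitz_onI)
      fix p q
      show "dist (w p $ j) (w q $ j) \<le> K * dist p q"
        using component_le_norm_cart[of "w p - w q" j] lip[of p q] by (simp add: dist_real_def dist_norm)
    qed (rule K)
  qed
  have "AE q in lborel. \<forall>k. \<exists>D. (Q k q \<longlongrightarrow> D) (at 0)"
  proof -
    have "AE q in lborel. \<forall>j k. \<exists>D. (diff_quot (\<lambda>p. w p $ j) (axis k 1) q \<longlongrightarrow> D) (at 0)"
      unfolding AE_all_countable using comp by blast
    then show ?thesis
    proof eventually_elim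
      case (elim q)
      show ?case
      proof
        fix k
        have "\<forall>j. \<exists>D. (diff_quot (\<lambda>p. w p $ j) (axis k 1) q \<longlongrightarrow> D) (at 0)" using elim by blast
        from choice[OF this] obtain D where
          D: "\<And>j. (diff_quot (\<lambda>p. w p $ j) (axis k 1) q \<longlongrightarrow> D j) (at 0)" by blast
        have "(Q k q \<longlongrightarrow> (\<chi> j. D j)) (at 0)"
        proof (rule vec_tendstoI)
          fix j
          have "(\<lambda>s. Q k q s $ j) = diff_quot (\<lambda>p. w p $ j) (axis k 1) q"
            by (simp add: fun_eq_iff Q_def diff_quot_def divide_inverse mult.commute)
          then show "((\<lambda>s. Q k q s $ j) \<longlongrightarrow> (\<chi> j. D j) $ j) (at 0)"
            using D[of j] by simp
        qed
        then show "\<exists>D. (Q k q \<longlongrightarrow> D) (at 0)" by blast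
      qed
    qed
  qed
  then have lim: "AE q in lborel. \<forall>k. (Q k q \<longlongrightarrow> d k q) (at 0)"
  proof eventually_elim
    case (elim q)
    show ?case
    proof
      fix k
      obtain D where D: "(Q k q \<longlongrightarrow> D) (at 0)" using elim by blast
      from this[unfolded tendsto_at_iff_sequentially, rule_format, of X] X
      have "(\<lambda>n. Q k q (X n)) \<longlonglongrightarrow> D" by (simp add: o_def)
      then have limD: "lim (\<lambda>n. Q k q (X n)) = D" by (rule limI)
      have "norm (Q k q s) \<le> K" if "s \<noteq> 0" for s
        using lip[of "q + s *\<^sub>R axis k 1" q] that by (simp add: Q_def norm_axis_1 divide_simps mult.commute)
      then have "norm D \<le> K"
        by (intro tendsto_upperbound[OF tendsto_norm[OF D]]) (auto simp: eventually_at_filter)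
      then have "d k q = D" unfolding d_def limD by (intro closest_point_self) simp
      with D show "(Q k q \<longlongrightarrow> d k q) (at 0)" by simp
    qed
  qed
  have meas: "d k \<in> borel_measurable borel" for k
  proof -
    have "(\<lambda>q. lim (\<lambda>n. Q k q (X n))) \<in> borel_measurable borel"
      unfolding Q_def by (intro borel_measurable_lim_metric) measurable
    moreover have "closest_point (cball 0 K) \<in> borel_measurable (borel :: (real ^ 'n) measure)"
      using K by (intro borel_measurable_continuous_onI continuous_on_closest_point) auto
    ultimately show ?thesis unfolding d_def by measurable
  qed
  have bound: "norm (d k q) \<le> K" for k q
    using closest_point_in_set[of "cball (0 :: real ^ 'n) K" "lim (\<lambda>n. Q k q (X n))"] K by (simp add: d_def)
  show ?thesis using meas bound lim[unfolded Q_def] by (intro exI[of _ d] conjI allI)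
qed

text \<open>With \<open>e\<close> the direction of \<open>g x\<close>, the component
  \<open>g p \<bullet> e\<close> stays above half of \<open>norm (g x)\<close> for \<open>p\<close>
  near \<open>x\<close>. Composing with the nearest-point map of a closed ball, which is
  nonexpansive, makes all bounds global and leaves \<open>g\<close> unchanged on the ball.\<close>

lemma transversal_field_near:
  fixes g :: "'a::euclidean_space \<Rightarrow> 'a"
  assumes U: "open U" "x \<in> U" and gx: "g x \<noteq> 0" and lip: "locally_lipschitz_on U g"
  obtains w e K M r where "transversal_field w e K M" "0 < r" "ball x r \<subseteq> U"
    "\<And>p. p \<in> ball x r \<Longrightarrow> 0 < g p \<bullet> e \<and> g p = (g p \<bullet> e) *\<^sub>R w p"
proof -
  define e where "e = g x /\<^sub>R norm (g x)"
  have ne: "norm e = 1" using gx by (simp add: e_def)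
  define m where "m = norm (g x) / 2"
  have m: "0 < m" using gx by (simp add: m_def)
  have gxe: "g x \<bullet> e = 2 * m" using gx by (simp add: e_def m_def power2_norm_eq_inner[symmetric] power2_eq_square)
  have cg: "continuous_on U g" using locally_lipschitz_on_imp_continuous_on U lip by blast
  then have "isCont (\<lambda>p. g p \<bullet> e) x"
    using U by (intro continuous_intros) (simp add: continuous_on_eq_continuous_at)
  then have "(((\<lambda>p. g p \<bullet> e)) \<longlongrightarrow> 2 * m) (nhds x)" using gxe by (simp add: isCont_def tendsto_nhds_iff)
  then have "\<forall>\<^sub>F p in nhds x. m < g p \<bullet> e" using m by (intro order_tendstoD) auto
  moreover have "\<forall>\<^sub>F p in nhds x. p \<in> U" using U by (rule eventually_nhds_in_open)
  ultimately have "\<forall>\<^sub>F p in nhds x. m < g p \<bullet> e \<and> p \<in> U" by eventually_elim simp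
  then obtain r1 where r1: "0 < r1" "\<And>p. dist p x < r1 \<Longrightarrow> m < g p \<bullet> e \<and> p \<in> U"
    unfolding eventually_nhds_metric by auto
  define r where "r = r1 / 2"
  have r: "0 < r" "\<And>p. p \<in> cball x r \<Longrightarrow> m < g p \<bullet> e \<and> p \<in> U"
    using r1 by (auto simp: r_def dist_commute)
  obtain L where L: "L-lipschitz_on (cball x r) g"
    using lip r(2) unfolding locally_lipschitz_on_def by (meson compact_cball subsetI)
  have L0: "0 \<le> L" using L by (rule lipschitz_on_nonneg)
  have "compact (g ` cball x r)"
    using r(2) by (intro compact_continuous_image continuous_on_subset[OF cg]) auto
  then obtain G where G: "\<And>p. p \<in> cball x r \<Longrightarrow> norm (g p) \<le> G"
    using compact_imp_bounded bounded_iff by (metis image_eqI)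
  have G0: "0 \<le> G" using order_trans[OF norm_ge_zero G[of x]] r(1) by simp
  define \<pi> where "\<pi> = closest_point (cball x r)"
  have \<pi>_in: "\<pi> p \<in> cball x r" for p unfolding \<pi>_def using r(1) by (intro closest_point_in_set) auto
  have \<pi>_lip: "norm (\<pi> p - \<pi> q) \<le> norm (p - q)" for p q
    unfolding \<pi>_def using closest_point_lipschitz[of "cball x r" p q] r(1) by (simp add: dist_norm)
  define gt where "gt = (\<lambda>p. g (\<pi> p))"
  have gt_lip: "norm (gt p - gt q) \<le> L * norm (p - q)" for p q
  proof -
    have "norm (gt p - gt q) \<le> L * norm (\<pi> p - \<pi> q)"
      using lipschitz_onD[OF L \<pi>_in \<pi>_in] by (simp add: gt_def dist_norm)
    also have "\<dots> \<le> L * norm (p - q)" using \<pi>_lip L0 by (rule mult_left_mono)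
    finally show ?thesis .
  qed
  have gt_e: "m < gt p \<bullet> e" for p using r(2)[OF \<pi>_in] by (simp add: gt_def)
  have gt_bd: "norm (gt p) \<le> G" for p using G[OF \<pi>_in] by (simp add: gt_def)
  define w where "w = (\<lambda>p. gt p /\<^sub>R (gt p \<bullet> e))"
  \<comment> \<open>Quotient rule: \<open>L / m\<close> stems from the numerator and
    \<open>G * L / m\<^sup>2\<close> from the denominator; the 1 makes \<open>K\<close>
    positive.\<close>
  define K where "K = L / m + G * L / m\<^sup>2 + 1"
  have tf: "transversal_field w e K (G / m)"
  proof
    show "norm e = 1" by fact
    show "w p \<bullet> e = 1" for p using gt_e[of p] m by (simp add: w_def)
    show "0 < K" using L0 G0 m by (simp add: K_def add_nonneg_pos)
    show "norm (w p) \<le> G / m" for p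
    proof -
      have "norm (w p) = norm (gt p) / (gt p \<bullet> e)" using gt_e[of p] m by (simp add: w_def divide_inverse mult.commute)
      also have "\<dots> \<le> G / m" using gt_bd[of p] gt_e[of p] m G0 by (intro frac_le) auto
      finally show ?thesis .
    qed
    show "norm (w p - w q) \<le> K * norm (p - q)" for p q
    proof -
      define a b where "a = gt p \<bullet> e" and "b = gt q \<bullet> e"
      have ab: "m < a" "m < b" using gt_e by (auto simp: a_def b_def)
      have diff: "\<bar>b - a\<bar> \<le> L * norm (p - q)"
      proof -
        have "\<bar>b - a\<bar> = \<bar>(gt p - gt q) \<bullet> e\<bar>" by (simp add: a_def b_def inner_diff_left)
        also have "\<dots> \<le> norm (gt p - gt q) * norm e" by (rule Cauchy_Schwarz_ineq2)
        finally show ?thesis using gt_lip[of p q] ne by simp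
      qed
      have "w p - w q = (gt p - gt q) /\<^sub>R a + ((b - a) / (a * b)) *\<^sub>R gt q"
      proof -
        have s: "(b - a) / (a * b) = inverse a - inverse b" using ab m by (simp add: field_simps)
        show ?thesis unfolding s by (simp add: w_def a_def[symmetric] b_def[symmetric] algebra_simps)
      qed
      also have "norm \<dots> \<le> norm (gt p - gt q) / a + \<bar>b - a\<bar> / (a * b) * norm (gt q)"
        using norm_triangle_ineq[of "(gt p - gt q) /\<^sub>R a" "((b - a) / (a * b)) *\<^sub>R gt q"] ab m
        by (simp add: divide_inverse mult.commute abs_mult)
      also have "\<dots> \<le> L * norm (p - q) / m + (L * norm (p - q)) / (m * m) * G"
        using ab m gt_lip[of p q] gt_bd[of q] diff L0
        by (intro add_mono frac_le mult_mono) auto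
      also have "\<dots> \<le> K * norm (p - q)" by (simp add: K_def power2_eq_square algebra_simps)
      finally show ?thesis .
    qed
  qed
  have near: "0 < g p \<bullet> e \<and> g p = (g p \<bullet> e) *\<^sub>R w p" if "p \<in> ball x r" for p
  proof -
    have "\<pi> p = p" unfolding \<pi>_def using that by (intro closest_point_self) auto
    then show ?thesis using gt_e[of p] m by (simp add: w_def gt_def)
  qed
  have sub: "ball x r \<subseteq> U" using r(2) by force
  show ?thesis by (rule that[OF tf r(1) sub near])
qed

text \<open>Integrability is inherited by the normalised field \<open>w\<close>: if \<open>g = \<gamma> w\<close>, the product rule shows that the
  cyclic sum for \<open>g\<close> is \<open>\<gamma>\<^sup>2\<close> times the one for \<open>w\<close>.\<close>

lemma normalised_jacobi:
  fixes g w :: "real ^ 'n::finite \<Rightarrow> real ^ 'n"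
  assumes gw: "\<And>p. p \<in> ball x r \<Longrightarrow> 0 < g p \<bullet> e \<and> g p = (g p \<bullet> e) *\<^sub>R w p"
    and q: "q \<in> ball x r"
    and dw: "\<And>k. ((\<lambda>s. (w (q + s *\<^sub>R axis k 1) - w q) /\<^sub>R s) \<longlongrightarrow> W k) (at 0)"
    and dg: "\<And>j k. \<exists>D. ((\<lambda>s. g (q + s *\<^sub>R axis k 1) $ j) has_real_derivative D) (at 0)"
    and J: "g q $ i * (partial_deriv k (\<lambda>y. g y $ j) q - partial_deriv j (\<lambda>y. g y $ k) q)
      + g q $ j * (partial_deriv i (\<lambda>y. g y $ k) q - partial_deriv k (\<lambda>y. g y $ i) q)
      + g q $ k * (partial_deriv j (\<lambda>y. g y $ i) q - partial_deriv i (\<lambda>y. g y $ j) q) = 0"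
  shows "w q $ i * (W k $ j - W j $ k) + w q $ j * (W i $ k - W k $ i) + w q $ k * (W j $ i - W i $ j) = 0"
proof -
  define \<gamma> where "\<gamma> = g q \<bullet> e"
  have \<gamma>: "0 < \<gamma>" "g q = \<gamma> *\<^sub>R w q" using gw[OF q] by (auto simp: \<gamma>_def)
  define G where "G = (\<lambda>k j. partial_deriv k (\<lambda>y. g y $ j) q)"
  have dG: "((\<lambda>s. g (q + s *\<^sub>R axis k 1) $ j) has_real_derivative G k j) (at 0)" for j k
    unfolding G_def partial_deriv_def using dg[of k j] DERIV_imp_deriv by blast
  have dW: "((\<lambda>s. w (q + s *\<^sub>R axis k 1) $ j) has_real_derivative W k $ j) (at 0)" for j k
  proof -
    have "((\<lambda>s. w (q + s *\<^sub>R axis k 1)) has_vector_derivative W k) (at 0)"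
      by (rule has_vector_derivative_quotient) (use dw[of k] in simp)
    then have "((\<lambda>s. w (q + s *\<^sub>R axis k 1) $ j) has_vector_derivative W k $ j) (at 0)"
      by (rule bounded_linear.has_vector_derivative[OF bounded_linear_vec_nth])
    then show ?thesis by (simp add: has_real_derivative_iff_has_vector_derivative)
  qed
  define \<Gamma> where "\<Gamma> = (\<lambda>k. \<Sum>j\<in>UNIV. G k j * e $ j)"
  have d\<gamma>: "((\<lambda>s. g (q + s *\<^sub>R axis k 1) \<bullet> e) has_real_derivative \<Gamma> k) (at 0)" for k
    unfolding inner_vec_def \<Gamma>_def inner_real_def
    by (intro DERIV_sum DERIV_cmult_right dG)
  have prod: "G k j = \<Gamma> k * w q $ j + W k $ j * \<gamma>" for k j
  proof -
    have "((\<lambda>s. (g (q + s *\<^sub>R axis k 1) \<bullet> e) * w (q + s *\<^sub>R axis k 1) $ j)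
        has_real_derivative \<Gamma> k * w (q + 0 *\<^sub>R axis k 1) $ j + W k $ j * (g (q + 0 *\<^sub>R axis k 1) \<bullet> e)) (at 0)"
      by (rule DERIV_mult[OF d\<gamma> dW])
    moreover have "\<forall>\<^sub>F s in nhds 0. q + s *\<^sub>R axis k 1 \<in> ball x r"
    proof -
      have "((\<lambda>s. q + s *\<^sub>R axis k (1::real)) \<longlongrightarrow> q + 0 *\<^sub>R axis k 1) (nhds 0)"
        by (intro tendsto_intros filterlim_ident)
      then show ?thesis using q by (intro topological_tendstoD) auto
    qed
    then have "\<forall>\<^sub>F s in nhds 0. (g (q + s *\<^sub>R axis k 1) \<bullet> e) * w (q + s *\<^sub>R axis k 1) $ j = g (q + s *\<^sub>R axis k 1) $ j"
    proof eventually_elim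
      case (elim s)
      have "g (q + s *\<^sub>R axis k 1) $ j = ((g (q + s *\<^sub>R axis k 1) \<bullet> e) *\<^sub>R w (q + s *\<^sub>R axis k 1)) $ j"
        using gw[OF elim] by simp
      then show ?case by simp
    qed
    ultimately have "((\<lambda>s. g (q + s *\<^sub>R axis k 1) $ j) has_real_derivative \<Gamma> k * w q $ j + W k $ j * \<gamma>) (at 0)"
      by (subst (asm) DERIV_cong_ev[OF refl _ refl]) (auto simp: \<gamma>_def)
    then show ?thesis by (rule DERIV_unique[OF dG])
  qed
  have "0 = g q $ i * (G k j - G j k) + g q $ j * (G i k - G k i) + g q $ k * (G j i - G i j)"
    using J by (simp add: G_def)
  \<comment> \<open>The six terms with \<open>\<Gamma>\<close> cancel in pairs, each pair carrying
    the same two components of \<open>w q\<close> with opposite signs.\<close>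
  also have "\<dots> = \<gamma> * \<gamma> * (w q $ i * (W k $ j - W j $ k) + w q $ j * (W i $ k - W k $ i) + w q $ k * (W j $ i - W i $ j))"
    unfolding prod by (simp add: \<gamma>(2) algebra_simps)
  finally show ?thesis using \<gamma>(1) by simp
qed

text \<open>Averaging over a radius below \<open>r / 4\<close> from a point of the ball of radius
  \<open>r / 4\<close> stays within radius \<open>r / 2\<close>, where the identity for
  \<open>w\<close> is available almost everywhere.\<close>

lemma integrable_field_approximable:
  fixes g w :: "real ^ 'n::finite \<Rightarrow> real ^ 'n" and K :: real
  assumes tf: "transversal_field w e K M" and r: "0 < r" "ball x r \<subseteq> U"
    and gw: "\<And>p. p \<in> ball x r \<Longrightarrow> 0 < g p \<bullet> e \<and> g p = (g p \<bullet> e) *\<^sub>R w p"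
    and U: "open U" and lip: "locally_lipschitz_on U g" and jac: "jacobi_integrable U g"
    and \<epsilon>: "0 < \<epsilon>" "\<epsilon> < r / 4"
  shows "nearly_integrable_approx w e K M (ball x (r / 4)) (4 * K * (CARD('n) * K)) \<epsilon>"
proof -
  interpret w: transversal_field w e K M by (rule tf)
  obtain d where D: "(\<forall>k. d k \<in> borel_measurable borel) \<and> (\<forall>k q. norm (d k q :: real ^ 'n) \<le> K) \<and>
    (AE q in lborel. \<forall>k. ((\<lambda>s. (w (q + s *\<^sub>R axis k 1) - w q) /\<^sub>R s) \<longlongrightarrow> d k q) (at 0))"
    using lipschitz_partial_derivatives[OF w.w_lip less_imp_le[OF w.K_pos]] by (rule exE)
  have d: "\<And>k. d k \<in> borel_measurable borel" "\<And>k q. norm (d k q) \<le> K" using D by simp_all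
  note dlim = D[THEN conjunct2, THEN conjunct2]
  define \<mu> where "\<mu> = density lborel (\<lambda>z::real ^ 'n. ennreal (indicator (ball 0 \<epsilon>) z / measure lborel (ball (0::real ^ 'n) \<epsilon>)))"
  interpret averaged_field \<mu> \<epsilon> w e K M d
    unfolding \<mu>_def
    by (intro averaged_field.intro ball_averaging_measure \<epsilon>(1) tf averaged_field_axioms.intro d dlim)
  define S where "S = cball x (r / 2)"
  have SU: "S \<subseteq> ball x r" using r by (auto simp: S_def)
  obtain L where L: "L-lipschitz_on S g"
    using lip SU r(2) unfolding locally_lipschitz_on_def S_def by (meson compact_cball order_trans)
  \<comment> \<open>\<open>partial_deriv\<close> is meaningful only where the partial derivatives of
    \<open>g\<close> exist. The almost everywhere result is for globally Lipschitz fields, so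
    \<open>g\<close> is extended from the closed half ball; near interior points the extension
    agrees with \<open>g\<close>.\<close>
  define gt where "gt = (\<lambda>p. g (closest_point S p))"
  have Lgt: "norm (gt p - gt q) \<le> L * norm (p - q)" for p q
  proof -
    have in_S: "closest_point S p \<in> S" for p unfolding S_def using r(1) by (intro closest_point_in_set) auto
    have "norm (gt p - gt q) \<le> L * norm (closest_point S p - closest_point S q)"
      using lipschitz_onD[OF L in_S in_S] by (simp add: gt_def dist_norm)
    also have "\<dots> \<le> L * norm (p - q)"
      using closest_point_lipschitz[of S p q] r(1) lipschitz_on_nonneg[OF L]
      by (intro mult_left_mono) (auto simp: dist_norm S_def)
    finally show ?thesis .
  qed
  obtain dg where Dg: "(\<forall>k. dg k \<in> borel_measurable borel) \<and> (\<forall>k q. norm (dg k q :: real ^ 'n) \<le> L) \<and>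
    (AE q in lborel. \<forall>k. ((\<lambda>s. (gt (q + s *\<^sub>R axis k 1) - gt q) /\<^sub>R s) \<longlongrightarrow> dg k q) (at 0))"
    using lipschitz_partial_derivatives[OF Lgt lipschitz_on_nonneg[OF L]] by (rule exE)
  note dglim = Dg[THEN conjunct2, THEN conjunct2]
  have jac': "AE q in lborel. \<forall>i j k. q \<in> U \<longrightarrow> g q $ i * (partial_deriv k (\<lambda>y. g y $ j) q - partial_deriv j (\<lambda>y. g y $ k) q)
      + g q $ j * (partial_deriv i (\<lambda>y. g y $ k) q - partial_deriv k (\<lambda>y. g y $ i) q)
      + g q $ k * (partial_deriv j (\<lambda>y. g y $ i) q - partial_deriv i (\<lambda>y. g y $ j) q) = 0"
    using jac unfolding jacobi_integrable_def AE_all_countable AE_completion_iff .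
  have J: "AE q in lborel. q \<in> ball x (r / 2) \<longrightarrow> (\<forall>v h. partial_sum (\<lambda>k. d k q) (lifted w e q v) \<bullet> h
        = partial_sum (\<lambda>k. d k q) (lifted w e q h) \<bullet> v)"
    using dlim dglim jac'
  proof eventually_elim
    case (elim q)
    show ?case
    proof (intro impI allI)
      fix v h assume q: "q \<in> ball x (r / 2)"
      then have qr: "q \<in> ball x r" using r(1) by auto
      have dgq: "\<exists>D. ((\<lambda>s. g (q + s *\<^sub>R axis k 1) $ j) has_real_derivative D) (at 0)" for j k
      proof -
        have "((\<lambda>s. gt (q + s *\<^sub>R axis k 1)) has_vector_derivative dg k q) (at 0)"
          by (rule has_vector_derivative_quotient) (use elim(2) in simp)
        then have "((\<lambda>s. gt (q + s *\<^sub>R axis k 1) $ j) has_vector_derivative dg k q $ j) (at 0)"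
          by (rule bounded_linear.has_vector_derivative[OF bounded_linear_vec_nth])
        then have "((\<lambda>s. gt (q + s *\<^sub>R axis k 1) $ j) has_real_derivative dg k q $ j) (at 0)"
          by (simp add: has_real_derivative_iff_has_vector_derivative)
        moreover have "\<forall>\<^sub>F s in nhds 0. q + s *\<^sub>R axis k 1 \<in> ball x (r / 2)"
        proof -
          have "((\<lambda>s. q + s *\<^sub>R axis k (1::real)) \<longlongrightarrow> q + 0 *\<^sub>R axis k 1) (nhds 0)"
            by (intro tendsto_intros filterlim_ident)
          then show ?thesis using q by (intro topological_tendstoD) auto
        qed
        then have "\<forall>\<^sub>F s in nhds 0. gt (q + s *\<^sub>R axis k 1) $ j = g (q + s *\<^sub>R axis k 1) $ j"
          by eventually_elim (auto simp: gt_def S_def closest_point_self)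
        ultimately show ?thesis by (subst (asm) DERIV_cong_ev[OF refl _ refl]) auto
      qed
      have we: "w q \<bullet> e = 1" by (rule w.w_e)
      have We: "d k q \<bullet> e = 0" for k
      proof -
        have "((\<lambda>s. ((w (q + s *\<^sub>R axis k 1) - w q) /\<^sub>R s) \<bullet> e) \<longlongrightarrow> d k q \<bullet> e) (at 0)"
          using elim(1) by (intro tendsto_intros) blast
        then show ?thesis by (simp add: inner_diff_left w.w_e tendsto_const_iff)
      qed
      have "w q $ i * (d k q $ j - d j q $ k) + w q $ j * (d i q $ k - d k q $ i) + w q $ k * (d j q $ i - d i q $ j) = 0" for i j k
        by (rule normalised_jacobi[OF gw qr _ dgq]) (use elim qr r(2) in blast)+
      from jacobi_contraction[where W = "\<lambda>k. d k q", OF this we We]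
      show "partial_sum (\<lambda>k. d k q) (lifted w e q v) \<bullet> h = partial_sum (\<lambda>k. d k q) (lifted w e q h) \<bullet> v"
        unfolding lifted_def .
    qed
  qed
  show ?thesis by (rule avg_nearly_integrable[OF J]) (use \<epsilon> in simp)
qed

section \<open>The regular solution of a foliation\<close>

text \<open>The estimate \<open>taylor\<close> is all that is retained of integrability, which
  separates the geometry of the leaves from the averaging. A leaf is labelled by its height
  \<open>c\<close> over \<open>x\<close>, and \<open>\<sigma>\<close> limits the labels for which
  the estimate holds.\<close>

locale foliation = transversal_field w e K M
  for w :: "'a::euclidean_space \<Rightarrow> 'a" and e K M +
  fixes x :: 'a and \<rho> \<sigma> Q :: real
  assumes \<rho>: "0 < \<rho>" "K * \<rho> \<le> 1 / 4" and \<sigma>: "0 < \<sigma>"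
    and taylor: "\<And>a b c. \<lbrakk>norm a < \<rho>; norm b < \<rho>; \<bar>c\<bar> < \<sigma>\<rbrakk> \<Longrightarrow>
      \<bar>height w e x b c - height w e x a c + w (x + a + height w e x a c *\<^sub>R e) \<bullet> (b - a)\<bar>
        \<le> Q * norm (b - a) * norm (b - a)"
begin

definition horiz :: "'a \<Rightarrow> 'a" where "horiz v = v - (v \<bullet> e) *\<^sub>R e"
definition leaf :: "real \<Rightarrow> 'a \<Rightarrow> 'a" where "leaf c a = x + a + height w e x a c *\<^sub>R e"
text \<open>The label of the leaf through \<open>p\<close>; it exists and is unique, by
  \<open>height_surj\<close> and \<open>height_inj\<close>, when the horizontal part of
  \<open>p - x\<close> is shorter than \<open>\<rho>\<close>.\<close>

definition level :: "'a \<Rightarrow> real" where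
  "level p = (THE c. height w e x (horiz (p - x)) c = (p - x) \<bullet> e)"
definition B :: real where "B = 1 + (1 + 4 * M) / 3"

lemma e_e: "e \<bullet> e = 1"
  using norm_e by (simp add: power2_norm_eq_inner[symmetric])

lemma horiz_simps:
  "horiz (u + v) = horiz u + horiz v" "horiz (u - v) = horiz u - horiz v" "horiz (s *\<^sub>R v) = s *\<^sub>R horiz v"
  "horiz 0 = 0" "horiz e = 0" "horiz v \<bullet> e = 0"
  by (simp_all add: horiz_def e_e inner_add_left inner_diff_left algebra_simps)

lemma horiz_decomp: "v = horiz v + (v \<bullet> e) *\<^sub>R e"
  by (simp add: horiz_def)

lemma horiz_id: "v \<bullet> e = 0 \<Longrightarrow> horiz v = v"
  by (simp add: horiz_def)

lemma norm_horiz: "norm (horiz v) \<le> norm v"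
proof -
  have "v \<bullet> v = horiz v \<bullet> horiz v + (v \<bullet> e)\<^sup>2"
    by (simp add: horiz_def inner_diff_left inner_diff_right e_e power2_eq_square inner_commute algebra_simps)
  then have "(norm (horiz v))\<^sup>2 \<le> (norm v)\<^sup>2" by (simp add: power2_norm_eq_inner)
  then show ?thesis by (rule power2_le_imp_le) simp
qed

lemma bounded_linear_horiz: "bounded_linear horiz"
  unfolding horiz_def[abs_def] by (intro bounded_linear_intros)

lemma continuous_on_horiz [continuous_intros]: "continuous_on S f \<Longrightarrow> continuous_on S (\<lambda>z. horiz (f z))"
  unfolding horiz_def by (intro continuous_intros)

lemma abs_inner_e: "\<bar>v \<bullet> e\<bar> \<le> norm v"
  using Cauchy_Schwarz_ineq2[of v e] norm_e by simp

lemma B_ge: "1 \<le> B"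
  using M_pos by (simp add: B_def)

lemma small: "norm a < \<rho> \<Longrightarrow> K * norm a \<le> 1 / 4"
  using mult_left_mono[of "norm a" \<rho> K] K_pos \<rho>(2) by linarith

text \<open>With \<open>a1 = a2\<close>, the height minus \<open>c\<close> is a contraction in
  \<open>c\<close> with factor 1/3. This makes the height bijective in \<open>c\<close> and
  \<open>level\<close> Lipschitz.\<close>

lemma height_mono:
  assumes "norm a1 < \<rho>" "norm a2 < \<rho>"
  shows "\<bar>height w e x a1 c1 - height w e x a2 c2 - (c1 - c2)\<bar> \<le> (B - 1) * norm (a1 - a2) + \<bar>c1 - c2\<bar> / 3"
  using height_compare[OF transversal_field_axioms transversal_field_axioms _ small[OF assms(1)] small[OF assms(2)], of 0 x c1 c2]
  by (simp add: B_def field_simps)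

lemma height_0: "height w e x 0 c = c"
  using ray_height[OF ray_const] by simp

lemma height_inj:
  assumes "norm a < \<rho>" "height w e x a c1 = height w e x a c2"
  shows "c1 = c2"
  using height_mono[OF assms(1,1), of c1 c2] assms(2) by (simp add: abs_minus_commute)

lemma height_surj:
  assumes a: "norm a < \<rho>"
  shows "\<exists>c. height w e x a c = z"
proof -
  define \<beta> where "\<beta> = (B - 1) * norm a"
  have \<beta>: "0 \<le> \<beta>" using B_ge by (simp add: \<beta>_def)
  have near: "\<bar>height w e x a c - c\<bar> \<le> \<beta>" for c
    using height_mono[OF a, of 0 c c] \<rho>(1) by (simp add: height_0 \<beta>_def)
  have "(4 / 3)-lipschitz_on UNIV (height w e x a)"
  proof (rule lipschitz_onI)
    fix c1 c2
    show "dist (height w e x a c1) (height w e x a c2) \<le> 4 / 3 * dist c1 c2"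
    proof -
      have "\<bar>height w e x a c1 - height w e x a c2\<bar>
          \<le> \<bar>height w e x a c1 - height w e x a c2 - (c1 - c2)\<bar> + \<bar>c1 - c2\<bar>" by linarith
      then show ?thesis using height_mono[OF a a, of c1 c2] by (simp add: dist_real_def)
    qed
  qed simp
  then have "continuous_on {z - \<beta>..z + \<beta>} (height w e x a)"
    using lipschitz_on_continuous_on continuous_on_subset by blast
  then show ?thesis
    using IVT'[of "height w e x a" "z - \<beta>" z "z + \<beta>"] near[of "z - \<beta>"] near[of "z + \<beta>"] \<beta> by (auto simp: abs_le_iff)
qed

lemma level_iff:
  assumes "norm (horiz (p - x)) < \<rho>"
  shows "level p = c \<longleftrightarrow> height w e x (horiz (p - x)) c = (p - x) \<bullet> e"
proof -
  obtain c0 where c0: "height w e x (horiz (p - x)) c0 = (p - x) \<bullet> e" using height_surj[OF assms] by blast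
  then have "level p = c0" unfolding level_def using height_inj[OF assms] by (intro the_equality) auto
  with c0 show ?thesis using height_inj[OF assms] by metis
qed

lemma leaf_level:
  assumes "norm (horiz (p - x)) < \<rho>"
  shows "leaf (level p) (horiz (p - x)) = p"
proof -
  have "height w e x (horiz (p - x)) (level p) = (p - x) \<bullet> e" using level_iff[OF assms] by blast
  then show ?thesis using horiz_decomp[of "p - x"] by (simp add: leaf_def add.assoc)
qed

lemma level_leaf:
  assumes "norm a < \<rho>" "a \<bullet> e = 0"
  shows "level (leaf c a) = c" "horiz (leaf c a - x) = a"
proof -
  show *: "horiz (leaf c a - x) = a" using assms(2) by (simp add: leaf_def horiz_simps horiz_id)
  have "(leaf c a - x) \<bullet> e = height w e x a c" using assms(2) by (simp add: leaf_def inner_add_left e_e)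
  then show "level (leaf c a) = c" using level_iff[of "leaf c a" c] * assms(1) by simp
qed

lemma level_compare:
  assumes "norm (horiz (p - x)) < \<rho>" "norm (horiz (q - x)) < \<rho>"
  shows "\<bar>(p - q) \<bullet> e - (level p - level q)\<bar> \<le> (B - 1) * norm (horiz (p - q)) + \<bar>level p - level q\<bar> / 3"
proof -
  have "height w e x (horiz (p - x)) (level p) = (p - x) \<bullet> e" "height w e x (horiz (q - x)) (level q) = (q - x) \<bullet> e"
    using level_iff assms by blast+
  moreover have "horiz (p - x) - horiz (q - x) = horiz (p - q)" by (simp flip: horiz_simps(2))
  moreover have "(p - x) \<bullet> e - (q - x) \<bullet> e = (p - q) \<bullet> e" by (simp add: inner_diff_left)
  ultimately show ?thesis using height_mono[OF assms, of "level p" "level q"] by simp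
qed

lemma level_lipschitz:
  assumes "norm (horiz (p - x)) < \<rho>" "norm (horiz (q - x)) < \<rho>"
  shows "\<bar>level p - level q\<bar> \<le> 3 / 2 * B * norm (p - q)"
proof -
  have "(B - 1) * norm (horiz (p - q)) \<le> (B - 1) * norm (p - q)"
    using B_ge norm_horiz by (intro mult_left_mono) auto
  moreover have "(B - 1) * norm (p - q) = B * norm (p - q) - norm (p - q)" by (simp add: algebra_simps)
  moreover have "\<bar>level p - level q\<bar> \<le> \<bar>(p - q) \<bullet> e\<bar> + \<bar>(p - q) \<bullet> e - (level p - level q)\<bar>" by linarith
  ultimately have "2 / 3 * \<bar>level p - level q\<bar> \<le> B * norm (p - q)"
    using level_compare[OF assms] abs_inner_e[of "p - q"] by simp
  then show ?thesis by simp
qed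

text \<open>By \<open>level_compare\<close> the rise of the level differs from \<open>s\<close> by
  at most a third of its own size, hence is positive and at least \<open>3 / 4 * s\<close>. This
  quantitative growth stands in for a derivative of \<open>level\<close> along
  \<open>e\<close>.\<close>

lemma level_vertical:
  assumes p: "norm (horiz (p - x)) < \<rho>" and s: "0 < s"
  shows "level p + 3 / 4 * s \<le> level (p + s *\<^sub>R e)"
proof -
  have h: "horiz (p + s *\<^sub>R e - x) = horiz (p - x)" by (simp add: horiz_simps)
  have "\<bar>s - (level (p + s *\<^sub>R e) - level p)\<bar> \<le> \<bar>level (p + s *\<^sub>R e) - level p\<bar> / 3"
    using level_compare[of "p + s *\<^sub>R e" p] p h by (simp add: horiz_simps e_e)
  moreover have "s - (level (p + s *\<^sub>R e) - level p) \<le> \<bar>s - (level (p + s *\<^sub>R e) - level p)\<bar>" by simp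
  ultimately have "s - (level (p + s *\<^sub>R e) - level p) \<le> \<bar>level (p + s *\<^sub>R e) - level p\<bar> / 3" by linarith
  then show ?thesis using s by (cases "level p \<le> level (p + s *\<^sub>R e)") auto
qed

lemma level_bound:
  assumes "norm (p - x) < \<rho>"
  shows "\<bar>level p\<bar> \<le> 3 / 2 * B * norm (p - x)"
proof -
  have p: "norm (horiz (p - x)) < \<rho>" using norm_horiz[of "p - x"] assms by simp
  have "level x = 0" using level_iff[of x 0] \<rho>(1) by (simp add: horiz_simps height_0)
  then show ?thesis using level_lipschitz[OF p, of x] \<rho>(1) by (simp add: horiz_simps)
qed

text \<open>The remainder in \<open>taylor\<close> is quadratic, so the gradient is
  \<open>- w\<close> at the leaf point; being continuous there, it makes the leaves
  \<open>C1\<close> although \<open>w\<close> is only Lipschitz.\<close>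

lemma height_has_derivative:
  assumes a: "norm a < \<rho>" and c: "\<bar>c\<bar> < \<sigma>"
  shows "((\<lambda>a. height w e x a c) has_derivative (\<lambda>v. - (w (leaf c a) \<bullet> v))) (at a)"
  unfolding has_derivative_within_alt
proof (intro conjI allI impI)
  show "bounded_linear (\<lambda>v. - (w (leaf c a) \<bullet> v))" by (intro bounded_linear_minus bounded_linear_inner_right)
  fix r :: real assume r: "0 < r"
  define d where "d = min (\<rho> - norm a) (r / (\<bar>Q\<bar> + 1))"
  have d: "0 < d" using a r by (simp add: d_def)
  have "norm (height w e x b c - height w e x a c - - (w (leaf c a) \<bullet> (b - a))) \<le> r * norm (b - a)"
    if b: "norm (b - a) < d" for b
  proof -
    have "norm b \<le> norm (b - a) + norm a" using norm_triangle_sub[of b a] by simp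
    then have nb: "norm b < \<rho>" using b by (simp add: d_def)
    have "\<bar>Q\<bar> * norm (b - a) \<le> r"
    proof -
      have "\<bar>Q\<bar> * norm (b - a) \<le> (\<bar>Q\<bar> + 1) * (r / (\<bar>Q\<bar> + 1))" using b r by (intro mult_mono) (auto simp: d_def)
      also have "\<dots> = r" by simp
      finally show ?thesis .
    qed
    then have "\<bar>Q\<bar> * norm (b - a) * norm (b - a) \<le> r * norm (b - a)" by (intro mult_right_mono) auto
    moreover have "Q * norm (b - a) * norm (b - a) \<le> \<bar>Q\<bar> * norm (b - a) * norm (b - a)"
      by (intro mult_right_mono) auto
    ultimately show ?thesis using taylor[OF a nb c] by (simp add: leaf_def)
  qed
  with d show "\<exists>d>0. \<forall>y\<in>UNIV. norm (y - a) < d \<longrightarrow>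
      norm (height w e x y c - height w e x a c - - (w (leaf c a) \<bullet> (y - a))) \<le> r * norm (y - a)" by blast
qed

lemma continuous_on_leaf: "\<bar>c\<bar> < \<sigma> \<Longrightarrow> continuous_on (ball 0 \<rho>) (leaf c)"
proof -
  assume c: "\<bar>c\<bar> < \<sigma>"
  have "continuous_on (ball 0 \<rho>) (\<lambda>a. height w e x a c)"
    by (rule has_derivative_continuous_on, rule has_derivative_at_withinI, rule height_has_derivative[OF _ c]) simp
  then show ?thesis unfolding leaf_def by (intro continuous_intros)
qed

text \<open>A single chart covers the whole level set: the horizontal projection, with inverse
  \<open>leaf c\<close>. Differentiability of the inverse comes from
  \<open>height_has_derivative\<close>, and its derivative is continuous because it is expressed
  through \<open>w\<close> on the leaf.\<close>

lemma level_set_manifold: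
  assumes V: "open V" "V \<subseteq> ball x \<rho>" and p0: "p0 \<in> V" and c: "\<bar>level p0\<bar> < \<sigma>"
  shows "C1_manifold (DIM('a) - 1) (level_set V level p0)"
proof -
  define c where "c = level p0"
  define N where "N = level_set V level p0"
  define L where "L = {v. e \<bullet> v = 0}"
  define W where "W = L \<inter> (ball 0 \<rho> \<inter> leaf c -` V)"
  define f where "f = (\<lambda>p. horiz (p - x))"
  have c\<sigma>: "\<bar>c\<bar> < \<sigma>" using c by (simp add: c_def)
  have e0: "e \<noteq> 0" using norm_e by auto
  have small_V: "norm (horiz (p - x)) < \<rho>" if "p \<in> V" for p
    using norm_horiz[of "p - x"] V(2) that by (force simp: dist_norm norm_minus_commute)
  have "open (ball 0 \<rho> \<inter> leaf c -` V)"
    by (rule continuous_open_preimage[OF continuous_on_leaf[OF c\<sigma>] open_ball V(1)])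
  then have Wo: "openin (top_of_set L) W" unfolding W_def by (intro openin_open_Int)
  have fh: "leaf c (f p) = p" "f p \<in> W" if "p \<in> N" for p
  proof -
    have p: "p \<in> V" "level p = c" using that by (auto simp: N_def level_set_def c_def)
    show *: "leaf c (f p) = p" using leaf_level[OF small_V[OF p(1)]] p(2) by (simp add: f_def)
    have "f p \<bullet> e = 0" by (simp add: f_def horiz_simps(6))
    then show "f p \<in> W" using * p small_V[OF p(1)] by (simp add: W_def L_def f_def inner_commute)
  qed
  have hf: "f (leaf c a) = a" "leaf c a \<in> N" if "a \<in> W" for a
  proof -
    have a: "norm a < \<rho>" "a \<bullet> e = 0" "leaf c a \<in> V" using that by (auto simp: W_def L_def inner_commute)
    show "f (leaf c a) = a" using level_leaf(2)[OF a(1,2)] by (simp add: f_def)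
    show "leaf c a \<in> N" using level_leaf(1)[OF a(1,2)] a(3) by (simp add: N_def level_set_def c_def)
  qed
  have homeo: "homeomorphism N W f (leaf c)"
  proof (rule homeomorphismI)
    show "continuous_on N f" unfolding f_def by (intro continuous_intros)
    show "continuous_on W (leaf c)" by (rule continuous_on_subset[OF continuous_on_leaf[OF c\<sigma>]]) (auto simp: W_def)
  qed (use fh hf in auto)
  have fC1: "C1_map_on N f"
    unfolding C1_map_on_def
  proof
    fix p assume "p \<in> N"
    have "(f has_derivative blinfun_apply (Blinfun horiz)) (at y)" for y
    proof -
      have "((\<lambda>p. horiz (p - x)) has_derivative (\<lambda>v. horiz (v - 0))) (at y)"
        by (intro bounded_linear.has_derivative[OF bounded_linear_horiz] derivative_intros)
      then show ?thesis by (simp add: f_def bounded_linear_Blinfun_apply[OF bounded_linear_horiz])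
    qed
    then show "\<exists>N' F (F' :: 'a \<Rightarrow> 'a \<Rightarrow>\<^sub>L 'a). open N' \<and> p \<in> N' \<and> (\<forall>y\<in>N'. (F has_derivative blinfun_apply (F' y)) (at y)) \<and>
        continuous_on N' F' \<and> (\<forall>y\<in>N \<inter> N'. F y = f y)"
      by (intro exI[of _ UNIV] exI[of _ f] exI[of _ "\<lambda>_. Blinfun horiz"]) auto
  qed
  have hC1: "C1_map_on W (leaf c)"
    unfolding C1_map_on_def
  proof
    fix a assume a: "a \<in> W"
    define Dom where "Dom = horiz -` ball 0 \<rho>"
    define H where "H = (\<lambda>v. leaf c (horiz v))"
    define H' where "H' = (\<lambda>v. Blinfun (\<lambda>d. horiz d - (w (H v) \<bullet> horiz d) *\<^sub>R e))"
    have cont_horiz: "continuous_on UNIV horiz" using continuous_on_horiz[OF continuous_on_id] by simp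
    have Dom: "open Dom" unfolding Dom_def by (rule open_vimage[OF open_ball cont_horiz])
    have aO: "a \<in> Dom" using a norm_horiz[of a] by (auto simp: Dom_def W_def)
    have bl: "bounded_linear (\<lambda>d. horiz d - (w (H v) \<bullet> horiz d) *\<^sub>R e)" for v
      by (intro bounded_linear_sub bounded_linear_horiz
          bounded_linear_compose[OF bounded_linear_scaleR_left, of "\<lambda>d. w (H v) \<bullet> horiz d"]
          bounded_linear_compose[OF bounded_linear_inner_right bounded_linear_horiz])
    have dH: "(H has_derivative blinfun_apply (H' v)) (at v)" if "v \<in> Dom" for v
    proof -
      have hv: "(horiz has_derivative horiz) (at v)"
        by (rule bounded_linear_imp_has_derivative[OF bounded_linear_horiz])
      have "((\<lambda>v. height w e x (horiz v) c) has_derivative (\<lambda>d. - (w (leaf c (horiz v)) \<bullet> horiz d))) (at v)"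
        by (rule has_derivative_compose[OF hv height_has_derivative[OF _ c\<sigma>]]) (use that in \<open>simp add: Dom_def\<close>)
      then have "(H has_derivative (\<lambda>d. 0 + horiz d + (- (w (leaf c (horiz v)) \<bullet> horiz d)) *\<^sub>R e)) (at v)"
        unfolding H_def leaf_def
        by (intro has_derivative_add has_derivative_const hv has_derivative_scaleR_left)
      then show ?thesis unfolding H'_def bounded_linear_Blinfun_apply[OF bl] by (simp add: H_def)
    qed
    have cH: "continuous_on Dom H"
      unfolding H_def
      by (rule continuous_on_compose2[OF continuous_on_leaf[OF c\<sigma>] continuous_on_subset[OF cont_horiz]])
        (auto simp: Dom_def)
    have cH': "continuous_on Dom H'"
    proof (rule continuous_on_blinfun_componentwise)
      fix i :: 'a
      have "continuous_on Dom (\<lambda>v. horiz i - (w (H v) \<bullet> horiz i) *\<^sub>R e)"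
        by (intro continuous_intros continuous_on_compose2[OF w_cont[of UNIV] cH]) auto
      then show "continuous_on Dom (\<lambda>v. blinfun_apply (H' v) i)"
        by (simp add: H'_def bounded_linear_Blinfun_apply[OF bl])
    qed
    have "H y = leaf c y" if "y \<in> W" for y using that by (simp add: H_def W_def L_def horiz_id inner_commute)
    then show "\<exists>N' F (F' :: 'a \<Rightarrow> 'a \<Rightarrow>\<^sub>L 'a). open N' \<and> a \<in> N' \<and> (\<forall>y\<in>N'. (F has_derivative blinfun_apply (F' y)) (at y)) \<and>
        continuous_on N' F' \<and> (\<forall>y\<in>W \<inter> N'. F y = leaf c y)"
      using Dom aO dH cH' by (intro exI[of _ Dom] exI[of _ H] exI[of _ H']) auto
  qed
  show ?thesis
    unfolding C1_manifold_def N_def[symmetric]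
  proof
    fix p assume p: "p \<in> N"
    have "subspace L" "dim L = DIM('a) - 1"
      unfolding L_def using e0 by (auto simp: subspace_hyperplane dim_hyperplane)
    moreover have "C1_diffeomorphic N W" unfolding C1_diffeomorphic_def using homeo fC1 hC1 by blast
    ultimately show "\<exists>N' L W. p \<in> N' \<and> openin (top_of_set N) N' \<and> subspace (L :: 'a set) \<and> dim L = DIM('a) - 1 \<and>
        openin (top_of_set L) W \<and> C1_diffeomorphic N' W"
      using p Wo by (intro exI[of _ N] exI[of _ L] exI[of _ W]) auto
  qed
qed

text \<open>\<open>G\<close> vanishes along every curve in the level set, and its gradient at
  \<open>p\<close> is \<open>w p\<close> because \<open>w p \<bullet> e = 1\<close>.\<close>

lemma level_set_normal:
  assumes V: "V \<subseteq> ball x \<rho>" and p0: "p0 \<in> V" and c: "\<bar>level p0\<bar> < \<sigma>"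
  shows "normal_field (level_set V level p0) w"
  unfolding normal_field_def
proof (intro ballI)
  fix p v assume p: "p \<in> level_set V level p0" and v: "v \<in> tangent_space (level_set V level p0) p"
  define c where "c = level p0"
  have small_V: "norm (horiz (q - x)) < \<rho>" if "q \<in> V" for q
    using norm_horiz[of "q - x"] V that by (force simp: dist_norm norm_minus_commute)
  obtain k d where k: "0 < d" "k ` {-d<..<d} \<subseteq> level_set V level p0" "k 0 = p" "(k has_vector_derivative v) (at 0)"
    using v unfolding tangent_space_def by auto
  define G where "G = (\<lambda>q. (q - x) \<bullet> e - height w e x (horiz (q - x)) c)"
  have Gk: "G (k s) = 0" if "s \<in> {-d<..<d}" for s
  proof -
    have "k s \<in> level_set V level p0" using k(2) that by blast
    then have "k s \<in> V" "level (k s) = c" by (auto simp: level_set_def c_def)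
    then show ?thesis using level_iff[OF small_V] by (simp add: G_def)
  qed
  have pV: "p \<in> V" "level p = c" using p by (auto simp: level_set_def c_def)
  have leaf_p: "leaf c (horiz (p - x)) = p" using leaf_level[OF small_V[OF pV(1)]] pV(2) by simp
  have hp: "((\<lambda>q. horiz (q - x)) has_derivative horiz) (at p)"
  proof -
    have "((\<lambda>q. horiz (q - x)) has_derivative (\<lambda>v. horiz (v - 0))) (at p)"
      by (intro bounded_linear.has_derivative[OF bounded_linear_horiz] derivative_intros)
    then show ?thesis by simp
  qed
  have "((\<lambda>q. height w e x (horiz (q - x)) c) has_derivative (\<lambda>v. - (w p \<bullet> horiz v))) (at p)"
    using has_derivative_compose[OF hp height_has_derivative[OF small_V[OF pV(1)]], of c] c
    by (simp add: leaf_p c_def[symmetric])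
  then have dG: "(G has_derivative (\<lambda>v. (v - 0) \<bullet> e - - (w p \<bullet> horiz v))) (at (k 0))"
    unfolding G_def k(3) by (intro has_derivative_diff has_derivative_inner_left has_derivative_ident has_derivative_const)
  have "((\<lambda>s. G (k s)) has_derivative (\<lambda>s. (s *\<^sub>R v - 0) \<bullet> e - - (w p \<bullet> horiz (s *\<^sub>R v)))) (at 0)"
    by (rule has_derivative_compose[OF k(4)[unfolded has_vector_derivative_def] dG])
  moreover have "((\<lambda>s. G (k s)) has_derivative (\<lambda>s. 0)) (at 0)"
  proof (rule has_derivative_transform_eventually[where f = "\<lambda>_. 0"])
    have "\<forall>\<^sub>F s in at 0. s \<in> {-d<..<d}" using k(1) by (intro eventually_at_in_open') auto
    then show "\<forall>\<^sub>F s in at 0. 0 = G (k s)" by eventually_elim (simp add: Gk)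
  qed (use k(1) Gk[of 0] in auto)
  ultimately have "(\<lambda>s. (s *\<^sub>R v - 0) \<bullet> e - - (w p \<bullet> horiz (s *\<^sub>R v))) = (\<lambda>s::real. 0)"
    by (rule has_derivative_unique)
  from fun_cong[OF this, of 1] have "v \<bullet> e + w p \<bullet> horiz v = 0" by simp
  then show "w p \<bullet> v = 0" by (simp add: horiz_def inner_diff_right w_e)
qed

text \<open>Growth along \<open>e\<close> at rate at least 3/4 rules out local extrema and zero
  gradients. \<open>increase_transfer\<close> carries the growth over to the direction
  \<open>g p\<close> at all points of a short segment, which gives strict monotonicity
  there.\<close>

lemma regular_solution_level:
  assumes \<rho>': "0 < \<rho>'" "\<rho>' \<le> \<rho>" "3 / 2 * B * \<rho>' \<le> \<sigma>" and U: "ball x \<rho>' \<subseteq> U" and cg: "continuous_on U g"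
    and gw: "\<And>p. p \<in> ball x \<rho>' \<Longrightarrow> 0 < g p \<bullet> e \<and> g p = (g p \<bullet> e) *\<^sub>R w p"
  shows "regular_solution U g (ball x \<rho>') level"
proof -
  define V where "V = ball x \<rho>'"
  have V: "open V" "V \<subseteq> ball x \<rho>" "V \<subseteq> U" using \<rho>'(2) U by (auto simp: V_def)
  have small_V: "norm (horiz (p - x)) < \<rho>" if "p \<in> V" for p
    using norm_horiz[of "p - x"] V(2) that by (force simp: dist_norm norm_minus_commute)
  have level_V: "\<bar>level p\<bar> < \<sigma>" if "p \<in> V" for p
  proof -
    have p: "norm (p - x) < \<rho>'" using that by (simp add: V_def dist_norm norm_minus_commute)
    have "\<bar>level p\<bar> \<le> 3 / 2 * B * norm (p - x)" using level_bound p \<rho>'(2) by simp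
    also have "\<dots> < 3 / 2 * B * \<rho>'" using p B_ge by (intro mult_strict_left_mono) auto
    finally show ?thesis using \<rho>'(3) by simp
  qed
  have lip: "(3 / 2 * B)-lipschitz_on V level"
    using level_lipschitz small_V B_ge by (intro lipschitz_onI) (auto simp: dist_norm)
  then have cl: "continuous_on V level" by (rule lipschitz_on_continuous_on)
  have man: "C1_manifold (DIM('a) - 1) (level_set V level p)" if "p \<in> V" for p
    using level_set_manifold[OF V(1,2) that level_V[OF that]] .
  have nf: "normal_field (level_set V level p) g" if "p \<in> V" for p
    unfolding normal_field_def
  proof (intro ballI)
    fix q v assume q: "q \<in> level_set V level p" and v: "v \<in> tangent_space (level_set V level p) q"
    have "w q \<bullet> v = 0" using level_set_normal[OF V(2) that level_V[OF that]] q v unfolding normal_field_def by blast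
    moreover have "g q = (g q \<bullet> e) *\<^sub>R w q" using gw q by (auto simp: level_set_def V_def)
    ultimately show "g q \<bullet> v = 0" by (metis inner_scaleR_left mult_zero_right)
  qed
  have up: "\<forall>\<^sub>F s in at_right 0. level p + 3 / 4 * s \<le> level (p + s *\<^sub>R e)" if "p \<in> V" for p
    using eventually_at_right_less[of 0] by eventually_elim (rule level_vertical[OF small_V[OF that]])
  have up_strict: "\<forall>\<^sub>F s in at_right 0. level p < level (p + s *\<^sub>R e)" if "p \<in> V" for p
    using up[OF that] eventually_at_right_less[of 0] by eventually_elim simp
  have down: "level (p + (- s) *\<^sub>R e) < level p" if "p \<in> V" "0 < s" for p s
  proof -
    have "horiz (p + (- s) *\<^sub>R e - x) = horiz (p - x)" by (simp add: horiz_simps)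
    then show ?thesis using level_vertical[of "p + (- s) *\<^sub>R e" s] small_V[OF that(1)] that(2) by simp
  qed
  have approach: "filterlim (\<lambda>s. p + (k * s) *\<^sub>R e) (at p within V) (at_right 0)" if p: "p \<in> V" and k: "k \<noteq> 0" for p k
  proof -
    have "((\<lambda>s. p + s *\<^sub>R (k *\<^sub>R e)) \<longlongrightarrow> p) (at_right 0)" by (rule line_tendsto)
    moreover have "\<forall>\<^sub>F s in at_right 0. p + s *\<^sub>R (k *\<^sub>R e) \<in> V" using eventually_line_in_open[OF V(1) p] .
    moreover have "\<forall>\<^sub>F s in at_right 0. p + s *\<^sub>R (k *\<^sub>R e) \<noteq> p"
      using eventually_at_right_less[of 0] by eventually_elim (use k norm_e in auto)
    ultimately have "filterlim (\<lambda>s. p + s *\<^sub>R (k *\<^sub>R e)) (at p within V) (at_right 0)"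
      unfolding filterlim_at by (auto elim: eventually_elim2)
    then show ?thesis by (simp add: mult.commute)
  qed
  have no_max: "\<not> local_max_point V level p" for p
  proof
    assume "local_max_point V level p"
    then have p: "p \<in> V" and ev: "\<forall>\<^sub>F y in at p within V. level y \<le> level p" by (auto simp: local_max_point_def)
    have "\<forall>\<^sub>F s in at_right 0. level (p + (1 * s) *\<^sub>R e) \<le> level p"
      using eventually_compose_filterlim[OF ev approach[OF p, of 1]] by simp
    with up_strict[OF p] have "\<forall>\<^sub>F s in at_right (0::real). False" by eventually_elim simp
    then show False by simp
  qed
  have no_min: "\<not> local_min_point V level p" for p
  proof
    assume "local_min_point V level p"
    then have p: "p \<in> V" and ev: "\<forall>\<^sub>F y in at p within V. level p \<le> level y" by (auto simp: local_min_point_def)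
    have "\<forall>\<^sub>F s in at_right 0. level p \<le> level (p + (- 1 * s) *\<^sub>R e)"
      using eventually_compose_filterlim[OF ev approach[OF p, of "- 1"]] by simp
    with eventually_at_right_less[of 0] have "\<forall>\<^sub>F s in at_right (0::real). False"
      by eventually_elim (use down[OF p] in force)
    then show False by simp
  qed
  have grad: "d \<noteq> 0" if p: "p \<in> V" and d: "GDERIV level p :> d" for p d
  proof
    assume "d = 0"
    then have "(level has_derivative (\<lambda>h. 0)) (at p)" using d by (simp add: gderiv_def)
    then obtain \<delta> where \<delta>: "0 < \<delta>" "\<And>y. norm (y - p) < \<delta> \<Longrightarrow> norm (level y - level p - 0) \<le> 1 / 2 * norm (y - p)"
      using has_derivative_little_o[of level "\<lambda>h. 0" p "1 / 2"] by auto
    have "level p + 3 / 4 * (\<delta> / 2) \<le> level (p + (\<delta> / 2) *\<^sub>R e)"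
      by (rule level_vertical[OF small_V[OF p]]) (use \<delta>(1) in simp)
    moreover have "norm (level (p + (\<delta> / 2) *\<^sub>R e) - level p - 0) \<le> 1 / 2 * norm (p + (\<delta> / 2) *\<^sub>R e - p)"
      using \<delta>(1) norm_e by (intro \<delta>(2)) simp
    ultimately show False using \<delta>(1) norm_e by simp
  qed
  have normal: "normal_solution U g V level"
    unfolding normal_solution_def
  proof (intro conjI ballI allI impI)
    show "locally_lipschitz_on V level"
      unfolding locally_lipschitz_on_def using lipschitz_on_subset[OF lip] by blast
    show "C1_manifold (DIM('a) - 1) (level_set V level p)" "normal_field (level_set V level p) g" if "p \<in> V" for p
      using man[OF that] nf[OF that] by auto
  qed (use V no_max no_min grad in auto)
  have incr: "\<exists>a b. a < 0 \<and> 0 < b \<and> (\<forall>t\<in>{a<..<b}. p + t *\<^sub>R g p \<in> V) \<and>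
      strict_mono_on {a<..<b} (\<lambda>t. level (p + t *\<^sub>R g p))" if p: "p \<in> V" for p
  proof -
    have gp: "g p \<noteq> 0" using gw p by (force simp: V_def)
    have lim: "((\<lambda>t. p + t *\<^sub>R g p) \<longlongrightarrow> p) (at 0)" by (rule line_tendsto)
    have "isCont g p" using cg V p by (metis continuous_on_eq_continuous_at continuous_on_subset)
    from isCont_tendsto_compose[OF this lim]
    have "((\<lambda>t. g (p + t *\<^sub>R g p) \<bullet> g p) \<longlongrightarrow> g p \<bullet> g p) (at 0)" by (intro tendsto_intros)
    then have "\<forall>\<^sub>F t in at 0. 0 < g (p + t *\<^sub>R g p) \<bullet> g p" using gp by (intro order_tendstoD) auto
    then have "\<forall>\<^sub>F t in at 0. 0 < g (p + t *\<^sub>R g p) \<bullet> g p \<and> p + t *\<^sub>R g p \<in> V"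
      using eventually_line_in_open[OF V(1) p, of "g p" UNIV] by eventually_elim simp
    then obtain \<delta> where \<delta>: "0 < \<delta>" "\<And>t. t \<noteq> 0 \<Longrightarrow> \<bar>t\<bar> < \<delta> \<Longrightarrow> 0 < g (p + t *\<^sub>R g p) \<bullet> g p \<and> p + t *\<^sub>R g p \<in> V"
      unfolding eventually_at by (auto simp: dist_real_def)
    have \<delta>': "0 < g (p + t *\<^sub>R g p) \<bullet> g p" "p + t *\<^sub>R g p \<in> V" if "\<bar>t\<bar> < \<delta>" for t
      using \<delta>(2)[of t] that gp p by (cases "t = 0"; simp)+
    have "level (p + t1 *\<^sub>R g p) < level (p + t2 *\<^sub>R g p)" if t: "t1 \<in> {-\<delta><..<\<delta>}" "t2 \<in> {-\<delta><..<\<delta>}" "t1 < t2" for t1 t2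
    proof (rule strict_increase_on_interval[where f = "\<lambda>t. level (p + t *\<^sub>R g p)"])
      show "t1 < t2" by fact
      show "continuous_on {t1..t2} (\<lambda>t. level (p + t *\<^sub>R g p))"
        by (rule continuous_on_compose2[OF cl], intro continuous_intros) (use t \<delta>'(2) in auto)
      fix s assume s: "t1 \<le> s" "s < t2"
      define q where "q = p + s *\<^sub>R g p"
      have q: "q \<in> V" "0 < g q \<bullet> g p" using \<delta>'[of s] s t by (auto simp: q_def)
      have gq: "0 < g q \<bullet> e" using gw q(1) by (auto simp: V_def)
      then have gq0: "g q \<noteq> 0" by auto
      have "\<forall>\<^sub>F \<tau> in at_right 0. level q < level (q + \<tau> *\<^sub>R g p)"
        by (rule increase_transfer[OF V(1) q(1) cl man[OF q(1)] nf[OF q(1)] gq0 gq up_strict[OF q(1)] q(2)])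
      then have "\<forall>\<^sub>F \<tau> in at_right 0. \<tau> \<in> {0<..<t2 - s} \<and> level q < level (q + \<tau> *\<^sub>R g p)"
        using eventually_at_right_real[of 0 "t2 - s"] s by (auto elim: eventually_elim2)
      then obtain \<tau> where \<tau>: "\<tau> \<in> {0<..<t2 - s}" "level q < level (q + \<tau> *\<^sub>R g p)"
        using eventually_happens trivial_limit_at_right_real by blast
      have eq: "q + \<tau> *\<^sub>R g p = p + (s + \<tau>) *\<^sub>R g p" by (simp add: q_def algebra_simps)
      have "level (p + s *\<^sub>R g p) < level (p + (s + \<tau>) *\<^sub>R g p)" using \<tau>(2)[unfolded eq] by (simp only: q_def)
      then show "\<exists>s'>s. s' \<le> t2 \<and> level (p + s *\<^sub>R g p) < level (p + s' *\<^sub>R g p)"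
        using \<tau>(1) by (intro exI[of _ "s + \<tau>"]) auto
    qed
    then have "strict_mono_on {-\<delta><..<\<delta>} (\<lambda>t. level (p + t *\<^sub>R g p))" by (rule strict_mono_onI)
    then show ?thesis using \<delta>(1) \<delta>'(2) by (intro exI[of _ "- \<delta>"] exI[of _ \<delta>]) auto
  qed
  show ?thesis
    unfolding regular_solution_def V_def[symmetric]
    using normal incr connected_ball[of x \<rho>'] by (auto simp: V_def[symmetric])
qed

end

section \<open>Local existence of regular solutions, and the equivalence\<close>

lemma regular_solution_exists:
  fixes g :: "real ^ 'n::finite \<Rightarrow> real ^ 'n"
  assumes U: "open U" and g0: "\<And>x. x \<in> U \<Longrightarrow> g x \<noteq> 0" and lip: "locally_lipschitz_on U g"
    and jac: "jacobi_integrable U g" and x: "x \<in> U"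
  shows "\<exists>V u. x \<in> V \<and> regular_solution U g V u \<and> convex V"
proof -
  obtain w e K M r where tf: "transversal_field w e K M" and r: "0 < r" "ball x r \<subseteq> U"
    and gw: "\<And>p. p \<in> ball x r \<Longrightarrow> 0 < g p \<bullet> e \<and> g p = (g p \<bullet> e) *\<^sub>R w p"
    using transversal_field_near[OF U x g0[OF x] lip] by metis
  interpret transversal_field w e K M by (rule tf)
  define b where "b = 1 + (1 + 4 * M) / 3"
  have b: "1 \<le> b" using M_pos by (simp add: b_def)
  \<comment> \<open>Directions shorter than \<open>\<rho>\<close> meet the bounds 1 and
    \<open>1 / (4 * K)\<close>. Rays must also stay in the ball of radius \<open>r / 4\<close>: the
    reach \<open>b * \<rho>\<close> and the starting height below \<open>\<sigma>\<close> take
    \<open>r / 8\<close> each.\<close>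
  define \<rho> where "\<rho> = min (min 1 (1 / (4 * K))) (r / (8 * b))"
  define \<sigma> where "\<sigma> = r / 8"
  have \<rho>: "0 < \<rho>" "\<rho> \<le> 1" "K * \<rho> \<le> 1 / 4" "b * \<rho> \<le> r / 8"
  proof -
    show "0 < \<rho>" "\<rho> \<le> 1" using K_pos r(1) b by (auto simp: \<rho>_def)
    have "K * \<rho> \<le> K * (1 / (4 * K))" using K_pos by (intro mult_left_mono) (auto simp: \<rho>_def)
    then show "K * \<rho> \<le> 1 / 4" using K_pos by simp
    have "b * \<rho> \<le> b * (r / (8 * b))" using b by (intro mult_left_mono) (auto simp: \<rho>_def)
    then show "b * \<rho> \<le> r / 8" using b by simp
  qed
  interpret foliation w e K M x \<rho> \<sigma> "K * b"
  proof
    show "0 < \<rho>" "K * \<rho> \<le> 1 / 4" "0 < \<sigma>" using \<rho> r(1) by (auto simp: \<sigma>_def)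
    fix a y :: "real ^ 'n" and c :: real assume ab: "norm a < \<rho>" "norm y < \<rho>" and c: "\<bar>c\<bar> < \<sigma>"
    show "\<bar>height w e x y c - height w e x a c + w (x + a + height w e x a c *\<^sub>R e) \<bullet> (y - a)\<bar>
        \<le> K * b * norm (y - a) * norm (y - a)"
    proof (rule height_taylor[of "r / 4" x "r / 4" "4 * K * (CARD('n) * K)" \<rho>])
      show "nearly_integrable_approx w e K M (ball x (r / 4)) (4 * K * (CARD('n) * K)) \<epsilon>" if "0 < \<epsilon>" "\<epsilon> < r / 4" for \<epsilon>
        by (rule integrable_field_approximable[OF tf r gw U lip jac that])
      show "b * \<rho> + \<bar>c\<bar> \<le> r / 4" using \<rho>(4) c by (simp add: \<sigma>_def)
    qed (use \<rho> r(1) K_pos ab b_def in auto)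
  qed
  \<comment> \<open>Levels on the final ball are below \<open>3 / 2 * b * \<rho>'\<close>, at most
    \<open>3 / 4 * \<sigma>\<close>, so only leaves covered by \<open>taylor\<close> occur.\<close>
  define \<rho>' where "\<rho>' = min (min \<rho> r) (\<sigma> / (2 * b))"
  have \<rho>': "0 < \<rho>'" "\<rho>' \<le> \<rho>" "\<rho>' \<le> r" using \<rho>(1) r(1) \<sigma> b by (auto simp: \<rho>'_def)
  have "3 / 2 * b * \<rho>' \<le> 3 / 2 * b * (\<sigma> / (2 * b))" using b by (intro mult_left_mono) (auto simp: \<rho>'_def)
  also have "\<dots> \<le> \<sigma>" using b \<sigma> by simp
  finally have bound: "3 / 2 * b * \<rho>' \<le> \<sigma>" .
  have sub: "ball x \<rho>' \<subseteq> ball x r" using \<rho>'(3) by auto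
  have "regular_solution U g (ball x \<rho>') level"
  proof (rule regular_solution_level[OF \<rho>'(1,2)])
    show "3 / 2 * B * \<rho>' \<le> \<sigma>" using bound unfolding b_def B_def .
    show "ball x \<rho>' \<subseteq> U" using sub r(2) by blast
    show "continuous_on U g" by (rule locally_lipschitz_on_imp_continuous_on[OF U lip])
    show "0 < g p \<bullet> e \<and> g p = (g p \<bullet> e) *\<^sub>R w p" if "p \<in> ball x \<rho>'" for p using gw sub that by blast
  qed
  moreover have "x \<in> ball x \<rho>'" using \<rho>'(1) by simp
  ultimately show ?thesis using convex_ball by blast
qed

theorem theorem3:
  fixes U :: "(real ^ 'n::finite) set" and g :: "real ^ 'n \<Rightarrow> real ^ 'n"
  assumes "open U"
    and "\<forall>x\<in>U. g x \<noteq> 0"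
    and "locally_lipschitz_on U g"
    and "jacobi_integrable U g"
  defines "cond_i \<equiv> \<forall>z\<in>U. \<exists>V. open V \<and> z \<in> V \<and> V \<subseteq> U \<and>
             (\<forall>x\<in>V. \<forall>y\<in>V. g x \<bullet> y \<ge> g x \<bullet> x \<longrightarrow> g y \<bullet> x \<le> g y \<bullet> y)"
    and "cond_ii \<equiv> \<forall>x\<in>U. \<forall>v. g x \<bullet> v = 0 \<longrightarrow>
             Limsup (at_right 0) (\<lambda>t. ereal (1 / t * (v \<bullet> g (x + t *\<^sub>R v)))) \<ge> 0"
    and "cond_iii \<equiv> \<forall>V u. regular_solution U g V u \<and> convex V \<longrightarrow> quasi_convex_on V u"
  shows "(cond_i \<longleftrightarrow> cond_ii) \<and> (cond_ii \<longleftrightarrow> cond_iii)"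
proof -
  have g0: "g x \<noteq> 0" if "x \<in> U" for x using assms(2) that by blast
  have i: "cond_i \<longleftrightarrow> (\<forall>z\<in>U. \<exists>V. open V \<and> z \<in> V \<and> V \<subseteq> U \<and> pseudo_monotone_on V g)"
    unfolding cond_i_def pseudo_monotone_on_def ..
  have ii: "cond_ii \<longleftrightarrow> tangentially_monotone_on U g"
    unfolding cond_ii_def tangentially_monotone_on_def ..
  have "cond_i" if "cond_ii"
    unfolding i
  proof
    fix z assume "z \<in> U"
    then obtain r where r: "0 < r" "ball z r \<subseteq> U" using assms(1) openE by blast
    then have "pseudo_monotone_on (ball z r) g"
      using tangentially_monotone_imp_pseudo_monotone[OF assms(1) g0 assms(3) that[unfolded ii] convex_ball r(2)] by blast
    then show "\<exists>V. open V \<and> z \<in> V \<and> V \<subseteq> U \<and> pseudo_monotone_on V g"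
      using r by (intro exI[of _ "ball z r"]) auto
  qed
  moreover have "cond_ii" if "cond_i"
    unfolding ii using pseudo_monotone_imp_tangentially_monotone that[unfolded i] by blast
  moreover have "cond_iii" if "cond_ii"
    unfolding cond_iii_def
    using tangentially_monotone_imp_quasi_convex[OF assms(1) g0 assms(3) that[unfolded ii]] by blast
  moreover have "cond_ii" if "cond_iii"
    unfolding ii
  proof (rule quasi_convex_imp_tangentially_monotone[OF g0])
    show "\<exists>V u. x \<in> V \<and> regular_solution U g V u \<and> convex V" if "x \<in> U" for x
      by (rule regular_solution_exists[OF assms(1) g0 assms(3,4) that])
    show "quasi_convex_on V u" if "regular_solution U g V u" "convex V" for V u
      using \<open>cond_iii\<close> that unfolding cond_iii_def by blast
  qed
  ultimately show ?thesis by blast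
qed

end
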